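(* Let $W\in\mathcal{C}^\infty(\mathbb{R}^d)$ be real-valued with $W(-x)=W(x)$ and let $I\subset\mathbb{R}$ be a compact interval. Then $\gamma\in\mathcal{C}^\infty(I,\mathfrak{g}_1^* )$ is a solution to the Vlasov equation $$\partial_t\gamma+v\cdot\nabla_x\gamma-2(\nabla W*\rho)\cdot\nabla_v\gamma=0,\qquad\rho=\int_{\mathbb{R}^d}d\gamma(\cdot,v)$$ (in the sense of distributions) if and only if $\dot\gamma=X_{\mathcal{H}_{Vl}}(\gamma)$, where $X_{\mathcal{H}_{Vl}}$ is the unique Hamiltonian vector field generated by $\mathcal{H}_{Vl}$ with respect to the Lie-Poisson space $(\mathfrak{g}_1^*,\{\cdot,\cdot\}_{\mathfrak{g}_1^*})$.
   Context: Fix $d\in\mathbb{N}$. $\mathfrak{g}_1=\mathcal{C}^\infty(\mathbb{R}^{2d})$ (real-valued, variables $z=(x,v)$) with the topology of uniform convergence of all derivatives on compact sets, and $[f,g]_{\mathfrak{g}_1}=\nabla_xf\cdot\nabla_vg-\nabla_vf\cdot\nabla_xg$. $\mathfrak{g}_1^*$ is its strong dual, i.e. the compactly supported distributions $\mathcal{E}'(\mathbb{R}^{2d})$. $\mathfrak{g}_1$ is reflexive, so for $\mathcal{F}\in\mathcal{C}^\infty(\mathfrak{g}_1^* )$ the Gâteaux derivative $\mathrm{d}\mathcal{F}[\gamma]$ is identified with an element of $\mathfrak{g}_1$. Smoothness is in the Gâteaux sense (all iterated directional derivatives $\mathrm{d}^nf:X\times X^n\to Y$ exist and are jointly continuous).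 $\{\mathcal{F},\mathcal{G}\}_{\mathfrak{g}_1^*}(\gamma):=\langle[\mathrm{d}\mathcal{F}[\gamma],\mathrm{d}\mathcal{G}[\gamma]]_{\mathfrak{g}_1},\gamma\rangle_{\mathfrak{g}_1-\mathfrak{g}_1^*}$, and $X_{\mathcal{G}}$ is the unique $\mathcal{C}^\infty$ map $\mathfrak{g}_1^*\to\mathfrak{g}_1^*$ with $\mathrm{d}\mathcal{F}[\gamma](X_{\mathcal{G}}(\gamma))=\{\mathcal{F},\mathcal{G}\}_{\mathfrak{g}_1^*}(\gamma)$ for all $\mathcal{F}\in\mathcal{C}^\infty(\mathfrak{g}_1^* )$, $\gamma\in\mathfrak{g}_1^*$. The density $\rho\in\mathcal{E}'(\mathbb{R}^d)$ of $\gamma$ is defined by $\langle f,\rho\rangle:=\langle f\otimes1,\gamma\rangle$, $(f\otimes1)(x,v)=f(x)$. The Vlasov Hamiltonian is $\mathcal{H}_{Vl}(\gamma):=\langle\tfrac12|v|^2,\gamma\rangle+\langle W(x_1-x_2),\gamma^{\otimes2}\rangle$, the second pairing being over $(\mathbb{R}^{2d})^2$ with variables $(x_1,v_1,x_2,v_2)$; $\mathcal{H}_{Vl}\in\mathcal{C}^\infty(\mathfrak{g}_1^* )$. *)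

theory Defs
  imports "HOL-Analysis.Analysis"
begin

section \<open>Topological vector spaces and strong duals\<close>

class topological_real_vector = real_vector + topological_monoid_add +
  assumes tendsto_scaleR_Pair:
    "((\<lambda>p. fst p *\<^sub>R snd p) \<longlongrightarrow> c *\<^sub>R a) (nhds c \<times>\<^sub>F nhds a)"

instance real_normed_vector \<subseteq> topological_real_vector
proof
  fix c :: real and a :: 'a
  show "((\<lambda>p. fst p *\<^sub>R snd p) \<longlongrightarrow> c *\<^sub>R a) (nhds c \<times>\<^sub>F nhds a)"
    by (intro tendsto_scaleR) (auto simp: filterlim_fst filterlim_snd)
qed

lemma tendsto_scaleR_tvs:
  fixes g :: "'b \<Rightarrow> 'a::topological_real_vector"
  assumes "(f \<longlongrightarrow> c) F" "(g \<longlongrightarrow> a) F"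
  shows "((\<lambda>x. f x *\<^sub>R g x) \<longlongrightarrow> c *\<^sub>R a) F"
  using filterlim_compose[OF tendsto_scaleR_Pair, of "\<lambda>x. (f x, g x)" c a F] assms
  by (simp add: nhds_prod[symmetric] tendsto_Pair)

definition tvs_bounded :: "'a::topological_real_vector set \<Rightarrow> bool" where
  "tvs_bounded B \<longleftrightarrow>
     (\<forall>U. open U \<and> 0 \<in> U \<longrightarrow> (\<exists>r>0. \<forall>s\<ge>r. B \<subseteq> (\<lambda>x. s *\<^sub>R x) ` U))"

lemma tvs_bounded_empty: "tvs_bounded {}"
  unfolding tvs_bounded_def using zero_less_one by blast

lemma tvs_bounded_Un:
  assumes "tvs_bounded A" "tvs_bounded B"
  shows "tvs_bounded (A \<union> B)"
  unfolding tvs_bounded_def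
proof (intro allI impI)
  fix U :: "'a set" assume U: "open U \<and> 0 \<in> U"
  obtain r where r: "r > 0" "\<forall>s\<ge>r. A \<subseteq> (\<lambda>x. s *\<^sub>R x) ` U"
    using assms(1) U unfolding tvs_bounded_def by blast
  obtain r' where r': "r' > 0" "\<forall>s\<ge>r'. B \<subseteq> (\<lambda>x. s *\<^sub>R x) ` U"
    using assms(2) U unfolding tvs_bounded_def by blast
  show "\<exists>r>0. \<forall>s\<ge>r. A \<union> B \<subseteq> (\<lambda>x. s *\<^sub>R x) ` U"
    using r r' by (intro exI[of _ "max r r'"]) auto
qed

lemma tvs_bounded_singleton: "tvs_bounded {f}"
  unfolding tvs_bounded_def
proof (intro allI impI)
  fix U :: "'a set" assume U: "open U \<and> 0 \<in> U"
  have "((\<lambda>s::real. inverse s *\<^sub>R f) \<longlongrightarrow> 0 *\<^sub>R f) at_top"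
    by (intro tendsto_scaleR_tvs tendsto_const tendsto_inverse_0_at_top filterlim_ident)
  then have "\<forall>\<^sub>F s::real in at_top. inverse s *\<^sub>R f \<in> U"
    using U by (auto simp: tendsto_def)
  then obtain r :: real where r: "\<forall>s\<ge>r. inverse s *\<^sub>R f \<in> U"
    by (auto simp: eventually_at_top_linorder)
  have "{f} \<subseteq> (\<lambda>x. s *\<^sub>R x) ` U" if "s \<ge> max r 1" for s
  proof -
    have "s *\<^sub>R (inverse s *\<^sub>R f) = f" using that by simp
    moreover have "inverse s *\<^sub>R f \<in> U" using r that by simp
    ultimately show ?thesis by (metis empty_subsetI image_eqI insert_subset)
  qed
  then show "\<exists>r>0. \<forall>s\<ge>r. {f} \<subseteq> (\<lambda>x. s *\<^sub>R x) ` U"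
    by (intro exI[of _ "max r 1"]) auto
qed

lemma tvs_bounded_functional:
  fixes \<mu> :: "'a::topological_real_vector \<Rightarrow> real"
  assumes "tvs_bounded B" "linear \<mu>" "continuous_on UNIV \<mu>"
  shows "\<exists>M>0. \<forall>f\<in>B. \<bar>\<mu> f\<bar> \<le> M"
proof -
  have "open (\<mu> -` {-1<..<1})"
    using assms(3) by (simp add: open_vimage)
  moreover have "0 \<in> \<mu> -` {-1<..<1}"
    using assms(2) by (simp add: linear_0)
  ultimately obtain r where r: "r > 0" "B \<subseteq> (\<lambda>x. r *\<^sub>R x) ` (\<mu> -` {-1<..<1})"
    using assms(1) unfolding tvs_bounded_def by (metis order_refl)
  have "\<bar>\<mu> f\<bar> \<le> r" if fB: "f \<in> B" for f
  proof -
    obtain u where u: "f = r *\<^sub>R u" "\<mu> u \<in> {-1<..<1}" using r(2) fB by blast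
    then have "\<bar>\<mu> f\<bar> = r * \<bar>\<mu> u\<bar>"
      using r(1) assms(2) by (simp add: linear_cmul abs_mult)
    also have "\<dots> \<le> r * 1" using r(1) u(2) by (intro mult_left_mono) auto
    finally show ?thesis by simp
  qed
  then show ?thesis using r(1) by blast
qed

typedef (overloaded) 'a dual =
  "{\<mu> :: 'a::topological_real_vector \<Rightarrow> real. linear \<mu> \<and> continuous_on UNIV \<mu>}"
  morphisms dual_apply Dual
  by (rule exI[of _ "\<lambda>_. 0"]) (auto intro: linear_zero)

setup_lifting type_definition_dual

abbreviation pairing :: "'a::topological_real_vector \<Rightarrow> 'a dual \<Rightarrow> real"  ("\<langle>_, _\<rangle>")
  where "\<langle>f, \<mu>\<rangle> \<equiv> dual_apply \<mu> f"

lemma linear_dual_apply: "linear (dual_apply \<mu>)"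
  and continuous_dual_apply: "continuous_on UNIV (dual_apply \<mu>)"
  using dual_apply[of \<mu>] by auto

lemma dual_eqI: "(\<And>f. \<langle>f, \<mu>\<rangle> = \<langle>f, \<nu>\<rangle>) \<Longrightarrow> \<mu> = \<nu>"
  by transfer auto

instantiation dual :: (topological_real_vector) real_vector
begin

lift_definition zero_dual :: "'a dual" is "\<lambda>_. 0"
  by (auto intro: linear_zero)
lift_definition plus_dual :: "'a dual \<Rightarrow> 'a dual \<Rightarrow> 'a dual" is "\<lambda>\<mu> \<nu> f. \<mu> f + \<nu> f"
  by (auto intro: linear_compose_add continuous_intros)
lift_definition minus_dual :: "'a dual \<Rightarrow> 'a dual \<Rightarrow> 'a dual" is "\<lambda>\<mu> \<nu> f. \<mu> f - \<nu> f"
  by (auto intro: linear_compose_sub continuous_intros)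
lift_definition uminus_dual :: "'a dual \<Rightarrow> 'a dual" is "\<lambda>\<mu> f. - \<mu> f"
  by (auto intro: linear_compose_neg continuous_intros)
lift_definition scaleR_dual :: "real \<Rightarrow> 'a dual \<Rightarrow> 'a dual" is "\<lambda>c \<mu> f. c * \<mu> f"
  by (auto intro!: continuous_intros simp: linear_iff algebra_simps)

instance
  by standard (transfer; auto simp: algebra_simps)+

end

text \<open>The strong topology: uniform convergence on the bounded subsets of the predual.\<close>

instantiation dual :: (topological_real_vector) topological_space
begin

definition open_dual :: "'a dual set \<Rightarrow> bool" where
  "open_dual U \<longleftrightarrow>
     (\<forall>\<mu>\<in>U. \<exists>B e. tvs_bounded B \<and> e > 0 \<and>
        (\<forall>\<nu>. (\<forall>f\<in>B. \<bar>\<langle>f, \<nu>\<rangle> - \<langle>f, \<mu>\<rangle>\<bar> < e) \<longrightarrow> \<nu> \<in> U))"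

instance
proof
  show "open (UNIV :: 'a dual set)"
    unfolding open_dual_def using tvs_bounded_empty zero_less_one by blast
next
  fix S T :: "'a dual set"
  assume ST: "open S" "open T"
  show "open (S \<inter> T)"
    unfolding open_dual_def
  proof
    fix \<mu> assume \<mu>: "\<mu> \<in> S \<inter> T"
    obtain A d where A: "tvs_bounded A" "d > 0"
      "\<And>\<nu>. (\<forall>f\<in>A. \<bar>\<langle>f, \<nu>\<rangle> - \<langle>f, \<mu>\<rangle>\<bar> < d) \<Longrightarrow> \<nu> \<in> S"
      using ST(1) \<mu> unfolding open_dual_def by blast
    obtain B e where B: "tvs_bounded B" "e > 0"
      "\<And>\<nu>. (\<forall>f\<in>B. \<bar>\<langle>f, \<nu>\<rangle> - \<langle>f, \<mu>\<rangle>\<bar> < e) \<Longrightarrow> \<nu> \<in> T"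
      using ST(2) \<mu> unfolding open_dual_def by blast
    show "\<exists>B e. tvs_bounded B \<and> e > 0 \<and>
        (\<forall>\<nu>. (\<forall>f\<in>B. \<bar>\<langle>f, \<nu>\<rangle> - \<langle>f, \<mu>\<rangle>\<bar> < e) \<longrightarrow> \<nu> \<in> S \<inter> T)"
      using A(1,2) B(1,2) tvs_bounded_Un[OF A(1) B(1)]
      by (intro exI[of _ "A \<union> B"] exI[of _ "min d e"]) (auto intro: A(3) B(3))
  qed
next
  fix K :: "'a dual set set"
  assume *: "\<forall>S\<in>K. open S"
  show "open (\<Union>K)"
    unfolding open_dual_def
  proof
    fix \<mu> assume "\<mu> \<in> \<Union>K"
    then obtain S where S: "S \<in> K" "\<mu> \<in> S" by blast
    then obtain B e where "tvs_bounded B" "e > 0"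
      "\<And>\<nu>. (\<forall>f\<in>B. \<bar>\<langle>f, \<nu>\<rangle> - \<langle>f, \<mu>\<rangle>\<bar> < e) \<Longrightarrow> \<nu> \<in> S"
      using * unfolding open_dual_def by blast
    then show "\<exists>B e. tvs_bounded B \<and> e > 0 \<and>
        (\<forall>\<nu>. (\<forall>f\<in>B. \<bar>\<langle>f, \<nu>\<rangle> - \<langle>f, \<mu>\<rangle>\<bar> < e) \<longrightarrow> \<nu> \<in> \<Union>K)"
      using S(1) by blast
  qed
qed

end

lemma eventually_nhds_dual:
  "eventually P (nhds \<mu>) \<longleftrightarrow>
     (\<exists>B e. tvs_bounded B \<and> e > 0 \<and> (\<forall>\<nu>. (\<forall>f\<in>B. \<bar>\<langle>f, \<nu>\<rangle> - \<langle>f, \<mu>\<rangle>\<bar> < e) \<longrightarrow> P \<nu>))"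
proof
  assume "eventually P (nhds \<mu>)"
  then obtain S where S: "open S" "\<mu> \<in> S" "\<forall>\<nu>\<in>S. P \<nu>"
    by (auto simp: eventually_nhds)
  then show "\<exists>B e. tvs_bounded B \<and> e > 0 \<and> (\<forall>\<nu>. (\<forall>f\<in>B. \<bar>\<langle>f, \<nu>\<rangle> - \<langle>f, \<mu>\<rangle>\<bar> < e) \<longrightarrow> P \<nu>)"
    unfolding open_dual_def by meson
next
  assume "\<exists>B e. tvs_bounded B \<and> e > 0 \<and> (\<forall>\<nu>. (\<forall>f\<in>B. \<bar>\<langle>f, \<nu>\<rangle> - \<langle>f, \<mu>\<rangle>\<bar> < e) \<longrightarrow> P \<nu>)"
  then obtain B e where B: "tvs_bounded B" "e > 0"
    "\<And>\<nu>. \<forall>f\<in>B. \<bar>\<langle>f, \<nu>\<rangle> - \<langle>f, \<mu>\<rangle>\<bar> < e \<Longrightarrow> P \<nu>" by blast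
  define S where "S = {\<nu>. \<exists>d<e. \<forall>f\<in>B. \<bar>\<langle>f, \<nu>\<rangle> - \<langle>f, \<mu>\<rangle>\<bar> \<le> d}"
  have "open S"
    unfolding open_dual_def
  proof
    fix \<nu> assume "\<nu> \<in> S"
    then obtain d where d: "d < e" "\<And>f. f \<in> B \<Longrightarrow> \<bar>\<langle>f, \<nu>\<rangle> - \<langle>f, \<mu>\<rangle>\<bar> \<le> d"
      by (auto simp: S_def)
    have "\<sigma> \<in> S" if \<sigma>: "\<forall>f\<in>B. \<bar>\<langle>f, \<sigma>\<rangle> - \<langle>f, \<nu>\<rangle>\<bar> < (e - d) / 2" for \<sigma>
    proof -
      have "\<bar>\<langle>f, \<sigma>\<rangle> - \<langle>f, \<mu>\<rangle>\<bar> \<le> (e + d) / 2" if "f \<in> B" for f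
        using \<sigma>[rule_format, OF that] d(2)[OF that] by (simp add: abs_if field_simps split: if_splits)
      then show ?thesis using d(1) by (auto simp: S_def intro!: exI[of _ "(e + d) / 2"])
    qed
    then show "\<exists>B e. tvs_bounded B \<and> e > 0 \<and> (\<forall>\<sigma>. (\<forall>f\<in>B. \<bar>\<langle>f, \<sigma>\<rangle> - \<langle>f, \<nu>\<rangle>\<bar> < e) \<longrightarrow> \<sigma> \<in> S)"
      using B(1) d(1) by (intro exI[of _ B] exI[of _ "(e - d) / 2"]) auto
  qed
  moreover have "\<mu> \<in> S" using B(2) by (auto simp: S_def)
  moreover have "\<forall>\<nu>\<in>S. P \<nu>" 
  proof
    fix \<nu> assume "\<nu> \<in> S"
    then obtain d where "d < e" "\<forall>f\<in>B. \<bar>\<langle>f, \<nu>\<rangle> - \<langle>f, \<mu>\<rangle>\<bar> \<le> d" by (auto simp: S_def)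
    then show "P \<nu>" by (intro B(3)) force
  qed
  ultimately show "eventually P (nhds \<mu>)" by (auto simp: eventually_nhds)
qed

lemma tendsto_dual_iff:
  fixes h :: "'b \<Rightarrow> 'a::topological_real_vector dual"
  shows "(h \<longlongrightarrow> \<mu>) F \<longleftrightarrow>
     (\<forall>B e. tvs_bounded B \<and> e > 0 \<longrightarrow> (\<forall>\<^sub>F x in F. \<forall>f\<in>B. \<bar>\<langle>f, h x\<rangle> - \<langle>f, \<mu>\<rangle>\<bar> < e))"
proof
  assume h: "(h \<longlongrightarrow> \<mu>) F"
  show "\<forall>B e. tvs_bounded B \<and> e > 0 \<longrightarrow> (\<forall>\<^sub>F x in F. \<forall>f\<in>B. \<bar>\<langle>f, h x\<rangle> - \<langle>f, \<mu>\<rangle>\<bar> < e)"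
  proof (intro allI impI)
    fix B :: "'a set" and e :: real assume "tvs_bounded B \<and> e > 0"
    then have "\<forall>\<^sub>F \<nu> in nhds \<mu>. \<forall>f\<in>B. \<bar>\<langle>f, \<nu>\<rangle> - \<langle>f, \<mu>\<rangle>\<bar> < e"
      unfolding eventually_nhds_dual by blast
    then show "\<forall>\<^sub>F x in F. \<forall>f\<in>B. \<bar>\<langle>f, h x\<rangle> - \<langle>f, \<mu>\<rangle>\<bar> < e"
      using h by (rule eventually_compose_filterlim)
  qed
next
  assume *: "\<forall>B e. tvs_bounded B \<and> e > 0 \<longrightarrow> (\<forall>\<^sub>F x in F. \<forall>f\<in>B. \<bar>\<langle>f, h x\<rangle> - \<langle>f, \<mu>\<rangle>\<bar> < e)"
  show "(h \<longlongrightarrow> \<mu>) F"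
    unfolding filterlim_iff
  proof (intro allI impI)
    fix P assume "eventually P (nhds \<mu>)"
    then obtain B e where B: "tvs_bounded B" "e > 0"
      "\<And>\<nu>. \<forall>f\<in>B. \<bar>\<langle>f, \<nu>\<rangle> - \<langle>f, \<mu>\<rangle>\<bar> < e \<Longrightarrow> P \<nu>"
      unfolding eventually_nhds_dual by blast
    then have "\<forall>\<^sub>F x in F. \<forall>f\<in>B. \<bar>\<langle>f, h x\<rangle> - \<langle>f, \<mu>\<rangle>\<bar> < e" using * by blast
    then show "\<forall>\<^sub>F x in F. P (h x)" by (rule eventually_mono) (rule B(3))
  qed
qed

instance dual :: (topological_real_vector) t2_space
proof
  fix \<mu> \<nu> :: "'a dual" assume "\<mu> \<noteq> \<nu>"
  then obtain f where f: "\<langle>f, \<mu>\<rangle> \<noteq> \<langle>f, \<nu>\<rangle>" using dual_eqI by blast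
  define d where "d = \<bar>\<langle>f, \<mu>\<rangle> - \<langle>f, \<nu>\<rangle>\<bar> / 2"
  have "d > 0" using f by (simp add: d_def)
  then have "\<forall>\<^sub>F \<sigma> in nhds \<mu>. \<bar>\<langle>f, \<sigma>\<rangle> - \<langle>f, \<mu>\<rangle>\<bar> < d" "\<forall>\<^sub>F \<sigma> in nhds \<nu>. \<bar>\<langle>f, \<sigma>\<rangle> - \<langle>f, \<nu>\<rangle>\<bar> < d"
    unfolding eventually_nhds_dual using tvs_bounded_singleton[of f] by blast+
  then obtain U V where UV: "open U" "\<mu> \<in> U" "\<forall>\<sigma>\<in>U. \<bar>\<langle>f, \<sigma>\<rangle> - \<langle>f, \<mu>\<rangle>\<bar> < d"
    "open V" "\<nu> \<in> V" "\<forall>\<sigma>\<in>V. \<bar>\<langle>f, \<sigma>\<rangle> - \<langle>f, \<nu>\<rangle>\<bar> < d"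
    unfolding eventually_nhds by blast
  have "U \<inter> V = {}"
  proof (rule ccontr)
    assume "U \<inter> V \<noteq> {}"
    then obtain \<sigma> where "\<bar>\<langle>f, \<sigma>\<rangle> - \<langle>f, \<mu>\<rangle>\<bar> < d" "\<bar>\<langle>f, \<sigma>\<rangle> - \<langle>f, \<nu>\<rangle>\<bar> < d" using UV by blast
    then show False unfolding d_def by (simp add: abs_if field_simps split: if_splits)
  qed
  then show "\<exists>U V. open U \<and> open V \<and> \<mu> \<in> U \<and> \<nu> \<in> V \<and> U \<inter> V = {}" using UV by blast
qed

instance dual :: (topological_real_vector) topological_real_vector
proof
  fix \<mu> \<nu> :: "'a dual"
  show "LIM p (nhds \<mu> \<times>\<^sub>F nhds \<nu>). fst p + snd p :> nhds (\<mu> + \<nu>)"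
    unfolding tendsto_dual_iff
  proof (intro allI impI)
    fix B :: "'a set" and e :: real assume B: "tvs_bounded B \<and> e > 0"
    then have "\<forall>\<^sub>F \<sigma> in nhds \<mu>. \<forall>f\<in>B. \<bar>\<langle>f, \<sigma>\<rangle> - \<langle>f, \<mu>\<rangle>\<bar> < e / 2"
      "\<forall>\<^sub>F \<sigma> in nhds \<nu>. \<forall>f\<in>B. \<bar>\<langle>f, \<sigma>\<rangle> - \<langle>f, \<nu>\<rangle>\<bar> < e / 2"
      unfolding eventually_nhds_dual by (meson half_gt_zero)+
    then show "\<forall>\<^sub>F p in nhds \<mu> \<times>\<^sub>F nhds \<nu>. \<forall>f\<in>B. \<bar>\<langle>f, fst p + snd p\<rangle> - \<langle>f, \<mu> + \<nu>\<rangle>\<bar> < e"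
      unfolding eventually_prod_filter
    proof (intro exI conjI allI impI ballI)
      fix \<sigma> \<tau> f
      assume "\<forall>f\<in>B. \<bar>\<langle>f, \<sigma>\<rangle> - \<langle>f, \<mu>\<rangle>\<bar> < e / 2" "\<forall>f\<in>B. \<bar>\<langle>f, \<tau>\<rangle> - \<langle>f, \<nu>\<rangle>\<bar> < e / 2" "f \<in> B"
      then have "\<bar>\<langle>f, \<sigma>\<rangle> - \<langle>f, \<mu>\<rangle>\<bar> < e / 2" "\<bar>\<langle>f, \<tau>\<rangle> - \<langle>f, \<nu>\<rangle>\<bar> < e / 2" by auto
      then show "\<bar>\<langle>f, fst (\<sigma>, \<tau>) + snd (\<sigma>, \<tau>)\<rangle> - \<langle>f, \<mu> + \<nu>\<rangle>\<bar> < e"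
        by (simp add: plus_dual.rep_eq abs_if field_simps split: if_splits)
    qed
  qed
next
  fix c :: real and \<mu> :: "'a dual"
  show "((\<lambda>p. fst p *\<^sub>R snd p) \<longlongrightarrow> c *\<^sub>R \<mu>) (nhds c \<times>\<^sub>F nhds \<mu>)"
    unfolding tendsto_dual_iff
  proof (intro allI impI)
    fix B :: "'a set" and e :: real assume B: "tvs_bounded B \<and> e > 0"
    obtain M where M: "M > 0" "\<And>f. f \<in> B \<Longrightarrow> \<bar>\<langle>f, \<mu>\<rangle>\<bar> \<le> M"
      using tvs_bounded_functional[OF _ linear_dual_apply continuous_dual_apply] B by metis
    define d where "d = min 1 (e / (2 * M))"
    define d' where "d' = e / (2 * (\<bar>c\<bar> + 1))"
    have d: "d > 0" "d \<le> 1" "d * M \<le> e / 2" and d': "d' > 0" "(\<bar>c\<bar> + 1) * d' = e / 2"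
      using B M(1) by (auto simp: d_def d'_def min_def field_simps)
    have "\<forall>\<^sub>F c' in nhds c. \<bar>c' - c\<bar> < d"
      using d(1) by (auto simp: eventually_nhds_metric dist_real_def)
    moreover have "\<forall>\<^sub>F \<sigma> in nhds \<mu>. \<forall>f\<in>B. \<bar>\<langle>f, \<sigma>\<rangle> - \<langle>f, \<mu>\<rangle>\<bar> < d'"
      unfolding eventually_nhds_dual using B d'(1) by blast
    ultimately show "\<forall>\<^sub>F p in nhds c \<times>\<^sub>F nhds \<mu>. \<forall>f\<in>B. \<bar>\<langle>f, fst p *\<^sub>R snd p\<rangle> - \<langle>f, c *\<^sub>R \<mu>\<rangle>\<bar> < e"
      unfolding eventually_prod_filter
    proof (intro exI conjI allI impI ballI)
      fix c' :: real and \<sigma> f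
      assume c': "\<bar>c' - c\<bar> < d" and "\<forall>f\<in>B. \<bar>\<langle>f, \<sigma>\<rangle> - \<langle>f, \<mu>\<rangle>\<bar> < d'" and f: "f \<in> B"
      then have s: "\<bar>\<langle>f, \<sigma>\<rangle> - \<langle>f, \<mu>\<rangle>\<bar> < d'" by auto
      have "\<bar>c' * \<langle>f, \<sigma>\<rangle> - c * \<langle>f, \<mu>\<rangle>\<bar> = \<bar>c' * (\<langle>f, \<sigma>\<rangle> - \<langle>f, \<mu>\<rangle>) + (c' - c) * \<langle>f, \<mu>\<rangle>\<bar>"
        by (simp add: algebra_simps)
      also have "\<dots> \<le> \<bar>c'\<bar> * \<bar>\<langle>f, \<sigma>\<rangle> - \<langle>f, \<mu>\<rangle>\<bar> + \<bar>c' - c\<bar> * \<bar>\<langle>f, \<mu>\<rangle>\<bar>"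
        by (metis abs_mult abs_triangle_ineq)
      also have "\<dots> < e / 2 + e / 2"
      proof (rule add_le_less_mono)
        show "\<bar>c'\<bar> * \<bar>\<langle>f, \<sigma>\<rangle> - \<langle>f, \<mu>\<rangle>\<bar> \<le> e / 2"
          unfolding d'(2)[symmetric] using c' d(2) s by (intro mult_mono) auto
        have "\<bar>c' - c\<bar> * \<bar>\<langle>f, \<mu>\<rangle>\<bar> \<le> \<bar>c' - c\<bar> * M"
          using M(2)[OF f] by (intro mult_left_mono) auto
        also have "\<dots> < d * M" using c' M(1) by simp
        also note d(3)
        finally show "\<bar>c' - c\<bar> * \<bar>\<langle>f, \<mu>\<rangle>\<bar> < e / 2" .
      qed
      finally show "\<bar>\<langle>f, fst (c', \<sigma>) *\<^sub>R snd (c', \<sigma>)\<rangle> - \<langle>f, c *\<^sub>R \<mu>\<rangle>\<bar> < e"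
        by (simp add: scaleR_dual.rep_eq)
    qed
  qed
qed


section \<open>The space of smooth functions\<close>

text \<open>\<open>dderivs [u, \<dots>, v] f\<close> is the iterated directional derivative
  \<open>\<partial>\<^sub>u \<dots> \<partial>\<^sub>v f\<close>; for basis vectors these are the partial derivatives.\<close>

primrec dderivs :: "'a list \<Rightarrow> ('a::euclidean_space \<Rightarrow> real) \<Rightarrow> 'a \<Rightarrow> real" where
  "dderivs [] f = f"
| "dderivs (v # vs) f = (\<lambda>x. frechet_derivative (dderivs vs f) (at x) v)"

definition smooth_function :: "('a::euclidean_space \<Rightarrow> real) \<Rightarrow> bool" where
  "smooth_function f \<longleftrightarrow> (\<forall>vs x. dderivs vs f differentiable at x)"

lemma dderivs_append: "dderivs (us @ vs) f = dderivs us (dderivs vs f)"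
  by (induction us) auto

lemma has_derivative_dderivs:
  "smooth_function f \<Longrightarrow> (dderivs vs f has_derivative (\<lambda>v. dderivs (v # vs) f x)) (at x)"
  unfolding smooth_function_def by (simp add: frechet_derivative_works[symmetric])

lemma has_derivative_smooth_function:
  "smooth_function f \<Longrightarrow> (f has_derivative (\<lambda>v. dderivs [v] f x)) (at x)"
  using has_derivative_dderivs[of f "[]"] by simp

lemma dderivs_Cons_eq:
  "(dderivs vs f has_derivative F) (at x) \<Longrightarrow> dderivs (v # vs) f x = F v"
  by (metis dderivs.simps(2) frechet_derivative_at)

lemma smooth_function_dderivs: "smooth_function f \<Longrightarrow> smooth_function (dderivs us f)"
  unfolding smooth_function_def by (metis dderivs_append)

lemma continuous_on_dderivs: "smooth_function f \<Longrightarrow> continuous_on S (dderivs vs f)"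
  unfolding smooth_function_def
  by (meson continuous_at_imp_continuous_on differentiable_imp_continuous_within)

lemma smooth_function_dderivsI:
  assumes "\<And>vs. dderivs vs f = G vs" and "\<And>vs x. G vs differentiable at x"
  shows "smooth_function f"
  using assms unfolding smooth_function_def by simp

lemma smooth_function_stepI:
  assumes "\<And>x. (f has_derivative (\<lambda>v. G v x)) (at x)" and "\<And>v. smooth_function (G v)"
  shows "smooth_function f"
  unfolding smooth_function_def
proof (intro allI)
  fix vs x
  show "dderivs vs f differentiable at x"
  proof (cases vs rule: rev_cases)
    case Nil
    then show ?thesis using assms(1) by (auto simp: differentiable_def)
  next
    case (snoc us v)
    have "dderivs [v] f = G v"
      using dderivs_Cons_eq[of "[]" f] assms(1) by fastforce
    then have "dderivs vs f = dderivs us (G v)"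
      using snoc by (simp add: dderivs_append del: dderivs.simps(2))
    then show ?thesis using assms(2) by (simp add: smooth_function_def)
  qed
qed

lemma dderivs_const: "dderivs vs (\<lambda>_. c) = (\<lambda>_. if vs = [] then c else 0)"
proof (induction vs)
  case (Cons v vs)
  show ?case
    by (rule ext, subst dderivs_Cons_eq[where F = "\<lambda>_. 0"]) (auto simp: Cons.IH)
qed auto

lemma smooth_function_const: "smooth_function (\<lambda>_. c)"
  by (rule smooth_function_dderivsI[OF dderivs_const]) simp

lemma smooth_function_linear:
  fixes L :: "'a::euclidean_space \<Rightarrow> real"
  assumes "bounded_linear L"
  shows "smooth_function L"
  by (rule smooth_function_stepI[where G = "\<lambda>v _. L v"])
    (auto intro: smooth_function_const bounded_linear_imp_has_derivative assms)

lemma dderivs_add: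
  assumes "smooth_function f" "smooth_function g"
  shows "dderivs vs (\<lambda>x. f x + g x) = (\<lambda>x. dderivs vs f x + dderivs vs g x)"
proof (induction vs)
  case (Cons v vs)
  show ?case
    by (rule ext, rule dderivs_Cons_eq, unfold Cons.IH)
      (intro derivative_intros has_derivative_dderivs assms)
qed auto

lemma smooth_function_add:
  assumes "smooth_function f" "smooth_function g"
  shows "smooth_function (\<lambda>x. f x + g x)"
  by (rule smooth_function_dderivsI[OF dderivs_add[OF assms]])
    (use assms in \<open>auto simp: smooth_function_def intro: differentiable_add\<close>)

text \<open>The terms of the Leibniz rule for \<^const>\<open>dderivs\<close>.\<close>

primrec splits :: "'a list \<Rightarrow> ('a list \<times> 'a list) list" where
  "splits [] = [([], [])]"
| "splits (v # vs) = map (\<lambda>p. (v # fst p, snd p)) (splits vs) @ map (\<lambda>p. (fst p, v # snd p)) (splits vs)"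

lemma has_derivative_sum_list:
  assumes "\<And>p. p \<in> set ps \<Longrightarrow> (F p has_derivative F' p) net"
  shows "((\<lambda>x. \<Sum>p\<leftarrow>ps. F p x) has_derivative (\<lambda>h. \<Sum>p\<leftarrow>ps. F' p h :: 'b::real_normed_vector)) net"
  using assms by (induction ps) (auto intro!: derivative_intros)

lemma has_derivative_splits:
  assumes "smooth_function f" "smooth_function g"
  shows "((\<lambda>x. \<Sum>p\<leftarrow>splits vs. dderivs (fst p) f x * dderivs (snd p) g x) has_derivative
     (\<lambda>h. \<Sum>p\<leftarrow>splits vs. dderivs (fst p) f x * dderivs (h # snd p) g x +
        dderivs (h # fst p) f x * dderivs (snd p) g x)) (at x)"
  by (intro has_derivative_sum_list has_derivative_mult has_derivative_dderivs assms)

lemma dderivs_mult: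
  assumes "smooth_function f" "smooth_function g"
  shows "dderivs vs (\<lambda>x. f x * g x) = (\<lambda>x. \<Sum>p\<leftarrow>splits vs. dderivs (fst p) f x * dderivs (snd p) g x)"
proof (induction vs)
  case (Cons v vs)
  from dderivs_Cons_eq[OF has_derivative_splits[OF assms, of vs, folded Cons.IH]]
  show ?case
    by (auto simp: sum_list_addf o_def add.commute simp del: dderivs.simps(2))
qed auto

lemma smooth_function_mult:
  assumes "smooth_function f" "smooth_function g"
  shows "smooth_function (\<lambda>x. f x * g x)"
proof (rule smooth_function_dderivsI[OF dderivs_mult[OF assms]])
  fix vs x
  show "(\<lambda>x. \<Sum>p\<leftarrow>splits vs. dderivs (fst p) f x * dderivs (snd p) g x) differentiable at x"
    using has_derivative_splits[OF assms] unfolding differentiable_def by blast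
qed

lemma dderivs_cmult:
  assumes "smooth_function f"
  shows "dderivs vs (\<lambda>x. c * f x) = (\<lambda>x. c * dderivs vs f x)"
proof (induction vs)
  case (Cons v vs)
  show ?case
    by (rule ext, rule dderivs_Cons_eq, unfold Cons.IH)
      (intro has_derivative_mult_right has_derivative_dderivs assms)
qed auto

lemma smooth_function_cmult: "smooth_function f \<Longrightarrow> smooth_function (\<lambda>x. c * f x)"
  using smooth_function_mult[OF smooth_function_const] .

lemma dderivs_affine:
  fixes L :: "'a::euclidean_space \<Rightarrow> 'b::euclidean_space"
  assumes "smooth_function f" "bounded_linear L"
  shows "dderivs vs (\<lambda>y. f (c + L y)) = (\<lambda>y. dderivs (map L vs) f (c + L y))"
proof (induction vs)
  case (Cons v vs)
  have *: "((\<lambda>y. dderivs (map L vs) f (c + L y)) has_derivative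
      (\<lambda>h. dderivs (L h # map L vs) f (c + L y))) (at y)" for y
  proof -
    have "((\<lambda>y. c + L y) has_derivative (\<lambda>h. 0 + L h)) (at y)"
      by (intro derivative_intros bounded_linear_imp_has_derivative assms)
    from has_derivative_compose[OF this has_derivative_dderivs[OF assms(1)]]
    show ?thesis by simp
  qed
  show ?case
    using dderivs_Cons_eq[OF *[folded Cons.IH]] by (auto simp del: dderivs.simps(2))
qed auto

lemma smooth_function_affine:
  fixes L :: "'a::euclidean_space \<Rightarrow> 'b::euclidean_space"
  assumes "smooth_function f" "bounded_linear L"
  shows "smooth_function (\<lambda>y. f (c + L y))"
proof (rule smooth_function_dderivsI[OF dderivs_affine[OF assms]])
  fix vs y
  have "((\<lambda>y. c + L y) has_derivative (\<lambda>h. 0 + L h)) (at y)"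
    by (intro derivative_intros bounded_linear_imp_has_derivative assms)
  from has_derivative_compose[OF this has_derivative_dderivs[OF assms(1)]]
  show "(\<lambda>y. dderivs (map L vs) f (c + L y)) differentiable at y"
    unfolding differentiable_def by blast
qed

lemma
  fixes L :: "'a::euclidean_space \<Rightarrow> 'b::euclidean_space"
  assumes "smooth_function f" "bounded_linear L"
  shows dderivs_linear: "dderivs vs (\<lambda>y. f (L y)) = (\<lambda>y. dderivs (map L vs) f (L y))"
    and smooth_function_compose_linear: "smooth_function (\<lambda>y. f (L y))"
  using dderivs_affine[OF assms, of vs 0] smooth_function_affine[OF assms, of 0] by simp_all

typedef (overloaded) 'a smooth = "{f :: 'a::euclidean_space \<Rightarrow> real. smooth_function f}"
  morphisms smooth_apply Smooth
  using smooth_function_const by blast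

setup_lifting type_definition_smooth

lemma smooth_function_smooth_apply [simp]: "smooth_function (smooth_apply f)"
  using smooth_apply[of f] by simp

lemma smooth_eqI: "(\<And>x. smooth_apply f x = smooth_apply g x) \<Longrightarrow> f = g"
  by transfer auto

instantiation smooth :: (euclidean_space) "{real_algebra_1, comm_ring_1}"
begin

lift_definition zero_smooth :: "'a smooth" is "\<lambda>_. 0"
  by (rule smooth_function_const)
lift_definition one_smooth :: "'a smooth" is "\<lambda>_. 1"
  by (rule smooth_function_const)
lift_definition plus_smooth :: "'a smooth \<Rightarrow> 'a smooth \<Rightarrow> 'a smooth" is "\<lambda>f g x. f x + g x"
  by (rule smooth_function_add)
lift_definition minus_smooth :: "'a smooth \<Rightarrow> 'a smooth \<Rightarrow> 'a smooth" is "\<lambda>f g x. f x - g x"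
  using smooth_function_add[OF _ smooth_function_cmult[where c = "-1"]] by simp
lift_definition uminus_smooth :: "'a smooth \<Rightarrow> 'a smooth" is "\<lambda>f x. - f x"
  using smooth_function_cmult[where c = "-1"] by simp
lift_definition times_smooth :: "'a smooth \<Rightarrow> 'a smooth \<Rightarrow> 'a smooth" is "\<lambda>f g x. f x * g x"
  by (rule smooth_function_mult)
lift_definition scaleR_smooth :: "real \<Rightarrow> 'a smooth \<Rightarrow> 'a smooth" is "\<lambda>c f x. c * f x"
  by (rule smooth_function_cmult)

instance
  by standard (transfer; auto simp: algebra_simps fun_eq_iff)+

end

lemma dderivs_plus_smooth [simp]:
  "dderivs vs (smooth_apply (f + g)) x = dderivs vs (smooth_apply f) x + dderivs vs (smooth_apply g) x"
  by transfer (simp add: dderivs_add)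

lemma dderivs_scaleR_smooth [simp]:
  "dderivs vs (smooth_apply (c *\<^sub>R f)) x = c * dderivs vs (smooth_apply f) x"
  by transfer (simp add: dderivs_cmult)

lemma dderivs_uminus_smooth [simp]:
  "dderivs vs (smooth_apply (- f)) x = - dderivs vs (smooth_apply f) x"
  using dderivs_scaleR_smooth[of vs "-1" f x] by simp

lemma dderivs_minus_smooth [simp]:
  "dderivs vs (smooth_apply (f - g)) x = dderivs vs (smooth_apply f) x - dderivs vs (smooth_apply g) x"
  using dderivs_plus_smooth[of vs f "- g" x] by simp

lemma dderivs_zero_smooth [simp]: "dderivs vs (smooth_apply 0) x = 0"
  using dderivs_scaleR_smooth[of vs 0 0 x] by simp

text \<open>Uniform convergence of all derivatives on compact sets: a basic neighbourhood constrains
  finitely many of the iterated derivatives on one compact set.\<close>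

instantiation smooth :: (euclidean_space) topological_space
begin

definition open_smooth :: "'a smooth set \<Rightarrow> bool" where
  "open_smooth U \<longleftrightarrow>
     (\<forall>f\<in>U. \<exists>K V e. compact K \<and> finite V \<and> e > 0 \<and>
        (\<forall>g. (\<forall>vs\<in>V. \<forall>x\<in>K. \<bar>dderivs vs (smooth_apply g) x - dderivs vs (smooth_apply f) x\<bar> < e) \<longrightarrow> g \<in> U))"

instance
proof
  show "open (UNIV :: 'a smooth set)"
    unfolding open_smooth_def by (intro ballI exI[of _ "{}"] exI[of _ 1]) auto
next
  fix S T :: "'a smooth set"
  assume ST: "open S" "open T"
  show "open (S \<inter> T)"
    unfolding open_smooth_def
  proof
    fix f assume f: "f \<in> S \<inter> T"
    obtain K V d where A: "compact K" "finite V" "d > 0"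
      "\<forall>g. (\<forall>vs\<in>V. \<forall>x\<in>K. \<bar>dderivs vs (smooth_apply g) x - dderivs vs (smooth_apply f) x\<bar> < d) \<longrightarrow> g \<in> S"
      using bspec[OF ST(1)[unfolded open_smooth_def] IntD1[OF f]] by (elim exE conjE) (rule that)
    obtain K' V' e where B: "compact K'" "finite V'" "e > 0"
      "\<forall>g. (\<forall>vs\<in>V'. \<forall>x\<in>K'. \<bar>dderivs vs (smooth_apply g) x - dderivs vs (smooth_apply f) x\<bar> < e) \<longrightarrow> g \<in> T"
      using bspec[OF ST(2)[unfolded open_smooth_def] IntD2[OF f]] by (elim exE conjE) (rule that)
    show "\<exists>K V e. compact K \<and> finite V \<and> e > 0 \<and>
        (\<forall>g. (\<forall>vs\<in>V. \<forall>x\<in>K. \<bar>dderivs vs (smooth_apply g) x - dderivs vs (smooth_apply f) x\<bar> < e) \<longrightarrow> g \<in> S \<inter> T)"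
      using A(1-3) B(1-3)
      by (intro exI[of _ "K \<union> K'"] exI[of _ "V \<union> V'"] exI[of _ "min d e"])
        (auto intro!: A(4)[rule_format] B(4)[rule_format] compact_Un)
  qed
next
  fix \<U> :: "'a smooth set set"
  assume *: "\<forall>S\<in>\<U>. open S"
  show "open (\<Union>\<U>)"
    unfolding open_smooth_def
  proof
    fix f assume "f \<in> \<Union>\<U>"
    then obtain S where S: "S \<in> \<U>" "f \<in> S" by blast
    have "open S" using * S(1) by blast
    from bspec[OF this[unfolded open_smooth_def] S(2)]
    obtain K V e where "compact K" "finite V" "e > 0"
      "\<forall>g. (\<forall>vs\<in>V. \<forall>x\<in>K. \<bar>dderivs vs (smooth_apply g) x - dderivs vs (smooth_apply f) x\<bar> < e) \<longrightarrow> g \<in> S"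
      by (elim exE conjE) (rule that)
    then show "\<exists>K V e. compact K \<and> finite V \<and> e > 0 \<and>
        (\<forall>g. (\<forall>vs\<in>V. \<forall>x\<in>K. \<bar>dderivs vs (smooth_apply g) x - dderivs vs (smooth_apply f) x\<bar> < e) \<longrightarrow> g \<in> \<Union>\<U>)"
      using S(1) by blast
  qed
qed

end

lemma eventually_nhds_smooth:
  "eventually P (nhds f) \<longleftrightarrow>
     (\<exists>K V e. compact K \<and> finite V \<and> e > 0 \<and>
       (\<forall>g. (\<forall>vs\<in>V. \<forall>x\<in>K. \<bar>dderivs vs (smooth_apply g) x - dderivs vs (smooth_apply f) x\<bar> < e) \<longrightarrow> P g))"
    (is "?L \<longleftrightarrow> ?R")
proof
  assume ?L
  then obtain S where S: "open S" "f \<in> S" "\<forall>g\<in>S. P g"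
    by (auto simp: eventually_nhds)
  then show ?R unfolding open_smooth_def by meson
next
  assume ?R
  then obtain K V e where K: "compact K" "finite V" "e > 0"
    "\<And>g. \<forall>vs\<in>V. \<forall>x\<in>K. \<bar>dderivs vs (smooth_apply g) x - dderivs vs (smooth_apply f) x\<bar> < e \<Longrightarrow> P g"
    by blast
  define S where
    "S = {g. \<exists>d<e. \<forall>vs\<in>V. \<forall>x\<in>K. \<bar>dderivs vs (smooth_apply g) x - dderivs vs (smooth_apply f) x\<bar> \<le> d}"
  have "open S"
    unfolding open_smooth_def
  proof
    fix g assume "g \<in> S"
    then obtain d where d: "d < e"
      "\<And>vs x. vs \<in> V \<Longrightarrow> x \<in> K \<Longrightarrow> \<bar>dderivs vs (smooth_apply g) x - dderivs vs (smooth_apply f) x\<bar> \<le> d"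
      by (auto simp: S_def)
    have "h \<in> S"
      if h: "\<forall>vs\<in>V. \<forall>x\<in>K. \<bar>dderivs vs (smooth_apply h) x - dderivs vs (smooth_apply g) x\<bar> < (e - d) / 2" for h
    proof -
      have "\<bar>dderivs vs (smooth_apply h) x - dderivs vs (smooth_apply f) x\<bar> \<le> (e + d) / 2"
        if "vs \<in> V" "x \<in> K" for vs x
        using h[rule_format, OF that] d(2)[OF that] by (simp add: abs_if field_simps split: if_splits)
      then show ?thesis using d(1) by (auto simp: S_def intro!: exI[of _ "(e + d) / 2"])
    qed
    then show "\<exists>K V e. compact K \<and> finite V \<and> e > 0 \<and>
       (\<forall>h. (\<forall>vs\<in>V. \<forall>x\<in>K. \<bar>dderivs vs (smooth_apply h) x - dderivs vs (smooth_apply g) x\<bar> < e) \<longrightarrow> h \<in> S)"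
      using K(1,2) d(1) by (intro exI[of _ K] exI[of _ V] exI[of _ "(e - d) / 2"]) auto
  qed
  moreover have "f \<in> S" using K(3) by (auto simp: S_def)
  moreover have "\<forall>g\<in>S. P g"
  proof
    fix g assume "g \<in> S"
    then obtain d where "d < e"
      "\<forall>vs\<in>V. \<forall>x\<in>K. \<bar>dderivs vs (smooth_apply g) x - dderivs vs (smooth_apply f) x\<bar> \<le> d" by (auto simp: S_def)
    then show "P g" by (intro K(4)) force
  qed
  ultimately show ?L unfolding eventually_nhds by blast
qed

lemma dderivs_bounded_on_compact:
  assumes "compact K" "finite V"
  shows "\<exists>M>0. \<forall>vs\<in>V. \<forall>x\<in>K. \<bar>dderivs vs (smooth_apply f) x\<bar> \<le> M"
proof -
  have "bounded (\<Union>vs\<in>V. dderivs vs (smooth_apply f) ` K)"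
    using assms
    by (intro bounded_UN ballI compact_imp_bounded compact_continuous_image continuous_on_dderivs
        smooth_function_smooth_apply)
  then obtain M where "M > 0" "\<And>y. y \<in> (\<Union>vs\<in>V. dderivs vs (smooth_apply f) ` K) \<Longrightarrow> norm y \<le> M"
    unfolding bounded_pos by blast
  then show ?thesis by (intro exI[of _ M]) (metis UN_I image_eqI real_norm_def)
qed

instance smooth :: (euclidean_space) topological_real_vector
proof
  fix f g :: "'a smooth"
  show "LIM p (nhds f \<times>\<^sub>F nhds g). fst p + snd p :> nhds (f + g)"
    unfolding filterlim_iff
  proof (intro allI impI)
    fix P assume "eventually P (nhds (f + g))"
    then obtain K V e where K: "compact K" "finite V" "e > 0"
      "\<And>h. \<forall>vs\<in>V. \<forall>x\<in>K. \<bar>dderivs vs (smooth_apply h) x - dderivs vs (smooth_apply (f + g)) x\<bar> < e \<Longrightarrow> P h"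
      unfolding eventually_nhds_smooth by blast
    let ?Q = "\<lambda>f h. \<forall>vs\<in>V. \<forall>x\<in>K. \<bar>dderivs vs (smooth_apply h) x - dderivs vs (smooth_apply f) x\<bar> < e / 2"
    have "eventually (?Q f) (nhds f)" "eventually (?Q g) (nhds g)"
      unfolding eventually_nhds_smooth using K(1-3) half_gt_zero by blast+
    then show "\<forall>\<^sub>F p in nhds f \<times>\<^sub>F nhds g. P (fst p + snd p)"
      unfolding eventually_prod_filter
    proof (intro exI conjI allI impI)
      fix h k assume hk: "?Q f h" "?Q g k"
      show "P (fst (h, k) + snd (h, k))"
      proof (rule K(4), intro ballI)
        fix vs x assume "vs \<in> V" "x \<in> K"
        with hk have "\<bar>dderivs vs (smooth_apply h) x - dderivs vs (smooth_apply f) x\<bar> < e / 2"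
          "\<bar>dderivs vs (smooth_apply k) x - dderivs vs (smooth_apply g) x\<bar> < e / 2" by auto
        then show "\<bar>dderivs vs (smooth_apply (fst (h, k) + snd (h, k))) x - dderivs vs (smooth_apply (f + g)) x\<bar> < e"
          by (simp add: abs_if field_simps split: if_splits)
      qed
    qed
  qed
next
  fix c :: real and f :: "'a smooth"
  show "((\<lambda>p. fst p *\<^sub>R snd p) \<longlongrightarrow> c *\<^sub>R f) (nhds c \<times>\<^sub>F nhds f)"
    unfolding filterlim_iff
  proof (intro allI impI)
    fix P assume "eventually P (nhds (c *\<^sub>R f))"
    then obtain K V e where K: "compact K" "finite V" "e > 0"
      "\<And>h. \<forall>vs\<in>V. \<forall>x\<in>K. \<bar>dderivs vs (smooth_apply h) x - dderivs vs (smooth_apply (c *\<^sub>R f)) x\<bar> < e \<Longrightarrow> P h"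
      unfolding eventually_nhds_smooth by blast
    obtain M where M: "M > 0" "\<And>vs x. vs \<in> V \<Longrightarrow> x \<in> K \<Longrightarrow> \<bar>dderivs vs (smooth_apply f) x\<bar> \<le> M"
      using dderivs_bounded_on_compact[OF K(1,2)] by metis
    define d where "d = min 1 (e / (2 * M))"
    define d' where "d' = e / (2 * (\<bar>c\<bar> + 1))"
    have d: "d > 0" "d \<le> 1" "d * M \<le> e / 2" and d': "d' > 0" "(\<bar>c\<bar> + 1) * d' = e / 2"
      using K(3) M(1) by (auto simp: d_def d'_def min_def field_simps)
    let ?Q = "\<lambda>h. \<forall>vs\<in>V. \<forall>x\<in>K. \<bar>dderivs vs (smooth_apply h) x - dderivs vs (smooth_apply f) x\<bar> < d'"
    have "\<forall>\<^sub>F c' in nhds c. \<bar>c' - c\<bar> < d"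
      using d(1) by (auto simp: eventually_nhds_metric dist_real_def)
    moreover have "eventually ?Q (nhds f)"
      unfolding eventually_nhds_smooth using K(1-2) d'(1) by blast
    ultimately show "\<forall>\<^sub>F p in nhds c \<times>\<^sub>F nhds f. P (fst p *\<^sub>R snd p)"
      unfolding eventually_prod_filter
    proof (intro exI conjI allI impI)
      fix c' :: real and h
      assume c': "\<bar>c' - c\<bar> < d" and h: "?Q h"
      show "P (fst (c', h) *\<^sub>R snd (c', h))"
      proof (rule K(4), intro ballI)
        fix vs x assume vx: "vs \<in> V" "x \<in> K"
        define s t where "s = dderivs vs (smooth_apply h) x" and "t = dderivs vs (smooth_apply f) x"
        have s: "\<bar>s - t\<bar> < d'" and t: "\<bar>t\<bar> \<le> M" using h vx M(2) by (auto simp: s_def t_def)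
        have "\<bar>c' * s - c * t\<bar> = \<bar>c' * (s - t) + (c' - c) * t\<bar>"
          by (simp add: algebra_simps)
        also have "\<dots> \<le> \<bar>c'\<bar> * \<bar>s - t\<bar> + \<bar>c' - c\<bar> * \<bar>t\<bar>"
          by (metis abs_mult abs_triangle_ineq)
        also have "\<dots> < e / 2 + e / 2"
        proof (rule add_le_less_mono)
          show "\<bar>c'\<bar> * \<bar>s - t\<bar> \<le> e / 2"
            unfolding d'(2)[symmetric] using c' d(2) s by (intro mult_mono) auto
          have "\<bar>c' - c\<bar> * \<bar>t\<bar> \<le> \<bar>c' - c\<bar> * M"
            using t by (intro mult_left_mono) auto
          also have "\<dots> < d * M" using c' M(1) by simp
          also note d(3)
          finally show "\<bar>c' - c\<bar> * \<bar>t\<bar> < e / 2" .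
        qed
        finally show "\<bar>dderivs vs (smooth_apply (fst (c', h) *\<^sub>R snd (c', h))) x - dderivs vs (smooth_apply (c *\<^sub>R f)) x\<bar> < e"
          by (simp add: s_def t_def)
      qed
    qed
  qed
qed

type_synonym 'a distr = "'a smooth dual"

lemma continuous_functional_iff:
  fixes \<mu> :: "'a::euclidean_space smooth \<Rightarrow> real"
  assumes "linear \<mu>"
  shows "continuous_on UNIV \<mu> \<longleftrightarrow>
    (\<exists>K V C. compact K \<and> finite V \<and> C \<ge> 0 \<and>
      (\<forall>f e. e \<ge> 0 \<longrightarrow> (\<forall>vs\<in>V. \<forall>x\<in>K. \<bar>dderivs vs (smooth_apply f) x\<bar> \<le> e) \<longrightarrow> \<bar>\<mu> f\<bar> \<le> C * e))"
    (is "_ \<longleftrightarrow> ?R")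
proof
  assume "continuous_on UNIV \<mu>"
  then have "(\<mu> \<longlongrightarrow> \<mu> 0) (nhds 0)"
    by (simp add: continuous_on_def tendsto_at_iff_tendsto_nhds)
  then have "\<forall>\<^sub>F f in nhds 0. \<bar>\<mu> f\<bar> < 1"
    using tendstoD[of \<mu> 0 "nhds 0" 1] assms by (simp add: linear_0)
  then obtain K V d where K: "compact K" "finite V" "d > 0"
    "\<And>f. \<forall>vs\<in>V. \<forall>x\<in>K. \<bar>dderivs vs (smooth_apply f) x\<bar> < d \<Longrightarrow> \<bar>\<mu> f\<bar> < 1"
    unfolding eventually_nhds_smooth by auto
  have "\<bar>\<mu> f\<bar> \<le> (2 / d) * e"
    if e: "e \<ge> 0" and f: "\<forall>vs\<in>V. \<forall>x\<in>K. \<bar>dderivs vs (smooth_apply f) x\<bar> \<le> e" for f e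
  proof (rule field_le_epsilon)
    fix r :: real assume r: "r > 0"
    define e' where "e' = e + r * d / 2"
    have e': "e' > 0" "e \<le> e'" using e r K(3) by (auto simp: e'_def add_nonneg_pos)
    define c where "c = d / (2 * e')"
    have c: "c > 0" "c * e' = d / 2" using e' K(3) by (auto simp: c_def)
    have "\<bar>dderivs vs (smooth_apply (c *\<^sub>R f)) x\<bar> < d" if "vs \<in> V" "x \<in> K" for vs x
    proof -
      have "\<bar>dderivs vs (smooth_apply (c *\<^sub>R f)) x\<bar> \<le> c * e'"
        using f[rule_format, OF that] c(1) e'(2) by (simp add: abs_mult)
      also have "\<dots> < d" using c(2) K(3) by simp
      finally show ?thesis .
    qed
    then have "\<bar>\<mu> (c *\<^sub>R f)\<bar> < 1" using K(4) by blast
    then have "c * \<bar>\<mu> f\<bar> < 1" using c(1) by (simp add: linear_cmul[OF assms] abs_mult)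
    then have "\<bar>\<mu> f\<bar> < 1 / c" using c(1) by (simp add: field_simps)
    also have "1 / c = (2 / d) * e + r" using K(3) e' by (simp add: c_def e'_def field_simps)
    finally show "\<bar>\<mu> f\<bar> \<le> (2 / d) * e + r" by simp
  qed
  then show ?R using K(1-3) by (intro exI[of _ K] exI[of _ V] exI[of _ "2 / d"]) auto
next
  assume ?R
  then obtain K V C where K: "compact K" "finite V" "C \<ge> 0"
    "\<And>f e. e \<ge> 0 \<Longrightarrow> \<forall>vs\<in>V. \<forall>x\<in>K. \<bar>dderivs vs (smooth_apply f) x\<bar> \<le> e \<Longrightarrow> \<bar>\<mu> f\<bar> \<le> C * e"
    by blast
  have "(\<mu> \<longlongrightarrow> \<mu> f) (nhds f)" for f
  proof (rule tendstoI)
    fix e :: real assume e: "e > 0"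
    define d where "d = e / (C + 1)"
    have d: "d > 0" "C * d < e" using e K(3) by (auto simp: d_def field_simps)
    show "\<forall>\<^sub>F g in nhds f. dist (\<mu> g) (\<mu> f) < e"
      unfolding eventually_nhds_smooth
    proof (intro exI[of _ K] exI[of _ V] exI[of _ d] conjI allI impI K(1,2) d(1))
      fix g assume "\<forall>vs\<in>V. \<forall>x\<in>K. \<bar>dderivs vs (smooth_apply g) x - dderivs vs (smooth_apply f) x\<bar> < d"
      then have "\<bar>\<mu> (g - f)\<bar> \<le> C * d" using d(1) by (intro K(4)) (auto intro: less_imp_le)
      then show "dist (\<mu> g) (\<mu> f) < e"
        using d(2) by (simp add: dist_real_def linear_diff[OF assms])
    qed
  qed
  then show "continuous_on UNIV \<mu>"
    by (simp add: continuous_on_def tendsto_at_iff_tendsto_nhds)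
qed

lemma dual_smooth_bound:
  fixes \<mu> :: "'a::euclidean_space distr"
  obtains K V C where "compact K" "finite V" "C \<ge> 0"
    "\<And>f e. e \<ge> 0 \<Longrightarrow> \<forall>vs\<in>V. \<forall>x\<in>K. \<bar>dderivs vs (smooth_apply f) x\<bar> \<le> e \<Longrightarrow> \<bar>\<langle>f, \<mu>\<rangle>\<bar> \<le> C * e"
  using continuous_dual_apply[of \<mu>] unfolding continuous_functional_iff[OF linear_dual_apply]
  by blast


lemma linear_dderivs_dir: "smooth_function f \<Longrightarrow> linear (\<lambda>v. dderivs (v # vs) f x)"
  by (rule has_derivative_linear[OF has_derivative_dderivs])

lemma dderivs_line:
  assumes "smooth_function f"
  shows "((\<lambda>s. dderivs vs f (p + s *\<^sub>R u)) has_real_derivative dderivs (u # vs) f (p + s *\<^sub>R u)) (at s)"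
proof -
  have "((\<lambda>s. p + s *\<^sub>R u) has_derivative (\<lambda>h. 0 + h *\<^sub>R u)) (at s)"
    by (intro derivative_intros)
  from has_derivative_compose[OF this has_derivative_dderivs[OF assms]]
  show ?thesis
    using linear_cmul[OF linear_dderivs_dir[OF assms]]
    by (simp add: has_field_derivative_def mult_commute_abs del: dderivs.simps(2))
qed

lemma dderivs_rectangle:
  assumes f: "smooth_function f" and h: "h > 0"
  shows "\<exists>\<xi> \<eta>. 0 < \<xi> \<and> \<xi> < h \<and> 0 < \<eta> \<and> \<eta> < h \<and>
    f (x + h *\<^sub>R u + h *\<^sub>R v) - f (x + h *\<^sub>R u) - f (x + h *\<^sub>R v) + f x =
      h * h * dderivs [v, u] f (x + \<xi> *\<^sub>R u + \<eta> *\<^sub>R v)"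
proof -
  define \<phi> where "\<phi> s = f ((x + h *\<^sub>R v) + s *\<^sub>R u) - f (x + s *\<^sub>R u)" for s
  have "(\<phi> has_real_derivative dderivs [u] f ((x + h *\<^sub>R v) + s *\<^sub>R u) - dderivs [u] f (x + s *\<^sub>R u)) (at s)" for s
    unfolding \<phi>_def using dderivs_line[OF f, of "[]"]
    by (intro derivative_intros) (simp_all del: dderivs.simps(2))
  then obtain \<xi> where \<xi>: "0 < \<xi>" "\<xi> < h"
    "\<phi> h - \<phi> 0 = (h - 0) * (dderivs [u] f ((x + h *\<^sub>R v) + \<xi> *\<^sub>R u) - dderivs [u] f (x + \<xi> *\<^sub>R u))"
    using MVT2[OF h, of \<phi> "\<lambda>s. dderivs [u] f ((x + h *\<^sub>R v) + s *\<^sub>R u) - dderivs [u] f (x + s *\<^sub>R u)"] by blast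
  have "((\<lambda>t. dderivs [u] f ((x + \<xi> *\<^sub>R u) + t *\<^sub>R v)) has_real_derivative
      dderivs [v, u] f ((x + \<xi> *\<^sub>R u) + t *\<^sub>R v)) (at t)" for t
    by (rule dderivs_line[OF f])
  then obtain \<eta> where \<eta>: "0 < \<eta>" "\<eta> < h"
    "dderivs [u] f ((x + \<xi> *\<^sub>R u) + h *\<^sub>R v) - dderivs [u] f ((x + \<xi> *\<^sub>R u) + 0 *\<^sub>R v) =
      (h - 0) * dderivs [v, u] f ((x + \<xi> *\<^sub>R u) + \<eta> *\<^sub>R v)"
    using MVT2[OF h, of "\<lambda>t. dderivs [u] f ((x + \<xi> *\<^sub>R u) + t *\<^sub>R v)"
      "\<lambda>t. dderivs [v, u] f ((x + \<xi> *\<^sub>R u) + t *\<^sub>R v)"] by blast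
  have "f (x + h *\<^sub>R u + h *\<^sub>R v) - f (x + h *\<^sub>R u) - f (x + h *\<^sub>R v) + f x = \<phi> h - \<phi> 0"
    by (simp add: \<phi>_def algebra_simps)
  also have "\<dots> = h * (dderivs [u] f ((x + \<xi> *\<^sub>R u) + h *\<^sub>R v) - dderivs [u] f ((x + \<xi> *\<^sub>R u) + 0 *\<^sub>R v))"
    unfolding \<xi>(3) by (simp add: algebra_simps del: dderivs.simps(2))
  also have "\<dots> = h * h * dderivs [v, u] f (x + \<xi> *\<^sub>R u + \<eta> *\<^sub>R v)"
    unfolding \<eta>(3) by (simp del: dderivs.simps(2))
  finally show ?thesis using \<xi>(1,2) \<eta>(1,2) by blast
qed

lemma dderivs_swap:
  assumes f: "smooth_function f"
  shows "dderivs [u, v] f x = dderivs [v, u] f x"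
proof (rule ccontr)
  assume neq: "dderivs [u, v] f x \<noteq> dderivs [v, u] f x"
  define e where "e = \<bar>dderivs [u, v] f x - dderivs [v, u] f x\<bar> / 2"
  have e: "e > 0" using neq by (simp add: e_def del: dderivs.simps(2))
  have cont: "isCont (dderivs vs f) x" for vs
    using f unfolding smooth_function_def by (blast intro: differentiable_imp_continuous_within)
  obtain d where d: "d > 0" "\<And>y. dist y x < d \<Longrightarrow> dist (dderivs [u, v] f y) (dderivs [u, v] f x) < e"
    using cont[of "[u, v]"] e unfolding continuous_at_eps_delta by blast
  obtain d' where d': "d' > 0" "\<And>y. dist y x < d' \<Longrightarrow> dist (dderivs [v, u] f y) (dderivs [v, u] f x) < e"
    using cont[of "[v, u]"] e unfolding continuous_at_eps_delta by blast
  define c where "c = norm u + norm v + 1"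
  define h where "h = min d d' / c"
  have c: "c > 0" by (simp add: c_def add_nonneg_pos)
  have h: "h > 0" "h * c \<le> d" "h * c \<le> d'" using c d(1) d'(1) by (auto simp: h_def)
  have near: "dist (x + s *\<^sub>R a + t *\<^sub>R b) x < h * c"
    if "0 < s" "s < h" "0 < t" "t < h" "norm a + norm b = norm u + norm v" for s t a b
  proof -
    have "dist (x + s *\<^sub>R a + t *\<^sub>R b) x = norm (s *\<^sub>R a + t *\<^sub>R b)" by (simp add: dist_norm)
    also have "\<dots> \<le> s * norm a + t * norm b"
      using norm_triangle_ineq[of "s *\<^sub>R a" "t *\<^sub>R b"] that by simp
    also have "\<dots> \<le> h * norm a + h * norm b" using that by (intro add_mono mult_right_mono) auto
    also have "\<dots> = h * (norm u + norm v)" using that(5) by (simp add: distrib_left[symmetric])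
    also have "\<dots> < h * c" using h(1) by (simp add: c_def)
    finally show ?thesis .
  qed
  obtain \<xi> \<eta> where 1: "0 < \<xi>" "\<xi> < h" "0 < \<eta>" "\<eta> < h"
    "f (x + h *\<^sub>R u + h *\<^sub>R v) - f (x + h *\<^sub>R u) - f (x + h *\<^sub>R v) + f x =
      h * h * dderivs [v, u] f (x + \<xi> *\<^sub>R u + \<eta> *\<^sub>R v)"
    using dderivs_rectangle[OF f h(1)] by blast
  obtain \<xi>' \<eta>' where 2: "0 < \<xi>'" "\<xi>' < h" "0 < \<eta>'" "\<eta>' < h"
    "f (x + h *\<^sub>R v + h *\<^sub>R u) - f (x + h *\<^sub>R v) - f (x + h *\<^sub>R u) + f x =
      h * h * dderivs [u, v] f (x + \<xi>' *\<^sub>R v + \<eta>' *\<^sub>R u)"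
    using dderivs_rectangle[OF f h(1)] by blast
  have "f (x + h *\<^sub>R v + h *\<^sub>R u) = f (x + h *\<^sub>R u + h *\<^sub>R v)" by (simp add: algebra_simps)
  then have "h * h * dderivs [v, u] f (x + \<xi> *\<^sub>R u + \<eta> *\<^sub>R v) =
      h * h * dderivs [u, v] f (x + \<xi>' *\<^sub>R v + \<eta>' *\<^sub>R u)"
    using 1(5) 2(5) by linarith
  then have eq: "dderivs [v, u] f (x + \<xi> *\<^sub>R u + \<eta> *\<^sub>R v) = dderivs [u, v] f (x + \<xi>' *\<^sub>R v + \<eta>' *\<^sub>R u)"
    using h(1) by (simp del: dderivs.simps(2))
  have "dist (dderivs [v, u] f (x + \<xi> *\<^sub>R u + \<eta> *\<^sub>R v)) (dderivs [v, u] f x) < e"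
    using near[OF 1(1-4), of u v] h(3) by (intro d'(2)) simp
  moreover have "dist (dderivs [u, v] f (x + \<xi>' *\<^sub>R v + \<eta>' *\<^sub>R u)) (dderivs [u, v] f x) < e"
    using near[OF 2(1-4), of v u] h(2) by (intro d(2)) simp
  ultimately show False
    unfolding eq dist_real_def e_def by (simp add: abs_if field_simps split: if_splits del: dderivs.simps(2))
qed

lemma dderivs_rotate:
  assumes f: "smooth_function f"
  shows "dderivs (vs @ [u]) f = dderivs (u # vs) f"
proof (induction vs)
  case (Cons w vs)
  have "dderivs ((w # vs) @ [u]) f = dderivs [w] (dderivs (u # vs) f)"
    using Cons.IH by simp
  also have "\<dots> = dderivs [w, u] (dderivs vs f)" by simp
  also have "\<dots> = dderivs [u, w] (dderivs vs f)"
    using dderivs_swap[OF smooth_function_dderivs[OF f]] by blast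
  finally show ?case by simp
qed simp

subsection \<open>Operations on smooth functions\<close>

lift_definition smooth_deriv :: "'a::euclidean_space \<Rightarrow> 'a smooth \<Rightarrow> 'a smooth"
  is "\<lambda>v f x. frechet_derivative f (at x) v"
  using smooth_function_dderivs[where us = "[_]"] by auto

lift_definition tensor_one :: "'a::euclidean_space smooth \<Rightarrow> ('a \<times> 'b::euclidean_space) smooth"
  is "\<lambda>f z. f (fst z)"
  by (rule smooth_function_compose_linear[OF _ bounded_linear_fst])

lift_definition slice :: "('a::euclidean_space \<times> 'b::euclidean_space) smooth \<Rightarrow> 'a \<Rightarrow> 'b smooth"
  is "\<lambda>\<Phi> x y. \<Phi> (x, y)"
  using smooth_function_affine[where c = "(_, 0)" and L = "\<lambda>y. (0, y)"]
  by (simp add: bounded_linear_Pair bounded_linear_zero bounded_linear_ident)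

lift_definition difference_kernel :: "'a::euclidean_space smooth \<Rightarrow> ('a \<times> 'a) smooth"
  is "\<lambda>g z. g (fst z - snd z)"
  by (rule smooth_function_compose_linear)
    (auto intro: bounded_linear_sub bounded_linear_fst bounded_linear_snd)

lemma dderivs_smooth_deriv:
  "dderivs vs (smooth_apply (smooth_deriv v f)) = dderivs (vs @ [v]) (smooth_apply f)"
  by transfer (simp add: dderivs_append)

lemma dderivs_tensor_one:
  "dderivs vs (smooth_apply (tensor_one f)) z = dderivs (map fst vs) (smooth_apply f) (fst z)"
  by transfer (simp add: dderivs_linear[OF _ bounded_linear_fst])

lemma dderivs_slice:
  "dderivs vs (smooth_apply (slice \<Phi> x)) y = dderivs (map (Pair 0) vs) (smooth_apply \<Phi>) (x, y)"
proof transfer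
  fix vs :: "'a list" and \<Phi> :: "'b \<times> 'a \<Rightarrow> real" and x y
  assume \<Phi>: "smooth_function \<Phi>"
  have "bounded_linear (Pair 0 :: 'a \<Rightarrow> 'b \<times> 'a)"
    by (intro bounded_linear_Pair bounded_linear_zero bounded_linear_ident)
  from dderivs_affine[OF \<Phi> this, of vs "(x, 0)"]
  show "dderivs vs (\<lambda>y. \<Phi> (x, y)) y = dderivs (map (Pair 0) vs) \<Phi> (x, y)"
    by (simp add: fun_eq_iff)
qed

lemma smooth_deriv_lincomb:
  "smooth_deriv (a *\<^sub>R u + v) f = a *\<^sub>R smooth_deriv u f + smooth_deriv v f"
proof transfer
  fix a :: real and u v :: 'a and f :: "'a \<Rightarrow> real"
  assume "smooth_function f"
  from linear_dderivs_dir[OF this, of "[]"]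
  show "(\<lambda>x. frechet_derivative f (at x) (a *\<^sub>R u + v)) =
      (\<lambda>x. a * frechet_derivative f (at x) u + frechet_derivative f (at x) v)"
    by (simp add: linear_add linear_cmul fun_eq_iff)
qed

lemma smooth_deriv_lincomb_right:
  "smooth_deriv v (a *\<^sub>R f + g) = a *\<^sub>R smooth_deriv v f + smooth_deriv v g"
proof (rule smooth_eqI)
  have *: "smooth_apply (smooth_deriv v h) = dderivs [v] (smooth_apply h)" for h
    by (simp add: smooth_deriv.rep_eq)
  show "smooth_apply (smooth_deriv v (a *\<^sub>R f + g)) x =
      smooth_apply (a *\<^sub>R smooth_deriv v f + smooth_deriv v g) x" for x
    by (simp add: * plus_smooth.rep_eq[of "a *\<^sub>R smooth_deriv v f"] scaleR_smooth.rep_eq[of a "smooth_deriv v f"]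
        del: dderivs.simps(2))
qed

lemma slice_lincomb: "slice (a *\<^sub>R \<Phi> + \<Psi>) x = a *\<^sub>R slice \<Phi> x + slice \<Psi> x"
  by transfer simp

lemma pairing_lincomb: "\<langle>a *\<^sub>R f + g, \<mu>\<rangle> = a * \<langle>f, \<mu>\<rangle> + \<langle>g, \<mu>\<rangle>"
  by (simp add: linear_add[OF linear_dual_apply] linear_cmul[OF linear_dual_apply])

lemma linearI_lincomb:
  assumes "\<And>a f g. T (a *\<^sub>R f + g) = a *\<^sub>R T f + T g"
  shows "linear T"
proof
  show add: "T (f + g) = T f + T g" for f g using assms[of 1 f g] by simp
  have "T 0 = 0" using add[of 0 0] by simp
  then show "T (a *\<^sub>R f) = a *\<^sub>R T f" for a f using assms[of a f 0] by simp
qed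

lemma has_derivative_pairing_slice:
  fixes \<Phi> :: "('a::euclidean_space \<times> 'b::euclidean_space) smooth" and \<mu> :: "'b distr"
  shows "((\<lambda>x. \<langle>slice \<Phi> x, \<mu>\<rangle>) has_derivative (\<lambda>h. \<langle>slice (smooth_deriv (h, 0) \<Phi>) x, \<mu>\<rangle>)) (at x)"
  unfolding has_derivative_at_alt
proof (intro conjI allI impI)
  have "linear (\<lambda>h. \<langle>slice (smooth_deriv (h, 0) \<Phi>) x, \<mu>\<rangle>)"
  proof (rule linearI_lincomb)
    fix a and f g :: 'a
    have "(a *\<^sub>R f + g, 0 :: 'b) = a *\<^sub>R (f, 0) + (g, 0)" by simp
    then show "\<langle>slice (smooth_deriv (a *\<^sub>R f + g, 0) \<Phi>) x, \<mu>\<rangle> =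
       a *\<^sub>R \<langle>slice (smooth_deriv (f, 0) \<Phi>) x, \<mu>\<rangle> + \<langle>slice (smooth_deriv (g, 0) \<Phi>) x, \<mu>\<rangle>"
      by (simp only: smooth_deriv_lincomb slice_lincomb pairing_lincomb real_scaleR_def)
  qed
  then show "bounded_linear (\<lambda>h. \<langle>slice (smooth_deriv (h, 0) \<Phi>) x, \<mu>\<rangle>)"
    by (simp add: linear_conv_bounded_linear)
next
  fix e :: real assume e: "e > 0"
  obtain K V C where K: "compact K" "finite V" "C \<ge> 0"
    "\<And>f e. e \<ge> 0 \<Longrightarrow> \<forall>vs\<in>V. \<forall>x\<in>K. \<bar>dderivs vs (smooth_apply f) x\<bar> \<le> e \<Longrightarrow> \<bar>\<langle>f, \<mu>\<rangle>\<bar> \<le> C * e"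
    using dual_smooth_bound[of \<mu>] by blast
  define r where "r = e / (C + 1)"
  define N where "N = real DIM('a)"
  have N: "N > 0" by (simp add: N_def)
  have r: "r > 0" "C * r \<le> e" using e K(3) by (auto simp: r_def field_simps)
  define G where "G vs b = dderivs ((b, 0) # map (Pair 0) vs) (smooth_apply \<Phi>)" for vs and b :: 'a
  define Q where "Q vs b d \<longleftrightarrow> (\<forall>h y. norm h < d \<longrightarrow> y \<in> K \<longrightarrow> \<bar>G vs b (x + h, y) - G vs b (x, y)\<bar> \<le> r / N)"
    for vs and b :: 'a and d
  have "\<forall>\<^sub>F d in at_right 0. Q vs b d" for vs and b :: 'a
  proof -
    have "uniformly_continuous_on (cball x 1 \<times> K) (G vs b)"
      using K(1) unfolding G_def
      by (intro compact_uniformly_continuous continuous_on_dderivs compact_Times) auto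
    then obtain d where d: "d > 0"
      "\<And>p q. p \<in> cball x 1 \<times> K \<Longrightarrow> q \<in> cball x 1 \<times> K \<Longrightarrow> dist q p < d \<Longrightarrow> dist (G vs b q) (G vs b p) < r / N"
      using r(1) N unfolding uniformly_continuous_on_def by (metis divide_pos_pos)
    have "Q vs b d'" if "d' < min d 1" for d'
      unfolding Q_def
    proof (intro allI impI)
      fix h :: 'a and y assume "norm h < d'" "y \<in> K"
      then show "\<bar>G vs b (x + h, y) - G vs b (x, y)\<bar> \<le> r / N"
        using d(2)[of "(x, y)" "(x + h, y)"] that by (auto simp: dist_Pair_Pair dist_norm)
    qed
    then show ?thesis
      unfolding eventually_at_right_field using d(1) by (intro exI[of _ "min d 1"]) auto
  qed
  then have "\<forall>\<^sub>F d in at_right 0. \<forall>p \<in> V \<times> Basis. Q (fst p) (snd p) d"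
    using K(2) by (intro eventually_ball_finite) auto
  then have "\<forall>\<^sub>F d in at_right 0. 0 < d \<and> (\<forall>p \<in> V \<times> Basis. Q (fst p) (snd p) d)"
    by (intro eventually_conj eventually_at_right_less)
  then obtain d where d0: "0 < d \<and> (\<forall>p \<in> V \<times> Basis. Q (fst p) (snd p) d)"
    using eventually_happens'[OF trivial_limit_at_right_real] by blast
  have d: "d > 0" "\<And>vs b. vs \<in> V \<Longrightarrow> b \<in> Basis \<Longrightarrow> Q vs b d"
    using d0 by auto
  show "\<exists>d>0. \<forall>y. norm (y - x) < d \<longrightarrow>
      norm (\<langle>slice \<Phi> y, \<mu>\<rangle> - \<langle>slice \<Phi> x, \<mu>\<rangle> - \<langle>slice (smooth_deriv (y - x, 0) \<Phi>) x, \<mu>\<rangle>) \<le> e * norm (y - x)"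
  proof (intro exI[of _ d] conjI allI impI d(1))
    fix x' assume x': "norm (x' - x) < d"
    define h where "h = x' - x"
    define f where "f = slice \<Phi> x' - slice \<Phi> x - slice (smooth_deriv (h, 0) \<Phi>) x"
    have "\<bar>dderivs vs (smooth_apply f) y\<bar> \<le> r * norm h" if vs: "vs \<in> V" and y: "y \<in> K" for vs y
    proof -
      let ?D = "\<lambda>h. dderivs ((h, 0) # map (Pair 0) vs) (smooth_apply \<Phi>)"
      have "((\<lambda>s. dderivs (map (Pair 0) vs) (smooth_apply \<Phi>) ((x, y) + s *\<^sub>R (h, 0)))
          has_real_derivative ?D h ((x, y) + s *\<^sub>R (h, 0))) (at s)" for s
        by (rule dderivs_line) simp
      then obtain \<theta> where \<theta>: "0 < \<theta>" "\<theta> < 1"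
        "dderivs (map (Pair 0) vs) (smooth_apply \<Phi>) ((x, y) + 1 *\<^sub>R (h, 0)) -
          dderivs (map (Pair 0) vs) (smooth_apply \<Phi>) ((x, y) + 0 *\<^sub>R (h, 0)) =
          (1 - 0) * ?D h ((x, y) + \<theta> *\<^sub>R (h, 0))"
        using MVT2[OF zero_less_one, of "\<lambda>s. dderivs (map (Pair 0) vs) (smooth_apply \<Phi>) ((x, y) + s *\<^sub>R (h, 0))"
          "\<lambda>s. ?D h ((x, y) + s *\<^sub>R (h, 0))"]
        by blast
      have lin: "?D h p = (\<Sum>b\<in>Basis. (h \<bullet> b) * G vs b p)" for p
      proof -
        have "linear (\<lambda>h. ?D h p)"
        proof -
          have "linear ((\<lambda>v. dderivs (v # map (Pair 0) vs) (smooth_apply \<Phi>) p) \<circ> (\<lambda>h. (h, 0)))"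
            by (intro linear_compose linear_dderivs_dir) (auto simp: linear_iff)
          then show ?thesis by (simp add: o_def del: dderivs.simps(2))
        qed
        from linear_sum[OF this, of "\<lambda>b. (h \<bullet> b) *\<^sub>R b" Basis] linear_cmul[OF this]
        have "?D (\<Sum>b\<in>Basis. (h \<bullet> b) *\<^sub>R b) p = (\<Sum>b\<in>Basis. (h \<bullet> b) * G vs b p)"
          by (simp add: G_def del: dderivs.simps(2) euclidean_representation)
        then show ?thesis by (simp add: euclidean_representation del: dderivs.simps(2))
      qed
      have "dderivs vs (smooth_apply f) y =
          dderivs (map (Pair 0) vs) (smooth_apply \<Phi>) (x', y) - dderivs (map (Pair 0) vs) (smooth_apply \<Phi>) (x, y)
          - ?D h (x, y)"
        unfolding f_def
        by (simp add: dderivs_slice dderivs_smooth_deriv dderivs_rotate del: dderivs.simps(2))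
      also have "\<dots> = ?D h (x + \<theta> *\<^sub>R h, y) - ?D h (x, y)"
        using \<theta>(3) by (simp add: h_def del: dderivs.simps(2))
      also have "\<dots> = (\<Sum>b\<in>Basis. (h \<bullet> b) * (G vs b (x + \<theta> *\<^sub>R h, y) - G vs b (x, y)))"
        unfolding lin by (simp add: sum_subtractf right_diff_distrib)
      also have "\<bar>\<dots>\<bar> \<le> (\<Sum>b\<in>(Basis :: 'a set). norm h * (r / N))"
      proof (rule order_trans[OF sum_abs], rule sum_mono)
        fix b :: 'a assume b: "b \<in> Basis"
        have "norm (\<theta> *\<^sub>R h) < d"
        proof -
          have "norm (\<theta> *\<^sub>R h) \<le> 1 * norm h" 
            using \<theta>(1,2) mult_right_mono[of \<theta> 1 "norm h"] by simp
          then show ?thesis using x' by (simp add: h_def)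
        qed
        then have "\<bar>G vs b (x + \<theta> *\<^sub>R h, y) - G vs b (x, y)\<bar> \<le> r / N"
          using d(2)[OF vs b] y unfolding Q_def by blast
        then show "\<bar>(h \<bullet> b) * (G vs b (x + \<theta> *\<^sub>R h, y) - G vs b (x, y))\<bar> \<le> norm h * (r / N)"
          unfolding abs_mult using Basis_le_norm[OF b] by (intro mult_mono) auto
      qed
      also have "\<dots> = r * norm h" using N by (simp add: N_def)
      finally show ?thesis .
    qed
    then have "\<bar>\<langle>f, \<mu>\<rangle>\<bar> \<le> C * (r * norm h)" using r(1) by (intro K(4)) auto
    also have "\<dots> \<le> e * norm h" using mult_right_mono[OF r(2), of "norm h"] by (simp add: mult.assoc)
    finally show "norm (\<langle>slice \<Phi> x', \<mu>\<rangle> - \<langle>slice \<Phi> x, \<mu>\<rangle> - \<langle>slice (smooth_deriv (x' - x, 0) \<Phi>) x, \<mu>\<rangle>)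
        \<le> e * norm (x' - x)"
      by (simp add: f_def h_def linear_diff[OF linear_dual_apply])
  qed
qed

definition partial_pairing ::
  "('a::euclidean_space \<times> 'b::euclidean_space) smooth \<Rightarrow> 'b distr \<Rightarrow> 'a smooth" where
  "partial_pairing \<Phi> \<mu> = Smooth (\<lambda>x. \<langle>slice \<Phi> x, \<mu>\<rangle>)"

lemma dderivs_pairing_slice:
  "dderivs vs (\<lambda>x. \<langle>slice \<Phi> x, \<mu>\<rangle>) =
     (\<lambda>x. \<langle>slice (foldr smooth_deriv (map (\<lambda>v. (v, 0)) vs) \<Phi>) x, \<mu>\<rangle>)"
proof (induction vs)
  case (Cons v vs)
  show ?case
    by (rule ext, rule trans[OF dderivs_Cons_eq], unfold Cons.IH, rule has_derivative_pairing_slice) simp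
qed simp

lemma smooth_apply_foldr_smooth_deriv:
  "smooth_apply (foldr smooth_deriv vs f) = dderivs vs (smooth_apply f)"
  by (induction vs) (auto simp: smooth_deriv.rep_eq)

lemma smooth_apply_partial_pairing: "smooth_apply (partial_pairing \<Phi> \<mu>) x = \<langle>slice \<Phi> x, \<mu>\<rangle>"
proof -
  have "smooth_function (\<lambda>x. \<langle>slice \<Phi> x, \<mu>\<rangle>)"
    by (rule smooth_function_dderivsI[OF dderivs_pairing_slice])
      (use has_derivative_pairing_slice in \<open>auto simp: differentiable_def\<close>)
  then show ?thesis unfolding partial_pairing_def by (simp add: Smooth_inverse)
qed

lemma dderivs_partial_pairing:
  "dderivs vs (smooth_apply (partial_pairing \<Phi> \<mu>)) x =
     \<langle>slice (foldr smooth_deriv (map (\<lambda>v. (v, 0)) vs) \<Phi>) x, \<mu>\<rangle>"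
  by (simp add: smooth_apply_partial_pairing[abs_def] dderivs_pairing_slice)

text \<open>\<open>\<gamma> \<otimes> \<mu>\<close>, characterised by \<open>\<langle>f \<otimes> g, \<gamma> \<otimes> \<mu>\<rangle> = \<langle>f, \<gamma>\<rangle> \<langle>g, \<mu>\<rangle>\<close>, as an iterated pairing.\<close>

definition tensor :: "'a::euclidean_space distr \<Rightarrow> 'b::euclidean_space distr \<Rightarrow> ('a \<times> 'b) distr" where
  "tensor \<gamma> \<mu> = Dual (\<lambda>\<Phi>. \<langle>partial_pairing \<Phi> \<mu>, \<gamma>\<rangle>)"

lemma pairing_Dual_compose:
  fixes T :: "'a::euclidean_space smooth \<Rightarrow> 'b::euclidean_space smooth"
  assumes lin: "\<And>a f g. T (a *\<^sub>R f + g) = a *\<^sub>R T f + T g"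
    and bd: "\<And>K V. compact K \<Longrightarrow> finite V \<Longrightarrow> \<exists>K' V' C. compact K' \<and> finite V' \<and> C \<ge> 0 \<and>
      (\<forall>f e. e \<ge> 0 \<longrightarrow> (\<forall>vs\<in>V'. \<forall>x\<in>K'. \<bar>dderivs vs (smooth_apply f) x\<bar> \<le> e) \<longrightarrow>
        (\<forall>vs\<in>V. \<forall>x\<in>K. \<bar>dderivs vs (smooth_apply (T f)) x\<bar> \<le> C * e))"
  shows "\<langle>f, Dual (\<lambda>f. \<langle>T f, \<mu>\<rangle>)\<rangle> = \<langle>T f, \<mu>\<rangle>"
proof -
  have linear: "linear (\<lambda>f. \<langle>T f, \<mu>\<rangle>)"
    by (rule linearI_lincomb) (simp add: lin pairing_lincomb)
  obtain K V C where K: "compact K" "finite V" "C \<ge> 0"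
    "\<And>f e. e \<ge> 0 \<Longrightarrow> \<forall>vs\<in>V. \<forall>x\<in>K. \<bar>dderivs vs (smooth_apply f) x\<bar> \<le> e \<Longrightarrow> \<bar>\<langle>f, \<mu>\<rangle>\<bar> \<le> C * e"
    using dual_smooth_bound[of \<mu>] by blast
  obtain K' V' C' where K': "compact K'" "finite V'" "C' \<ge> 0"
    "\<forall>f e. e \<ge> 0 \<longrightarrow> (\<forall>vs\<in>V'. \<forall>x\<in>K'. \<bar>dderivs vs (smooth_apply f) x\<bar> \<le> e) \<longrightarrow>
        (\<forall>vs\<in>V. \<forall>x\<in>K. \<bar>dderivs vs (smooth_apply (T f)) x\<bar> \<le> C' * e)"
    using bd[OF K(1,2)] by (elim exE conjE) (rule that)
  have "\<bar>\<langle>T f, \<mu>\<rangle>\<bar> \<le> (C * C') * e"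
    if "e \<ge> 0" "\<forall>vs\<in>V'. \<forall>x\<in>K'. \<bar>dderivs vs (smooth_apply f) x\<bar> \<le> e" for f e
    using K(4)[of "C' * e" "T f"] K'(3,4) that by (simp add: mult.assoc)
  then have "continuous_on UNIV (\<lambda>f. \<langle>T f, \<mu>\<rangle>)"
    unfolding continuous_functional_iff[OF linear] using K(3) K'(1-3)
    by (intro exI[of _ K'] exI[of _ V'] exI[of _ "C * C'"]) auto
  then show ?thesis using linear by (simp add: Dual_inverse)
qed

lemma pairing_tensor: "\<langle>\<Phi>, tensor \<gamma> \<mu>\<rangle> = \<langle>partial_pairing \<Phi> \<mu>, \<gamma>\<rangle>"
  unfolding tensor_def
proof (rule pairing_Dual_compose)
  show "partial_pairing (a *\<^sub>R \<Phi> + \<Psi>) \<mu> = a *\<^sub>R partial_pairing \<Phi> \<mu> + partial_pairing \<Psi> \<mu>" for a \<Phi> \<Psi>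
    by (rule smooth_eqI)
      (simp add: smooth_apply_partial_pairing slice_lincomb pairing_lincomb plus_smooth.rep_eq scaleR_smooth.rep_eq)
next
  fix K :: "'a set" and V :: "'a list set"
  assume KV: "compact K" "finite V"
  obtain L U C where L: "compact L" "finite U" "C \<ge> 0"
    "\<And>f e. e \<ge> 0 \<Longrightarrow> \<forall>vs\<in>U. \<forall>x\<in>L. \<bar>dderivs vs (smooth_apply f) x\<bar> \<le> e \<Longrightarrow> \<bar>\<langle>f, \<mu>\<rangle>\<bar> \<le> C * e"
    using dual_smooth_bound[of \<mu>] by blast
  show "\<exists>K' V' C. compact K' \<and> finite V' \<and> C \<ge> 0 \<and>
      (\<forall>\<Phi> e. e \<ge> 0 \<longrightarrow> (\<forall>vs\<in>V'. \<forall>x\<in>K'. \<bar>dderivs vs (smooth_apply \<Phi>) x\<bar> \<le> e) \<longrightarrow>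
        (\<forall>vs\<in>V. \<forall>x\<in>K. \<bar>dderivs vs (smooth_apply (partial_pairing \<Phi> \<mu>)) x\<bar> \<le> C * e))"
  proof (intro exI[of _ "K \<times> L"] exI[of _ "(\<lambda>(us, vs). map (Pair 0) us @ map (\<lambda>v. (v, 0)) vs) ` (U \<times> V)"]
      exI[of _ C] conjI allI impI ballI)
    fix \<Phi> e vs x
    assume e: "0 \<le> e" and v: "vs \<in> V" "x \<in> K" and
      \<Phi>: "\<forall>vs\<in>(\<lambda>(us, vs). map (Pair 0) us @ map (\<lambda>v. (v, 0)) vs) ` (U \<times> V).
        \<forall>x\<in>K \<times> L. \<bar>dderivs vs (smooth_apply \<Phi>) x\<bar> \<le> e"
    show "\<bar>dderivs vs (smooth_apply (partial_pairing \<Phi> \<mu>)) x\<bar> \<le> C * e"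
      unfolding dderivs_partial_pairing
    proof (intro L(4) e ballI)
      fix us y assume "us \<in> U" "y \<in> L"
      then show "\<bar>dderivs us (smooth_apply (slice (foldr smooth_deriv (map (\<lambda>v. (v, 0)) vs) \<Phi>) x)) y\<bar> \<le> e"
        using \<Phi> v by (force simp: dderivs_slice smooth_apply_foldr_smooth_deriv dderivs_append[symmetric])
    qed
  qed (use KV L in \<open>auto intro: compact_Times\<close>)
qed

subsection \<open>Operations on compactly supported distributions\<close>

definition distr_deriv :: "'a::euclidean_space \<Rightarrow> 'a distr \<Rightarrow> 'a distr" where
  "distr_deriv v \<mu> = Dual (\<lambda>f. - \<langle>smooth_deriv v f, \<mu>\<rangle>)"

definition distr_mult :: "'a::euclidean_space smooth \<Rightarrow> 'a distr \<Rightarrow> 'a distr" where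
  "distr_mult g \<mu> = Dual (\<lambda>f. \<langle>g * f, \<mu>\<rangle>)"

definition spatial_density :: "('a::euclidean_space \<times> 'b::euclidean_space) distr \<Rightarrow> 'a distr" where
  "spatial_density \<gamma> = Dual (\<lambda>f. \<langle>tensor_one f, \<gamma>\<rangle>)"

text \<open>\<open>(g * \<mu>)(x) = \<langle>g(x - \<cdot>), \<mu>\<rangle>\<close>\<close>

definition convolution :: "'a::euclidean_space smooth \<Rightarrow> 'a distr \<Rightarrow> 'a smooth" where
  "convolution g \<mu> = partial_pairing (difference_kernel g) \<mu>"

lemma pairing_distr_deriv: "\<langle>f, distr_deriv v \<mu>\<rangle> = - \<langle>smooth_deriv v f, \<mu>\<rangle>"
proof -
  have "\<langle>f, Dual (\<lambda>f. \<langle>- smooth_deriv v f, \<mu>\<rangle>)\<rangle> = \<langle>- smooth_deriv v f, \<mu>\<rangle>"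
  proof (rule pairing_Dual_compose)
    show "- smooth_deriv v (a *\<^sub>R f + g) = a *\<^sub>R - smooth_deriv v f + - smooth_deriv v g" for a f g
      by (simp add: smooth_deriv_lincomb_right)
  next
    fix K :: "'a set" and V :: "'a list set"
    assume KV: "compact K" "finite V"
    then show "\<exists>K' V' C. compact K' \<and> finite V' \<and> C \<ge> 0 \<and>
      (\<forall>f e. e \<ge> 0 \<longrightarrow> (\<forall>vs\<in>V'. \<forall>x\<in>K'. \<bar>dderivs vs (smooth_apply f) x\<bar> \<le> e) \<longrightarrow>
        (\<forall>vs\<in>V. \<forall>x\<in>K. \<bar>dderivs vs (smooth_apply (- smooth_deriv v f)) x\<bar> \<le> C * e))"
      by (intro exI[of _ K] exI[of _ "(\<lambda>vs. vs @ [v]) ` V"] exI[of _ 1])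
        (auto simp: dderivs_smooth_deriv)
  qed
  then show ?thesis by (simp add: distr_deriv_def linear_neg[OF linear_dual_apply])
qed

lemma pairing_distr_mult: "\<langle>f, distr_mult g \<mu>\<rangle> = \<langle>g * f, \<mu>\<rangle>"
  unfolding distr_mult_def
proof (rule pairing_Dual_compose)
  show "g * (a *\<^sub>R f + h) = a *\<^sub>R (g * f) + g * h" for a f h
    by (simp add: distrib_left)
next
  fix K :: "'a set" and V :: "'a list set"
  assume KV: "compact K" "finite V"
  define S where "S = (\<Union>vs\<in>V. set (splits vs))"
  have S: "finite S" using KV by (simp add: S_def)
  obtain M where M: "M > 0" "\<forall>vs\<in>fst ` S. \<forall>x\<in>K. \<bar>dderivs vs (smooth_apply g) x\<bar> \<le> M"
    using dderivs_bounded_on_compact[OF KV(1), of "fst ` S"] S by blast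
  define n where "n = Max (insert 0 ((\<lambda>vs. length (splits vs)) ` V))"
  have n: "length (splits vs) \<le> n" if "vs \<in> V" for vs
    unfolding n_def using KV that by (intro Max_ge) auto
  show "\<exists>K' V' C. compact K' \<and> finite V' \<and> C \<ge> 0 \<and>
      (\<forall>f e. e \<ge> 0 \<longrightarrow> (\<forall>vs\<in>V'. \<forall>x\<in>K'. \<bar>dderivs vs (smooth_apply f) x\<bar> \<le> e) \<longrightarrow>
        (\<forall>vs\<in>V. \<forall>x\<in>K. \<bar>dderivs vs (smooth_apply (g * f)) x\<bar> \<le> C * e))"
  proof (intro exI[of _ K] exI[of _ "snd ` S"] exI[of _ "real n * M"] conjI allI impI ballI)
    fix f e vs x
    assume e: "0 \<le> e" and v: "vs \<in> V" "x \<in> K"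
      and f: "\<forall>vs\<in>snd ` S. \<forall>x\<in>K. \<bar>dderivs vs (smooth_apply f) x\<bar> \<le> e"
    have bound: "\<bar>\<Sum>p\<leftarrow>ps. dderivs (fst p) (smooth_apply g) x * dderivs (snd p) (smooth_apply f) x\<bar>
        \<le> real (length ps) * (M * e)" if "set ps \<subseteq> S" for ps
      using that
    proof (induction ps)
      case (Cons p ps)
      have "\<bar>dderivs (fst p) (smooth_apply g) x * dderivs (snd p) (smooth_apply f) x\<bar> \<le> M * e"
        unfolding abs_mult using M f v(2) Cons.prems by (intro mult_mono) auto
      then show ?case using Cons by (simp add: distrib_right)
    qed simp
    have "\<bar>dderivs vs (smooth_apply (g * f)) x\<bar> =
        \<bar>\<Sum>p\<leftarrow>splits vs. dderivs (fst p) (smooth_apply g) x * dderivs (snd p) (smooth_apply f) x\<bar>"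
      by (simp add: times_smooth.rep_eq dderivs_mult)
    also have "\<dots> \<le> real (length (splits vs)) * (M * e)"
      using v(1) by (intro bound) (auto simp: S_def)
    also have "\<dots> \<le> real n * (M * e)"
      using n[OF v(1)] M(1) e by (intro mult_right_mono) auto
    finally show "\<bar>dderivs vs (smooth_apply (g * f)) x\<bar> \<le> real n * M * e" by (simp add: mult.assoc)
  qed (use KV S M in auto)
qed

lemma pairing_spatial_density: "\<langle>f, spatial_density \<gamma>\<rangle> = \<langle>tensor_one f, \<gamma>\<rangle>"
  unfolding spatial_density_def
proof (rule pairing_Dual_compose)
  show "tensor_one (a *\<^sub>R f + g) = a *\<^sub>R tensor_one f + (tensor_one g :: ('a \<times> 'b) smooth)" for a and f g :: "'a smooth"
    by transfer simp
next
  fix K :: "('a \<times> 'b) set" and V :: "('a \<times> 'b) list set"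
  assume KV: "compact K" "finite V"
  then show "\<exists>K' V' C. compact K' \<and> finite V' \<and> C \<ge> 0 \<and>
      (\<forall>f e. e \<ge> 0 \<longrightarrow> (\<forall>vs\<in>V'. \<forall>x\<in>K'. \<bar>dderivs vs (smooth_apply f) x\<bar> \<le> e) \<longrightarrow>
        (\<forall>vs\<in>V. \<forall>x\<in>K. \<bar>dderivs vs (smooth_apply (tensor_one f :: ('a \<times> 'b) smooth)) x\<bar> \<le> C * e))"
    by (intro exI[of _ "fst ` K"] exI[of _ "map fst ` V"] exI[of _ 1])
      (auto simp: dderivs_tensor_one intro!: compact_continuous_image continuous_intros)
qed

lemma smooth_apply_convolution:
  "smooth_apply (convolution g \<mu>) x = \<langle>slice (difference_kernel g) x, \<mu>\<rangle>"
  by (simp add: convolution_def smooth_apply_partial_pairing)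

section \<open>Gateaux smoothness\<close>

definition gateaux_deriv ::
  "('a::topological_real_vector \<Rightarrow> 'b::{topological_real_vector, t2_space}) \<Rightarrow> 'a \<Rightarrow> 'a \<Rightarrow> 'b" where
  "gateaux_deriv f x h = Lim (at 0) (\<lambda>t. (f (x + t *\<^sub>R h) - f x) /\<^sub>R t)"

definition gateaux_differentiable ::
  "('a::topological_real_vector \<Rightarrow> 'b::{topological_real_vector, t2_space}) \<Rightarrow> 'a \<Rightarrow> 'a \<Rightarrow> bool" where
  "gateaux_differentiable f x h \<longleftrightarrow> (\<exists>l. ((\<lambda>t. (f (x + t *\<^sub>R h) - f x) /\<^sub>R t) \<longlongrightarrow> l) (at 0))"

text \<open>The directions of \<open>d\<^sup>nf[x](h\<^sub>0, \<dots>, h\<^bsub>n-1\<^esub>)\<close> are the first \<open>n\<close> entries of a sequence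
  \<open>h\<close>, the remaining entries being irrelevant.  Hence joint continuity on \<open>X \<times> X\<^sup>n\<close> is
  continuity on \<open>X \<times> (nat \<Rightarrow> X)\<close> for the product topology.\<close>

primrec iter_gateaux_deriv ::
  "nat \<Rightarrow> ('a::topological_real_vector \<Rightarrow> 'b::{topological_real_vector, t2_space}) \<Rightarrow> 'a \<Rightarrow> (nat \<Rightarrow> 'a) \<Rightarrow> 'b" where
  "iter_gateaux_deriv 0 f x h = f x"
| "iter_gateaux_deriv (Suc n) f x h = gateaux_deriv (\<lambda>y. iter_gateaux_deriv n f y h) x (h n)"

definition gateaux_smooth ::
  "('a::topological_real_vector \<Rightarrow> 'b::{topological_real_vector, t2_space}) \<Rightarrow> bool" where
  "gateaux_smooth f \<longleftrightarrow>
     (\<forall>n. (\<forall>x h. gateaux_differentiable (\<lambda>y. iter_gateaux_deriv n f y h) x (h n)) \<and>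
          continuous_on UNIV (\<lambda>(x, h). iter_gateaux_deriv n f x h))"

text \<open>Curves on a set \<open>I\<close> of times; only the values on \<open>I\<close> matter, and derivatives at end points
  of an interval are one-sided.\<close>

definition curve_deriv :: "real set \<Rightarrow> (real \<Rightarrow> 'b::{topological_real_vector, t2_space}) \<Rightarrow> real \<Rightarrow> 'b" where
  "curve_deriv I \<gamma> t = Lim (at t within I) (\<lambda>s. (\<gamma> s - \<gamma> t) /\<^sub>R (s - t))"

definition smooth_curve_on :: "real set \<Rightarrow> (real \<Rightarrow> 'b::{topological_real_vector, t2_space}) \<Rightarrow> bool" where
  "smooth_curve_on I \<gamma> \<longleftrightarrow>
     (\<forall>n. continuous_on I ((curve_deriv I ^^ n) \<gamma>) \<and>
       (\<forall>t\<in>I. \<exists>l. ((\<lambda>s. ((curve_deriv I ^^ n) \<gamma> s - (curve_deriv I ^^ n) \<gamma> t) /\<^sub>R (s - t)) \<longlongrightarrow> l)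
          (at t within I)))"

section \<open>The Lie-Poisson space of compactly supported distributions on phase space\<close>

type_synonym 'd phase = "(real ^ 'd) \<times> (real ^ 'd)"

abbreviation x_dir :: "'d::finite \<Rightarrow> 'd phase" where "x_dir i \<equiv> (axis i 1, 0)"
abbreviation v_dir :: "'d::finite \<Rightarrow> 'd phase" where "v_dir i \<equiv> (0, axis i 1)"

definition lie_bracket :: "'d::finite phase smooth \<Rightarrow> 'd phase smooth \<Rightarrow> 'd phase smooth" where
  "lie_bracket f g =
     (\<Sum>i\<in>UNIV. smooth_deriv (x_dir i) f * smooth_deriv (v_dir i) g) -
     (\<Sum>i\<in>UNIV. smooth_deriv (v_dir i) f * smooth_deriv (x_dir i) g)"

text \<open>The derivative of \<open>F\<close> at \<open>\<gamma>\<close>, an element of the bidual, identified with an element of the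
  (reflexive) predual.\<close>

definition dual_gradient :: "('a::topological_real_vector dual \<Rightarrow> real) \<Rightarrow> 'a dual \<Rightarrow> 'a" where
  "dual_gradient F \<gamma> = (THE f. \<forall>\<mu>. gateaux_deriv F \<gamma> \<mu> = \<langle>f, \<mu>\<rangle>)"

definition lie_poisson_bracket ::
  "('d::finite phase distr \<Rightarrow> real) \<Rightarrow> ('d phase distr \<Rightarrow> real) \<Rightarrow> 'd phase distr \<Rightarrow> real" where
  "lie_poisson_bracket F G \<gamma> = \<langle>lie_bracket (dual_gradient F \<gamma>) (dual_gradient G \<gamma>), \<gamma>\<rangle>"

definition hamiltonian_vector_field ::
  "('d::finite phase distr \<Rightarrow> real) \<Rightarrow> 'd phase distr \<Rightarrow> 'd phase distr" where
  "hamiltonian_vector_field G =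
     (THE X. gateaux_smooth X \<and>
       (\<forall>F. gateaux_smooth F \<longrightarrow> (\<forall>\<gamma>. gateaux_deriv F \<gamma> (X \<gamma>) = lie_poisson_bracket F G \<gamma>)))"

section \<open>The Vlasov equation\<close>

lift_definition kinetic_energy :: "'d::finite phase smooth" is "\<lambda>z. (norm (snd z))\<^sup>2 / 2"
proof (rule smooth_function_stepI[where G = "\<lambda>h z. snd z \<bullet> snd h"])
  fix z :: "'d phase"
  show "((\<lambda>z. (norm (snd z))\<^sup>2 / 2) has_derivative (\<lambda>h. snd z \<bullet> snd h)) (at z)"
    unfolding power2_norm_eq_inner
    by (auto intro!: derivative_eq_intros simp: inner_commute)
qed (intro smooth_function_linear bounded_linear_intros)

lift_definition velocity :: "'d::finite \<Rightarrow> 'd phase smooth" is "\<lambda>i z. snd z $ i"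
  by (intro smooth_function_linear bounded_linear_compose[OF bounded_linear_vec_nth] bounded_linear_snd)

lift_definition pair_interaction :: "(real ^ 'd::finite) smooth \<Rightarrow> ('d phase \<times> 'd phase) smooth"
  is "\<lambda>W (z\<^sub>1, z\<^sub>2). W (fst z\<^sub>1 - fst z\<^sub>2)"
  unfolding case_prod_beta
  by (rule smooth_function_compose_linear)
    (auto intro!: bounded_linear_sub bounded_linear_fst_comp bounded_linear_snd_comp bounded_linear_intros)

definition vlasov_hamiltonian :: "(real ^ 'd::finite) smooth \<Rightarrow> 'd phase distr \<Rightarrow> real" where
  "vlasov_hamiltonian W \<gamma> = \<langle>kinetic_energy, \<gamma>\<rangle> + \<langle>pair_interaction W, tensor \<gamma> \<gamma>\<rangle>"

definition vlasov_solution :: "(real ^ 'd::finite) smooth \<Rightarrow> real set \<Rightarrow> (real \<Rightarrow> 'd phase distr) \<Rightarrow> bool" where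
  "vlasov_solution W I \<gamma> \<longleftrightarrow>
     (\<forall>t\<in>I. curve_deriv I \<gamma> t
        + (\<Sum>i\<in>UNIV. distr_mult (velocity i) (distr_deriv (x_dir i) (\<gamma> t)))
        - 2 *\<^sub>R (\<Sum>i\<in>UNIV.
            distr_mult (tensor_one (convolution (smooth_deriv (axis i 1) W) (spatial_density (\<gamma> t))))
              (distr_deriv (v_dir i) (\<gamma> t))) = 0)"

end

theory Submission
  imports Defs
begin

text \<open>The candidate for the Hamiltonian vector field is the sum of a linear and a quadratic vector
  field read off from the Vlasov equation.  It is smooth because the tensor product is \<^emph>\<open>jointly\<close>
  continuous for the strong topologies: the predual is metrizable, so countably many bounded sets
  can be rescaled to have a bounded union.  That it satisfies the defining identity for every
  smooth \<open>F\<close> rests on the reflexivity of the space of smooth functions, which provides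
  \<open>dF[\<gamma>]\<close> as an element of the predual; reflexivity is proved by approximating a functional on the dual
  at finitely many points from the bipolar of a bounded set.  Uniqueness follows by testing with the
  linear functionals \<open>F = \<langle>f, \<cdot>\<rangle>\<close>.\<close>

section \<open>Bounded sets of smooth functions\<close>

text \<open>Gateaux smoothness asks for derivatives that are continuous jointly in the base point
  and the directions, and the strong dual is not metrizable. The second derivative of a quadratic
  field evaluates a bilinear map at two independent directions, so the tensor product has to be
  bounded on products of polars, where separate continuity gives no direct control.

  A second obstacle is that \<open>tensor\<close> is an iterated pairing and not visibly symmetric.
  The first variation of the interaction energy consists of two pairings in opposite order; a Fubini
  theorem for distributions, together with the evenness of \<open>W\<close>, merges them into twice
  one of them. This is the origin of the factor 2 in the force. Reflexivity therefore serves twice,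
  for the gradients and for Fubini.

  In the proof of reflexivity no limit of approximants is formed: the representing function is known
  beforehand, and an approximant only has to be close to it on one compact set. Bounds on
  derivatives of one order higher reduce this to a finite net.\<close>

lemma dderivs_sum_smooth:
  "dderivs vs (smooth_apply (\<Sum>i\<in>A. f i)) x = (\<Sum>i\<in>A. dderivs vs (smooth_apply (f i)) x)"
  by (induction A rule: infinite_finite_induct) auto

lemma smooth_deriv_Basis_expansion:
  "smooth_deriv v f = (\<Sum>b\<in>Basis. (v \<bullet> b) *\<^sub>R smooth_deriv b f)"
proof -
  have lin: "linear (\<lambda>v. smooth_deriv v f)"
    by (rule linearI_lincomb) (rule smooth_deriv_lincomb)
  have "smooth_deriv v f = smooth_deriv (\<Sum>b\<in>Basis. (v \<bullet> b) *\<^sub>R b) f"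
    by (simp add: euclidean_representation)
  also have "\<dots> = (\<Sum>b\<in>Basis. (v \<bullet> b) *\<^sub>R smooth_deriv b f)"
    by (simp only: linear_sum[OF lin] linear_cmul[OF lin])
  finally show ?thesis .
qed

text \<open>Directions are arbitrary vectors, so the seminorms defining the topology form an
  uncountable family. Expanding one direction at a time bounds each of them by the finitely many
  basis derivatives of the same order, which leaves countably many seminorms.\<close>

lemma dderivs_bound_Basis:
  fixes vs :: "'a::euclidean_space list"
  shows "\<exists>C\<ge>0. \<forall>f x e. e \<ge> 0 \<longrightarrow>
     (\<forall>bs. set bs \<subseteq> Basis \<and> length bs = length vs \<longrightarrow> \<bar>dderivs bs (smooth_apply f) x\<bar> \<le> e) \<longrightarrow>
     \<bar>dderivs vs (smooth_apply f) x\<bar> \<le> C * e"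
proof (induction vs rule: rev_induct)
  case Nil
  then show ?case by (auto intro!: exI[of _ 1])
next
  case (snoc v vs)
  then obtain C where C: "C \<ge> 0" "\<And>f x e. e \<ge> 0 \<Longrightarrow>
      \<forall>bs. set bs \<subseteq> Basis \<and> length bs = length vs \<longrightarrow> \<bar>dderivs bs (smooth_apply f) x\<bar> \<le> e \<Longrightarrow>
      \<bar>dderivs vs (smooth_apply f) x\<bar> \<le> C * e"
    by blast
  show ?case
  proof (intro exI[of _ "(\<Sum>b\<in>Basis. \<bar>v \<bullet> b\<bar>) * C"] conjI allI impI)
    fix f :: "'a smooth" and x e
    assume e: "e \<ge> 0" and *: "\<forall>bs. set bs \<subseteq> Basis \<and> length bs = length (vs @ [v]) \<longrightarrow>
        \<bar>dderivs bs (smooth_apply f) x\<bar> \<le> e"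
    have b: "\<bar>dderivs vs (smooth_apply (smooth_deriv b f)) x\<bar> \<le> C * e" if "b \<in> Basis" for b
      using that * by (intro C(2) e) (auto simp: dderivs_smooth_deriv)
    have "\<bar>dderivs (vs @ [v]) (smooth_apply f) x\<bar> =
        \<bar>\<Sum>b\<in>Basis. (v \<bullet> b) * dderivs vs (smooth_apply (smooth_deriv b f)) x\<bar>"
      by (simp add: dderivs_smooth_deriv[symmetric] smooth_deriv_Basis_expansion[of v] dderivs_sum_smooth)
    also have "\<dots> \<le> (\<Sum>b\<in>Basis. \<bar>v \<bullet> b\<bar> * (C * e))"
      by (rule order_trans[OF sum_abs], rule sum_mono) (auto simp: abs_mult intro: mult_left_mono b)
    finally show "\<bar>dderivs (vs @ [v]) (smooth_apply f) x\<bar> \<le> (\<Sum>b\<in>Basis. \<bar>v \<bullet> b\<bar>) * C * e"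
      by (simp add: sum_distrib_right mult.assoc)
  qed (use C(1) in \<open>auto intro!: mult_nonneg_nonneg sum_nonneg\<close>)
qed

lemma tvs_boundedI:
  assumes "\<And>P. eventually P (nhds 0) \<Longrightarrow> \<exists>r>0. \<forall>s\<ge>r. \<forall>f\<in>B. P (inverse s *\<^sub>R f)"
  shows "tvs_bounded B"
  unfolding tvs_bounded_def
proof (intro allI impI)
  fix U :: "'a set" assume "open U \<and> 0 \<in> U"
  then have "eventually (\<lambda>f. f \<in> U) (nhds 0)" by (auto simp: eventually_nhds)
  from assms[OF this] obtain r where r: "r > 0" "\<And>s f. s \<ge> r \<Longrightarrow> f \<in> B \<Longrightarrow> inverse s *\<^sub>R f \<in> U"
    by blast
  have "B \<subseteq> (\<lambda>x. s *\<^sub>R x) ` U" if "s \<ge> r" for s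
  proof
    fix f assume "f \<in> B"
    then show "f \<in> (\<lambda>x. s *\<^sub>R x) ` U"
      using r(1) r(2)[OF that, of f] that by (intro image_eqI[of _ _ "inverse s *\<^sub>R f"]) auto
  qed
  then show "\<exists>r>0. \<forall>s\<ge>r. B \<subseteq> (\<lambda>x. s *\<^sub>R x) ` U" using r(1) by blast
qed

lemma tvs_boundedD:
  assumes "tvs_bounded B" "eventually P (nhds 0)"
  shows "\<exists>r>0. \<forall>s\<ge>r. \<forall>f\<in>B. P (inverse s *\<^sub>R f)"
proof -
  obtain U where U: "open U" "0 \<in> U" "\<And>f. f \<in> U \<Longrightarrow> P f"
    using assms(2) by (auto simp: eventually_nhds)
  obtain r where r: "r > 0" "\<And>s. s \<ge> r \<Longrightarrow> B \<subseteq> (\<lambda>x. s *\<^sub>R x) ` U"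
    using assms(1) U unfolding tvs_bounded_def by blast
  have "P (inverse s *\<^sub>R f)" if s: "s \<ge> r" and f: "f \<in> B" for s f
  proof -
    obtain u where "f = s *\<^sub>R u" "u \<in> U" using r(2)[OF s] f by blast
    then show ?thesis using U(3) r(1) s by simp
  qed
  then show ?thesis using r(1) by blast
qed

lemma tvs_bounded_scaleR:
  assumes "tvs_bounded B"
  shows "tvs_bounded ((\<lambda>f. c *\<^sub>R f) ` B)"
proof (rule tvs_boundedI)
  fix P :: "'a \<Rightarrow> bool" assume P: "eventually P (nhds 0)"
  have "((\<lambda>f::'a. c *\<^sub>R f) \<longlongrightarrow> c *\<^sub>R 0) (nhds 0)"
    by (intro tendsto_scaleR_tvs tendsto_const filterlim_ident)
  then have "eventually (\<lambda>f. P (c *\<^sub>R f)) (nhds 0)"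
    using P by (auto intro: eventually_compose_filterlim)
  from tvs_boundedD[OF assms this]
  show "\<exists>r>0. \<forall>s\<ge>r. \<forall>f\<in>(\<lambda>f. c *\<^sub>R f) ` B. P (inverse s *\<^sub>R f)"
    by (auto simp: mult.commute)
qed

lemma tvs_bounded_smooth_iff:
  "tvs_bounded B \<longleftrightarrow>
     (\<forall>vs K. compact K \<longrightarrow> (\<exists>M. \<forall>f\<in>B. \<forall>x\<in>K. \<bar>dderivs vs (smooth_apply f) x\<bar> \<le> M))"
    (is "_ \<longleftrightarrow> ?R")
proof
  assume B: "tvs_bounded B"
  show ?R
  proof (intro allI impI)
    fix vs and K :: "'a set" assume K: "compact K"
    have "\<forall>\<^sub>F f in nhds 0. \<forall>x\<in>K. \<bar>dderivs vs (smooth_apply f) x\<bar> \<le> 1"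
      unfolding eventually_nhds_smooth using K
      by (intro exI[of _ K] exI[of _ "{vs}"] exI[of _ 1]) (auto intro: less_imp_le)
    from tvs_boundedD[OF B this] obtain r where r: "r > 0"
      "\<And>f x. f \<in> B \<Longrightarrow> x \<in> K \<Longrightarrow> \<bar>dderivs vs (smooth_apply (inverse r *\<^sub>R f)) x\<bar> \<le> 1"
      by blast
    then have "\<bar>dderivs vs (smooth_apply f) x\<bar> \<le> r" if "f \<in> B" "x \<in> K" for f x
      using r(2)[OF that] r(1) by (simp add: abs_mult field_simps)
    then show "\<exists>M. \<forall>f\<in>B. \<forall>x\<in>K. \<bar>dderivs vs (smooth_apply f) x\<bar> \<le> M" by blast
  qed
next
  assume R: ?R
  show "tvs_bounded B"
  proof (rule tvs_boundedI)
    fix P :: "'a smooth \<Rightarrow> bool" assume "eventually P (nhds 0)"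
    then obtain K V e where K: "compact K" "finite V" "e > 0"
      "\<And>g. \<forall>vs\<in>V. \<forall>x\<in>K. \<bar>dderivs vs (smooth_apply g) x\<bar> < e \<Longrightarrow> P g"
      unfolding eventually_nhds_smooth by auto
    have "\<forall>vs. \<exists>M. \<forall>f\<in>B. \<forall>x\<in>K. \<bar>dderivs vs (smooth_apply f) x\<bar> \<le> M"
      using R K(1) by blast
    then obtain M where M: "\<And>vs f x. f \<in> B \<Longrightarrow> x \<in> K \<Longrightarrow> \<bar>dderivs vs (smooth_apply f) x\<bar> \<le> M vs"
      unfolding choice_iff by blast
    define N where "N = 1 + (\<Sum>vs\<in>V. \<bar>M vs\<bar>)"
    have N: "N > 0" by (simp add: N_def add_pos_nonneg sum_nonneg)
    have MN: "M vs < N" if "vs \<in> V" for vs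
      using member_le_sum[OF that, of "\<lambda>vs. \<bar>M vs\<bar>"] K(2) by (auto simp: N_def)
    have "P (inverse s *\<^sub>R f)" if s: "s \<ge> N / e" and f: "f \<in> B" for s f
    proof (rule K(4), intro ballI)
      fix vs x assume v: "vs \<in> V" "x \<in> K"
      have s0: "s > 0" using s N K(3) by (meson divide_pos_pos less_le_trans)
      have "\<bar>dderivs vs (smooth_apply f) x\<bar> < N" using M[OF f v(2), of vs] MN[OF v(1)] by linarith
      also have "N \<le> s * e" using s K(3) by (simp add: field_simps)
      finally show "\<bar>dderivs vs (smooth_apply (inverse s *\<^sub>R f)) x\<bar> < e"
        using s0 by (simp add: abs_mult field_simps)
    qed
    then show "\<exists>r>0. \<forall>s\<ge>r. \<forall>f\<in>B. P (inverse s *\<^sub>R f)"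
      using N K(3) by (intro exI[of _ "N / e"]) auto
  qed
qed

text \<open>The countable form of the boundedness criterion: words of basis vectors and balls of
  integer radius are enough, since every compact set lies in such a ball. It permits diagonal
  choices over the conditions.\<close>

lemma tvs_bounded_smooth_BasisI:
  fixes B :: "'a::euclidean_space smooth set"
  assumes "\<And>bs n. set bs \<subseteq> Basis \<Longrightarrow>
    \<exists>M. \<forall>f\<in>B. \<forall>x\<in>cball 0 (real n). \<bar>dderivs bs (smooth_apply f) x\<bar> \<le> M"
  shows "tvs_bounded B"
  unfolding tvs_bounded_smooth_iff
proof (intro allI impI)
  fix vs :: "'a list" and K :: "'a set" assume "compact K"
  then obtain r where r: "\<And>x. x \<in> K \<Longrightarrow> norm x \<le> r"
    using compact_imp_bounded bounded_iff by metis
  obtain n where "r \<le> real n" using real_arch_simple by blast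
  then have n: "K \<subseteq> cball 0 (real n)" using r by force
  obtain C where C: "C \<ge> 0" "\<And>f x e. e \<ge> 0 \<Longrightarrow>
      \<forall>bs. set bs \<subseteq> Basis \<and> length bs = length vs \<longrightarrow> \<bar>dderivs bs (smooth_apply f) x\<bar> \<le> e \<Longrightarrow>
      \<bar>dderivs vs (smooth_apply f) x\<bar> \<le> C * e"
    using dderivs_bound_Basis[of vs] by blast
  have "\<forall>bs. \<exists>M. set bs \<subseteq> Basis \<longrightarrow>
      (\<forall>f\<in>B. \<forall>x\<in>cball 0 (real n). \<bar>dderivs bs (smooth_apply f) x\<bar> \<le> M)"
    using assms by blast
  then obtain M where M: "\<And>bs f x. set bs \<subseteq> Basis \<Longrightarrow> f \<in> B \<Longrightarrow> x \<in> cball 0 (real n) \<Longrightarrow>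
      \<bar>dderivs bs (smooth_apply f) x\<bar> \<le> M bs"
    unfolding choice_iff by blast
  define L where "L = {bs :: 'a list. set bs \<subseteq> Basis \<and> length bs = length vs}"
  have L: "finite L" unfolding L_def by (intro finite_lists_length_eq) auto
  have "\<bar>dderivs vs (smooth_apply f) x\<bar> \<le> C * (\<Sum>bs\<in>L. \<bar>M bs\<bar>)" if f: "f \<in> B" and x: "x \<in> K" for f x
  proof (rule C(2))
    show "\<forall>bs. set bs \<subseteq> Basis \<and> length bs = length vs \<longrightarrow>
        \<bar>dderivs bs (smooth_apply f) x\<bar> \<le> (\<Sum>bs\<in>L. \<bar>M bs\<bar>)"
    proof (intro allI impI)
      fix bs :: "'a list" assume bs: "set bs \<subseteq> Basis \<and> length bs = length vs"
      then have "\<bar>M bs\<bar> \<le> (\<Sum>bs\<in>L. \<bar>M bs\<bar>)" using L by (intro member_le_sum) (auto simp: L_def)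
      moreover have "\<bar>dderivs bs (smooth_apply f) x\<bar> \<le> M bs" using M bs f x n by blast
      ultimately show "\<bar>dderivs bs (smooth_apply f) x\<bar> \<le> (\<Sum>bs\<in>L. \<bar>M bs\<bar>)" by linarith
    qed
  qed (simp add: sum_nonneg)
  then show "\<exists>M. \<forall>f\<in>B. \<forall>x\<in>K. \<bar>dderivs vs (smooth_apply f) x\<bar> \<le> M" by blast
qed

text \<open>Mackey's countability condition, which holds in every metrizable space.\<close>

lemma tvs_bounded_smooth_countable_Union:
  fixes S :: "nat \<Rightarrow> 'a::euclidean_space smooth set"
  assumes S: "\<And>n. tvs_bounded (S n)"
  obtains c where "\<And>n. c n > 0" "tvs_bounded (\<Union>n. (\<lambda>f. c n *\<^sub>R f) ` S n)"
proof -
  define L where "L m = {bs :: 'a list. set bs \<subseteq> Basis \<and> length bs \<le> m}" for m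
  have L: "finite (L m)" for m unfolding L_def by (intro finite_lists_length_le) auto
  have "\<forall>bs m n. \<exists>M. \<forall>f\<in>S n. \<forall>x\<in>cball 0 (real m). \<bar>dderivs bs (smooth_apply f) x\<bar> \<le> M"
    by (intro allI S[unfolded tvs_bounded_smooth_iff, rule_format] compact_cball)
  then obtain M where M: "\<And>bs m n f x. f \<in> S n \<Longrightarrow> x \<in> cball 0 (real m) \<Longrightarrow>
      \<bar>dderivs bs (smooth_apply f) x\<bar> \<le> M bs m n"
    unfolding choice_iff by (elim exE) (rule that, blast)
  define N where "N m n = (\<Sum>bs\<in>L m. \<bar>M bs m n\<bar>)" for m n
  have N0: "N m n \<ge> 0" for m n by (simp add: N_def sum_nonneg)
  have N: "\<bar>dderivs bs (smooth_apply f) x\<bar> \<le> N m n"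
    if "bs \<in> L m" "f \<in> S n" "x \<in> cball 0 (real m)" for bs m n f x
    using M[OF that(2,3), of bs] member_le_sum[OF that(1), of "\<lambda>bs. \<bar>M bs m n\<bar>"] L
    by (simp add: N_def)
  \<comment> \<open>Diagonal choice. The seminorm with index m controls the order of derivatives and
    the radius at once. Rescaling by \<open>c k\<close> makes it at most 1 on \<open>S k\<close> for
    every k \<ge> m, and the finitely many k < m are absorbed into the sum in the final
    bound.\<close>
  define c where "c n = inverse (1 + (\<Sum>m\<le>n. N m n))" for n
  have pos: "1 + (\<Sum>m\<le>n. N m n) \<ge> 1" for n using N0 by (simp add: sum_nonneg)
  have c: "c n > 0" "c n \<le> 1" for n
    using pos[of n] by (auto simp: c_def inverse_le_1_iff add_pos_nonneg)
  show thesis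
  proof (rule that[OF c(1)], rule tvs_bounded_smooth_BasisI)
    fix bs :: "'a list" and n assume bs: "set bs \<subseteq> Basis"
    define m where "m = max n (length bs)"
    have bsm: "bs \<in> L m" using bs by (simp add: L_def m_def)
    have "\<bar>dderivs bs (smooth_apply (c k *\<^sub>R f)) x\<bar> \<le> 1 + (\<Sum>k<m. N m k)"
      if f: "f \<in> S k" and x: "x \<in> cball 0 (real n)" for k f x
    proof -
      have "x \<in> cball 0 (real m)" using x by (auto simp: m_def)
      then have "\<bar>dderivs bs (smooth_apply (c k *\<^sub>R f)) x\<bar> \<le> c k * N m k"
        using N[OF bsm f] c(1)[of k] by (simp add: abs_mult)
      also have "\<dots> \<le> 1 + (\<Sum>k<m. N m k)"
      proof (cases "k < m")
        case True
        have "c k * N m k \<le> 1 * N m k" using c N0 by (intro mult_right_mono) auto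
        also have "\<dots> \<le> (\<Sum>k<m. N m k)" using True N0 by (simp add: member_le_sum)
        finally show ?thesis by simp
      next
        case False
        then have "N m k \<le> (\<Sum>m\<le>k. N m k)" using member_le_sum[of m "{..k}" "\<lambda>m. N m k"] N0 by simp
        then have "c k * N m k \<le> 1"
          using pos[of k] by (simp add: c_def field_simps)
        moreover have "(\<Sum>k<m. N m k) \<ge> 0" using N0 by (simp add: sum_nonneg)
        ultimately show ?thesis by linarith
      qed
      finally show ?thesis .
    qed
    then show "\<exists>M. \<forall>f\<in>\<Union>n. (\<lambda>f. c n *\<^sub>R f) ` S n. \<forall>x\<in>cball 0 (real n).
        \<bar>dderivs bs (smooth_apply f) x\<bar> \<le> M"
      by (intro exI[of _ "1 + (\<Sum>k<m. N m k)"]) auto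
  qed
qed

section \<open>Reflexivity\<close>

text \<open>Up to the sign (-1)^n, with n the length of \<open>vs\<close>, the derivative along
  \<open>vs\<close> of the Dirac measure at x. Without the sign, a functional \<phi> composed with
  it reproduces the derivatives of the function that represents \<phi>.\<close>

definition derivative_at :: "'a::euclidean_space list \<Rightarrow> 'a \<Rightarrow> 'a distr" where
  "derivative_at vs x = Dual (\<lambda>f. dderivs vs (smooth_apply f) x)"

lemma pairing_derivative_at: "\<langle>f, derivative_at vs x\<rangle> = dderivs vs (smooth_apply f) x"
proof -
  have lin: "linear (\<lambda>f. dderivs vs (smooth_apply f) x)"
    by (rule linearI_lincomb) simp
  have "continuous_on UNIV (\<lambda>f. dderivs vs (smooth_apply f) x)"
    unfolding continuous_functional_iff[OF lin]
    by (intro exI[of _ "{x}"] exI[of _ "{vs}"] exI[of _ 1]) auto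
  then show ?thesis using lin by (simp add: derivative_at_def Dual_inverse)
qed

lemma pairing_separates:
  fixes f g :: "'a::euclidean_space smooth"
  assumes "\<And>\<mu>. \<langle>f, \<mu>\<rangle> = \<langle>g, \<mu>\<rangle>"
  shows "f = g"
  using assms[of "derivative_at [] _"] by (intro smooth_eqI) (simp add: pairing_derivative_at)

lemma pairing_simps [simp]:
  "\<langle>f, \<mu> + \<nu>\<rangle> = \<langle>f, \<mu>\<rangle> + \<langle>f, \<nu>\<rangle>" "\<langle>f, \<mu> - \<nu>\<rangle> = \<langle>f, \<mu>\<rangle> - \<langle>f, \<nu>\<rangle>"
  "\<langle>f, - \<mu>\<rangle> = - \<langle>f, \<mu>\<rangle>" "\<langle>f, c *\<^sub>R \<mu>\<rangle> = c * \<langle>f, \<mu>\<rangle>" "\<langle>f, 0\<rangle> = 0"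
  by (transfer; simp)+

lemma pairing_left_simps [simp]:
  "\<langle>f + g, \<mu>\<rangle> = \<langle>f, \<mu>\<rangle> + \<langle>g, \<mu>\<rangle>" "\<langle>f - g, \<mu>\<rangle> = \<langle>f, \<mu>\<rangle> - \<langle>g, \<mu>\<rangle>"
  "\<langle>- f, \<mu>\<rangle> = - \<langle>f, \<mu>\<rangle>" "\<langle>c *\<^sub>R f, \<mu>\<rangle> = c * \<langle>f, \<mu>\<rangle>" "\<langle>0, \<mu>\<rangle> = 0"
  by (simp_all add: linear_add linear_diff linear_neg linear_cmul linear_0 linear_dual_apply)

lemma pairing_sum: "\<langle>f, \<Sum>i\<in>A. \<mu> i\<rangle> = (\<Sum>i\<in>A. \<langle>f, \<mu> i\<rangle>)"
  by (induction A rule: infinite_finite_induct) auto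

lemma pairing_sum_left: "\<langle>\<Sum>i\<in>A. f i, \<mu>\<rangle> = (\<Sum>i\<in>A. \<langle>f i, \<mu>\<rangle>)"
  by (induction A rule: infinite_finite_induct) auto

section \<open>Functionals on the strong dual and bipolars\<close>

text \<open>A continuous functional is bounded on some polar, and rescaling the bounded set
  normalises the constant to 1. An arbitrary s stands in for the supremum over \<open>B\<close>, so
  that the empty set is covered too.\<close>

lemma continuous_functional_dual_bound:
  fixes \<phi> :: "'a::topological_real_vector dual \<Rightarrow> real"
  assumes "linear \<phi>" "continuous_on UNIV \<phi>"
  obtains B where "tvs_bounded B"
    "\<And>\<mu> s. s \<ge> 0 \<Longrightarrow> \<forall>f\<in>B. \<bar>\<langle>f, \<mu>\<rangle>\<bar> \<le> s \<Longrightarrow> \<bar>\<phi> \<mu>\<bar> \<le> s"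
proof -
  have "(\<phi> \<longlongrightarrow> \<phi> 0) (nhds 0)"
    using assms(2) by (simp add: continuous_on_def tendsto_at_iff_tendsto_nhds)
  then have "\<forall>\<^sub>F \<mu> in nhds 0. \<bar>\<phi> \<mu>\<bar> < 1"
    using tendstoD[of \<phi> 0 "nhds 0" 1] assms by (simp add: linear_0)
  then obtain B e where B: "tvs_bounded B" "e > 0"
    "\<And>\<mu>. \<forall>f\<in>B. \<bar>\<langle>f, \<mu>\<rangle>\<bar> < e \<Longrightarrow> \<bar>\<phi> \<mu>\<bar> < 1"
    unfolding eventually_nhds_dual by auto
  show thesis
  proof (rule that[OF tvs_bounded_scaleR[OF B(1), of "2 / e"]])
    fix \<mu> and s :: real
    assume s: "s \<ge> 0" and \<mu>: "\<forall>f\<in>(\<lambda>f. (2 / e) *\<^sub>R f) ` B. \<bar>\<langle>f, \<mu>\<rangle>\<bar> \<le> s"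
    show "\<bar>\<phi> \<mu>\<bar> \<le> s"
    proof (rule field_le_epsilon)
      \<comment> \<open>Dividing by s + r instead of s covers the case s = 0.\<close>
      fix r :: real assume r: "r > 0"
      have "\<bar>\<langle>f, inverse (s + r) *\<^sub>R \<mu>\<rangle>\<bar> < e" if "f \<in> B" for f
      proof -
        have "2 / e * \<bar>\<langle>f, \<mu>\<rangle>\<bar> \<le> s" using \<mu> that B(2) by (simp add: abs_mult)
        then have "2 * \<bar>\<langle>f, \<mu>\<rangle>\<bar> \<le> s * e" using B(2) by (simp add: field_simps)
        also have "\<dots> < 2 * ((s + r) * e)"
          using s r B(2) by (simp add: algebra_simps add_nonneg_pos)
        finally show ?thesis using s r by (simp add: abs_mult field_simps)
      qed
      then have "\<bar>\<phi> (inverse (s + r) *\<^sub>R \<mu>)\<bar> < 1" using B(3) by blast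
      then show "\<bar>\<phi> \<mu>\<bar> \<le> s + r"
        using s r by (simp add: linear_cmul[OF assms(1)] abs_mult field_simps)
    qed
  qed
qed

text \<open>By the bipolar theorem, the weakly closed absolutely convex hull of \<open>B\<close>.
  Described by functionals, it inherits every bound that they satisfy on \<open>B\<close>.\<close>

definition bipolar :: "'a::topological_real_vector set \<Rightarrow> 'a set" where
  "bipolar B = {f. \<forall>\<mu> s. s \<ge> 0 \<longrightarrow> (\<forall>g\<in>B. \<bar>\<langle>g, \<mu>\<rangle>\<bar> \<le> s) \<longrightarrow> \<bar>\<langle>f, \<mu>\<rangle>\<bar> \<le> s}"

lemma bipolarD: "f \<in> bipolar B \<Longrightarrow> s \<ge> 0 \<Longrightarrow> (\<And>g. g \<in> B \<Longrightarrow> \<bar>\<langle>g, \<mu>\<rangle>\<bar> \<le> s) \<Longrightarrow> \<bar>\<langle>f, \<mu>\<rangle>\<bar> \<le> s"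
  unfolding bipolar_def by blast

lemma convex_bipolar: "convex (bipolar B)"
  unfolding convex_alt
proof (intro ballI allI impI)
  fix f g :: 'a and u :: real
  assume fg: "f \<in> bipolar B" "g \<in> bipolar B" and u: "0 \<le> u \<and> u \<le> 1"
  show "(1 - u) *\<^sub>R f + u *\<^sub>R g \<in> bipolar B"
    unfolding bipolar_def
  proof (intro CollectI allI impI)
    fix \<mu> and s :: real assume s: "s \<ge> 0" "\<forall>g\<in>B. \<bar>\<langle>g, \<mu>\<rangle>\<bar> \<le> s"
    have "\<bar>\<langle>f, \<mu>\<rangle>\<bar> \<le> s" "\<bar>\<langle>g, \<mu>\<rangle>\<bar> \<le> s" using fg s unfolding bipolar_def by blast+
    then have "\<bar>(1 - u) * \<langle>f, \<mu>\<rangle> + u * \<langle>g, \<mu>\<rangle>\<bar> \<le> s"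
      using convex_bound_le[of "\<langle>f, \<mu>\<rangle>" s "\<langle>g, \<mu>\<rangle>" "1 - u" u]
        convex_bound_le[of "- \<langle>f, \<mu>\<rangle>" s "- \<langle>g, \<mu>\<rangle>" "1 - u" u] u
      by (auto simp: abs_le_iff)
    then show "\<bar>\<langle>(1 - u) *\<^sub>R f + u *\<^sub>R g, \<mu>\<rangle>\<bar> \<le> s" by simp
  qed
qed

text \<open>A Helly-type theorem.  A near minimiser \<open>f\<close> of the squared error satisfies, up to a small
  error, the variational inequality of the projection onto the convex set \<open>bipolar B\<close>; testing the
  bound on \<open>\<phi>\<close> with the functional \<open>\<Sum>\<mu>. (\<phi> \<mu> - \<langle>f, \<mu>\<rangle>) \<mu>\<close> then shows that the squared error is small.\<close>

lemma bipolar_approximation: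
  fixes \<phi> :: "'a::topological_real_vector dual \<Rightarrow> real"
  assumes lin: "linear \<phi>" and B: "tvs_bounded B"
    and bound: "\<And>\<mu> s. s \<ge> 0 \<Longrightarrow> \<forall>f\<in>B. \<bar>\<langle>f, \<mu>\<rangle>\<bar> \<le> s \<Longrightarrow> \<bar>\<phi> \<mu>\<bar> \<le> s"
    and M: "finite M" and e: "e > 0"
  obtains f where "f \<in> bipolar B" "\<And>\<mu>. \<mu> \<in> M \<Longrightarrow> \<bar>\<langle>f, \<mu>\<rangle> - \<phi> \<mu>\<bar> < e"
proof -
  define J where "J f = (\<Sum>\<mu>\<in>M. (\<phi> \<mu> - \<langle>f, \<mu>\<rangle>)\<^sup>2)" for f
  have J0: "J f \<ge> 0" for f by (simp add: J_def sum_nonneg)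
  have zero: "0 \<in> bipolar B" unfolding bipolar_def by auto
  have "\<forall>\<mu>. \<exists>S>0. \<forall>f\<in>B. \<bar>\<langle>f, \<mu>\<rangle>\<bar> \<le> S"
    by (intro allI tvs_bounded_functional[OF B linear_dual_apply continuous_dual_apply])
  from choice[OF this] obtain S where "\<forall>\<mu>. S \<mu> > 0 \<and> (\<forall>f\<in>B. \<bar>\<langle>f, \<mu>\<rangle>\<bar> \<le> S \<mu>)" ..
  then have S: "\<And>\<mu>. S \<mu> > 0" "\<And>\<mu> f. f \<in> B \<Longrightarrow> \<bar>\<langle>f, \<mu>\<rangle>\<bar> \<le> S \<mu>" by simp_all
  have S': "\<bar>\<langle>f, \<mu>\<rangle>\<bar> \<le> S \<mu>" if "f \<in> bipolar B" for f \<mu>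
    by (rule bipolarD[OF that less_imp_le[OF S(1)] S(2)])
  define Q where "Q = (\<Sum>\<mu>\<in>M. (2 * S \<mu>)\<^sup>2)"
  have Q: "Q \<ge> 0" by (simp add: Q_def sum_nonneg)
  have "\<exists>f\<in>bipolar B. J f < e\<^sup>2"
  proof (rule ccontr)
    assume "\<not> ?thesis"
    then have ge: "J f \<ge> e\<^sup>2" if "f \<in> bipolar B" for f using that by force
    \<comment> \<open>The function f below minimises \<open>J\<close> up to t^2. Comparing it with a
      point at parameter t on a segment in the bipolar and dividing by 2t leaves the error \<kappa>
      = t(1 + Q)/2. This choice of t makes \<kappa> at most e^2/2, against \<open>J f\<close> \<ge>
      e^2.\<close>
    define t where "t = min 1 (e\<^sup>2 / (1 + Q))"
    have Q1: "1 + Q > 0" using Q by simp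
    have t: "t > 0" "t \<le> 1" "t \<le> e\<^sup>2 / (1 + Q)" using e Q1 by (auto simp: t_def)
    then have tQ: "t * (1 + Q) \<le> e\<^sup>2" using Q1 by (simp add: pos_le_divide_eq)
    define m where "m = Inf (J ` bipolar B)"
    have bdd: "bdd_below (J ` bipolar B)" using J0 by (auto intro: bdd_belowI[of _ 0])
    have "m < m + t\<^sup>2" using t by simp
    then obtain f where f: "f \<in> bipolar B" "J f < m + t\<^sup>2"
      unfolding m_def using cInf_lessD[of "J ` bipolar B"] zero by blast
    have m: "m \<le> J g" if "g \<in> bipolar B" for g
      unfolding m_def using that by (intro cInf_lower bdd) auto
    define a where "a \<mu> = \<phi> \<mu> - \<langle>f, \<mu>\<rangle>" for \<mu>
    define \<nu> where "\<nu> = (\<Sum>\<mu>\<in>M. a \<mu> *\<^sub>R \<mu>)"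
    define \<kappa> where "\<kappa> = t * (1 + Q) / 2"
    have variational: "\<langle>g, \<nu>\<rangle> \<le> \<langle>f, \<nu>\<rangle> + \<kappa>" if g: "g \<in> bipolar B" for g
    proof -
      define b where "b \<mu> = \<langle>g, \<mu>\<rangle> - \<langle>f, \<mu>\<rangle>" for \<mu>
      have "(\<Sum>\<mu>\<in>M. (b \<mu>)\<^sup>2) \<le> Q"
        unfolding Q_def
      proof (rule sum_mono)
        fix \<mu> assume "\<mu> \<in> M"
        have "\<bar>b \<mu>\<bar> \<le> 2 * S \<mu>" using S'[OF f(1), of \<mu>] S'[OF g, of \<mu>] by (simp add: b_def)
        then show "(b \<mu>)\<^sup>2 \<le> (2 * S \<mu>)\<^sup>2"
          using S(1)[of \<mu>] by (subst abs_le_square_iff[symmetric]) auto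
      qed
      then have bQ: "t\<^sup>2 * (\<Sum>\<mu>\<in>M. (b \<mu>)\<^sup>2) \<le> t\<^sup>2 * Q" by (intro mult_left_mono) auto
      have "(1 - t) *\<^sub>R f + t *\<^sub>R g \<in> bipolar B"
        using convexD_alt[OF convex_bipolar f(1) g] t(1,2) by simp
      from m[OF this] have "J f - t\<^sup>2 < J ((1 - t) *\<^sub>R f + t *\<^sub>R g)" using f(2) by simp
      also have "J ((1 - t) *\<^sub>R f + t *\<^sub>R g) = (\<Sum>\<mu>\<in>M. (a \<mu> - t * b \<mu>)\<^sup>2)"
        unfolding J_def by (rule sum.cong) (auto simp: a_def b_def algebra_simps)
      also have "\<dots> = (\<Sum>\<mu>\<in>M. (a \<mu>)\<^sup>2 - (2 * t) * (a \<mu> * b \<mu>) + t\<^sup>2 * (b \<mu>)\<^sup>2)"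
        by (rule sum.cong) (auto simp: power2_eq_square algebra_simps)
      also have "\<dots> = J f - 2 * t * (\<Sum>\<mu>\<in>M. a \<mu> * b \<mu>) + t\<^sup>2 * (\<Sum>\<mu>\<in>M. (b \<mu>)\<^sup>2)"
        by (simp add: sum.distrib sum_subtractf sum_distrib_left J_def a_def)
      finally have "2 * t * (\<Sum>\<mu>\<in>M. a \<mu> * b \<mu>) < t\<^sup>2 + t\<^sup>2 * Q" using bQ by simp
      also have "\<dots> = 2 * t * \<kappa>" by (simp add: \<kappa>_def power2_eq_square algebra_simps)
      finally have "(\<Sum>\<mu>\<in>M. a \<mu> * b \<mu>) < \<kappa>" using t(1) by simp
      moreover have "(\<Sum>\<mu>\<in>M. a \<mu> * b \<mu>) = \<langle>g, \<nu>\<rangle> - \<langle>f, \<nu>\<rangle>"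
        by (simp add: \<nu>_def pairing_sum b_def algebra_simps sum_subtractf)
      ultimately show ?thesis by simp
    qed
    \<comment> \<open>The variational inequality at 0 makes this radius nonnegative; at g and - g it
      bounds the pairing with \<nu> on \<open>B\<close>.\<close>
    have "\<bar>\<phi> \<nu>\<bar> \<le> \<langle>f, \<nu>\<rangle> + \<kappa>"
    proof (rule bound)
      show "0 \<le> \<langle>f, \<nu>\<rangle> + \<kappa>" using variational[OF zero] by simp
      have "g \<in> bipolar B" "- g \<in> bipolar B" if "g \<in> B" for g using that by (auto simp: bipolar_def)
      from variational[OF this(1)] variational[OF this(2)]
      show "\<forall>g\<in>B. \<bar>\<langle>g, \<nu>\<rangle>\<bar> \<le> \<langle>f, \<nu>\<rangle> + \<kappa>" by (auto simp: abs_le_iff)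
    qed
    moreover have "\<phi> \<nu> - \<langle>f, \<nu>\<rangle> = J f"
    proof -
      have "\<phi> \<nu> = (\<Sum>\<mu>\<in>M. a \<mu> * \<phi> \<mu>)"
        by (simp add: \<nu>_def linear_sum[OF lin] linear_cmul[OF lin])
      moreover have "\<langle>f, \<nu>\<rangle> = (\<Sum>\<mu>\<in>M. a \<mu> * \<langle>f, \<mu>\<rangle>)" by (simp add: \<nu>_def pairing_sum)
      ultimately show ?thesis
        by (simp add: J_def a_def power2_eq_square right_diff_distrib sum_subtractf)
    qed
    ultimately have "J f \<le> \<kappa>" by simp
    then have "e\<^sup>2 \<le> t * (1 + Q) / 2" using ge[OF f(1)] by (simp add: \<kappa>_def)
    moreover have "e\<^sup>2 > 0" using e by simp
    ultimately show False using tQ by linarith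
  qed
  then obtain f where f: "f \<in> bipolar B" "J f < e\<^sup>2" by blast
  have "\<bar>\<langle>f, \<mu>\<rangle> - \<phi> \<mu>\<bar> < e" if "\<mu> \<in> M" for \<mu>
  proof -
    have "(\<phi> \<mu> - \<langle>f, \<mu>\<rangle>)\<^sup>2 \<le> J f"
      unfolding J_def using M that by (intro member_le_sum) auto
    then have "\<bar>\<phi> \<mu> - \<langle>f, \<mu>\<rangle>\<bar>\<^sup>2 < e\<^sup>2" using f(2) by simp
    then show ?thesis using power2_less_imp_less[of "\<bar>\<phi> \<mu> - \<langle>f, \<mu>\<rangle>\<bar>" e] e by (simp add: abs_minus_commute)
  qed
  then show thesis using that f(1) by blast
qed

section \<open>Mean value estimates uniform over bounded sets\<close>

lemma dderivs_direction_bound: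
  fixes f :: "'a::euclidean_space smooth"
  assumes "\<And>b. b \<in> Basis \<Longrightarrow> \<bar>dderivs (b # vs) (smooth_apply f) x\<bar> \<le> M"
  shows "\<bar>dderivs (h # vs) (smooth_apply f) x\<bar> \<le> norm h * (real DIM('a) * M)"
proof -
  have lin: "linear (\<lambda>v. dderivs (v # vs) (smooth_apply f) x)"
    by (rule linear_dderivs_dir) simp
  have "dderivs (h # vs) (smooth_apply f) x =
      dderivs ((\<Sum>b\<in>Basis. (h \<bullet> b) *\<^sub>R b) # vs) (smooth_apply f) x"
    by (simp add: euclidean_representation)
  also have "\<dots> = (\<Sum>b\<in>Basis. (h \<bullet> b) * dderivs (b # vs) (smooth_apply f) x)"
    by (simp only: linear_sum[OF lin] linear_cmul[OF lin] real_scaleR_def)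
  also have "\<bar>\<dots>\<bar> \<le> (\<Sum>b\<in>(Basis :: 'a set). norm h * M)"
  proof (rule order_trans[OF sum_abs], rule sum_mono)
    fix b :: 'a assume b: "b \<in> Basis"
    show "\<bar>(h \<bullet> b) * dderivs (b # vs) (smooth_apply f) x\<bar> \<le> norm h * M"
      unfolding abs_mult by (intro mult_mono assms Basis_le_norm b) auto
  qed
  finally show ?thesis by (simp add: mult.left_commute del: dderivs.simps(2))
qed

lemma dderivs_mvt:
  fixes f :: "'a::euclidean_space smooth"
  obtains \<theta> where "0 < \<theta>" "\<theta> < 1"
    "dderivs vs (smooth_apply f) (x + h) - dderivs vs (smooth_apply f) x =
      dderivs (h # vs) (smooth_apply f) (x + \<theta> *\<^sub>R h)"
proof -
  have "((\<lambda>s. dderivs vs (smooth_apply f) (x + s *\<^sub>R h)) has_real_derivative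
      dderivs (h # vs) (smooth_apply f) (x + s *\<^sub>R h)) (at s)" for s
    by (rule dderivs_line) simp
  from MVT2[OF zero_less_one this] show thesis
    using that by auto
qed

lemma dderivs_lipschitz:
  fixes f :: "'a::euclidean_space smooth"
  assumes "\<And>b z. b \<in> Basis \<Longrightarrow> z \<in> cball 0 R \<Longrightarrow> \<bar>dderivs (b # vs) (smooth_apply f) z\<bar> \<le> M"
    and "x \<in> cball 0 R" "y \<in> cball 0 R"
  shows "\<bar>dderivs vs (smooth_apply f) y - dderivs vs (smooth_apply f) x\<bar> \<le> norm (y - x) * (real DIM('a) * M)"
proof -
  obtain \<theta> where \<theta>: "0 < \<theta>" "\<theta> < 1"
    "dderivs vs (smooth_apply f) (x + (y - x)) - dderivs vs (smooth_apply f) x =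
      dderivs ((y - x) # vs) (smooth_apply f) (x + \<theta> *\<^sub>R (y - x))"
    using dderivs_mvt[of vs f x "y - x"] by blast
  have "x + \<theta> *\<^sub>R (y - x) = (1 - \<theta>) *\<^sub>R x + \<theta> *\<^sub>R y" by (simp add: algebra_simps)
  then have "x + \<theta> *\<^sub>R (y - x) \<in> cball 0 R"
    using convexD_alt[OF convex_cball assms(2,3), of \<theta>] \<theta> by auto
  then have "\<bar>dderivs ((y - x) # vs) (smooth_apply f) (x + \<theta> *\<^sub>R (y - x))\<bar> \<le> norm (y - x) * (real DIM('a) * M)"
    using assms(1) by (intro dderivs_direction_bound) auto
  then show ?thesis using \<theta>(3) by simp
qed

text \<open>Two applications of the mean value theorem replace a Taylor formula. The constant
  depends on f only through M, so the estimate is uniform over a bounded set of functions, as the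
  strong topology requires.\<close>

lemma dderivs_second_order:
  fixes f :: "'a::euclidean_space smooth"
  assumes M: "\<And>a b z. a \<in> Basis \<Longrightarrow> b \<in> Basis \<Longrightarrow> z \<in> cball x r \<Longrightarrow>
      \<bar>dderivs (a # b # vs) (smooth_apply f) z\<bar> \<le> M"
    and h: "norm h \<le> r"
  shows "\<bar>dderivs vs (smooth_apply f) (x + h) - dderivs vs (smooth_apply f) x -
      dderivs (h # vs) (smooth_apply f) x\<bar> \<le> norm h * (norm h * (real DIM('a) * (real DIM('a) * M)))"
proof -
  let ?D = "\<lambda>vs. dderivs vs (smooth_apply f)"
  obtain \<theta> where \<theta>: "0 < \<theta>" "\<theta> < 1" "?D vs (x + h) - ?D vs x = ?D (h # vs) (x + \<theta> *\<^sub>R h)"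
    using dderivs_mvt[of vs f x h] by blast
  obtain \<theta>' where \<theta>': "0 < \<theta>'" "\<theta>' < 1"
    "?D (h # vs) (x + \<theta> *\<^sub>R h) - ?D (h # vs) x = ?D ((\<theta> *\<^sub>R h) # h # vs) (x + \<theta>' *\<^sub>R \<theta> *\<^sub>R h)"
    using dderivs_mvt[of "h # vs" f x "\<theta> *\<^sub>R h"] by blast
  define z where "z = x + \<theta>' *\<^sub>R \<theta> *\<^sub>R h"
  have "norm (\<theta>' *\<^sub>R \<theta> *\<^sub>R h) \<le> 1 * (1 * norm h)"
    using \<theta> \<theta>' by (simp add: mult_le_one mult_left_le_one_le mult.assoc[symmetric] del: mult_1)
  then have z: "z \<in> cball x r" using h by (simp add: z_def dist_norm)
  \<comment> \<open>The basis expansion acts on the first direction only, so symmetry of second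
    derivatives is used to bring h to the front.\<close>
  have basis: "\<bar>?D (a # h # vs) z\<bar> \<le> norm h * (real DIM('a) * M)" if a: "a \<in> Basis" for a
  proof -
    have swap: "?D (a # k # vs) z = ?D (k # a # vs) z" for k
      using dderivs_swap[OF smooth_function_dderivs[of "smooth_apply f" vs], of a k z] by simp
    show ?thesis unfolding swap
      by (rule dderivs_direction_bound) (use M a z in \<open>simp add: swap[symmetric]\<close>)
  qed
  have "\<bar>?D ((\<theta> *\<^sub>R h) # h # vs) z\<bar> \<le> norm (\<theta> *\<^sub>R h) * (real DIM('a) * (norm h * (real DIM('a) * M)))"
    by (rule dderivs_direction_bound) (rule basis)
  also have "\<dots> \<le> norm h * (real DIM('a) * (norm h * (real DIM('a) * M)))"
  proof (rule mult_right_mono)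
    show "norm (\<theta> *\<^sub>R h) \<le> norm h" using \<theta> by (simp add: mult_left_le_one_le)
    obtain b :: 'a where b: "b \<in> Basis" using nonempty_Basis by blast
    have "0 \<le> M" using M[OF b b z] by linarith
    then show "0 \<le> DIM('a) * (norm h * (real DIM('a) * M))" by simp
  qed
  finally show ?thesis using \<theta>(3) \<theta>'(3) by (simp add: z_def mult.left_commute del: dderivs.simps(2))
qed

text \<open>In other words, \<open>x \<mapsto> \<partial>\<^sup>\<alpha>\<delta>\<^sub>x\<close> is differentiable for the strong topology.\<close>

lemma has_derivative_functional_derivative_at:
  fixes \<phi> :: "'a::euclidean_space distr \<Rightarrow> real"
  assumes lin: "linear \<phi>" and B: "tvs_bounded B"
    and bound: "\<And>\<mu> s. s \<ge> 0 \<Longrightarrow> \<forall>f\<in>B. \<bar>\<langle>f, \<mu>\<rangle>\<bar> \<le> s \<Longrightarrow> \<bar>\<phi> \<mu>\<bar> \<le> s"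
  shows "((\<lambda>x. \<phi> (derivative_at vs x)) has_derivative (\<lambda>h. \<phi> (derivative_at (h # vs) x))) (at x)"
  unfolding has_derivative_at_alt
proof (intro conjI allI impI)
  have "linear (\<lambda>h. derivative_at (h # vs) x)"
    by (rule linearI_lincomb, rule dual_eqI)
      (simp add: pairing_derivative_at linear_add[OF linear_dderivs_dir] linear_cmul[OF linear_dderivs_dir]
        del: dderivs.simps(2))
  from linear_compose[OF this lin]
  show "bounded_linear (\<lambda>h. \<phi> (derivative_at (h # vs) x))"
    by (simp add: linear_conv_bounded_linear o_def)
next
  fix e :: real assume e: "e > 0"
  have "\<forall>vs. \<exists>M. \<forall>f\<in>B. \<forall>z\<in>cball x 1. \<bar>dderivs vs (smooth_apply f) z\<bar> \<le> M"
    using B compact_cball unfolding tvs_bounded_smooth_iff by blast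
  then obtain M where M: "\<And>vs f z. f \<in> B \<Longrightarrow> z \<in> cball x 1 \<Longrightarrow> \<bar>dderivs vs (smooth_apply f) z\<bar> \<le> M vs"
    unfolding choice_iff by blast
  define N where "N = 1 + (\<Sum>p\<in>Basis \<times> Basis. \<bar>M (fst p # snd p # vs)\<bar>)"
  have N: "N > 0" by (simp add: N_def add_pos_nonneg sum_nonneg)
  have MN: "M (a # b # vs) \<le> N" if "a \<in> Basis" "b \<in> Basis" for a b
    using member_le_sum[of "(a, b)" "Basis \<times> Basis" "\<lambda>p. \<bar>M (fst p # snd p # vs)\<bar>"] that
    by (simp add: N_def)
  define L where "L = DIM('a) * (real DIM('a) * N)"
  have L: "L > 0" using N by (simp add: L_def)
  define d where "d = min 1 (e / L)"
  have d: "d > 0" "d \<le> 1" "d * L \<le> e" using e L by (auto simp: d_def min_def field_simps)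
  show "\<exists>d>0. \<forall>y. norm (y - x) < d \<longrightarrow>
      norm (\<phi> (derivative_at vs y) - \<phi> (derivative_at vs x) - \<phi> (derivative_at ((y - x) # vs) x))
        \<le> e * norm (y - x)"
  proof (intro exI[of _ d] conjI allI impI d(1))
    fix y assume y: "norm (y - x) < d"
    define h where "h = y - x"
    have "\<bar>\<phi> (derivative_at vs y - derivative_at vs x - derivative_at (h # vs) x)\<bar> \<le> norm h * (norm h * L)"
    proof (rule bound, simp add: L less_imp_le, intro ballI)
      fix f assume f: "f \<in> B"
      have "\<bar>dderivs vs (smooth_apply f) (x + h) - dderivs vs (smooth_apply f) x -
          dderivs (h # vs) (smooth_apply f) x\<bar> \<le> norm h * (norm h * L)"
        unfolding L_def
      proof (rule dderivs_second_order)
        show "norm h \<le> 1" using y d(2) by (simp add: h_def)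
        show "\<bar>dderivs (a # b # vs) (smooth_apply f) z\<bar> \<le> N" if "a \<in> Basis" "b \<in> Basis" "z \<in> cball x 1" for a b z
          using M[OF f that(3), of "a # b # vs"] MN[OF that(1,2)] by linarith
      qed
      then show "\<bar>\<langle>f, derivative_at vs y - derivative_at vs x - derivative_at (h # vs) x\<rangle>\<bar> \<le> norm h * (norm h * L)"
        by (simp add: pairing_derivative_at h_def del: dderivs.simps(2))
    qed
    also have "\<dots> \<le> norm h * e"
    proof (rule mult_left_mono)
      have "norm h * L \<le> d * L" using y L by (intro mult_right_mono) (simp_all add: h_def)
      then show "norm h * L \<le> e" using d(3) by linarith
    qed simp
    finally show "norm (\<phi> (derivative_at vs y) - \<phi> (derivative_at vs x) - \<phi> (derivative_at ((y - x) # vs) x))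
        \<le> e * norm (y - x)"
      by (simp add: linear_diff[OF lin] h_def mult.commute)
  qed
qed

text \<open>The representing function can only send x to the value of \<phi> at the Dirac measure at
  x. A distribution \<mu> tests finitely many derivatives on a compact set, so \<phi> is compared
  with f through an element g of the bipolar that nearly agrees with \<phi> at \<mu> and at the
  derivative functionals of a finite net. Equicontinuity carries the agreement from the net to the
  whole compact set.\<close>

theorem smooth_reflexive:
  fixes \<phi> :: "'a::euclidean_space distr \<Rightarrow> real"
  assumes lin: "linear \<phi>" and cont: "continuous_on UNIV \<phi>"
  obtains f where "\<And>\<mu>. \<phi> \<mu> = \<langle>f, \<mu>\<rangle>"
proof -
  obtain B where B: "tvs_bounded B" and
    bound: "\<And>\<mu> s. s \<ge> 0 \<Longrightarrow> \<forall>f\<in>B. \<bar>\<langle>f, \<mu>\<rangle>\<bar> \<le> s \<Longrightarrow> \<bar>\<phi> \<mu>\<bar> \<le> s"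
    using continuous_functional_dual_bound[OF assms] by blast
  note deriv = has_derivative_functional_derivative_at[OF lin B bound]
  define F where "F vs x = \<phi> (derivative_at vs x)" for vs x
  have dF: "dderivs vs (F []) = F vs" for vs
  proof (induction vs)
    case (Cons v vs)
    show ?case
      by (rule ext, rule dderivs_Cons_eq, unfold Cons.IH, unfold F_def, rule deriv)
  qed simp
  have "smooth_function (F [])"
    by (rule smooth_function_dderivsI[OF dF])
      (use deriv in \<open>auto simp: F_def[abs_def] differentiable_def\<close>)
  then obtain f where f: "smooth_apply f = F []"
    using Smooth_inverse by blast
  have df: "dderivs vs (smooth_apply f) x = \<phi> (derivative_at vs x)" for vs x
    by (simp add: f dF F_def)
  have "\<phi> \<mu> = \<langle>f, \<mu>\<rangle>" for \<mu>
  proof -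
    obtain K V C where K: "compact K" "finite V" "C \<ge> 0"
      "\<And>f e. e \<ge> 0 \<Longrightarrow> \<forall>vs\<in>V. \<forall>x\<in>K. \<bar>dderivs vs (smooth_apply f) x\<bar> \<le> e \<Longrightarrow> \<bar>\<langle>f, \<mu>\<rangle>\<bar> \<le> C * e"
      using dual_smooth_bound[of \<mu>] by blast
    \<comment> \<open>The mean value theorem needs a convex set, so K is enclosed in a ball.\<close>
    obtain R where R: "\<And>x. x \<in> K \<Longrightarrow> norm x \<le> R"
      using compact_imp_bounded[OF K(1)] bounded_iff by metis
    have "\<forall>vs. \<exists>M. \<forall>f\<in>B. \<forall>z\<in>cball 0 R. \<bar>dderivs vs (smooth_apply f) z\<bar> \<le> M"
      using B compact_cball unfolding tvs_bounded_smooth_iff by blast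
    then obtain M where M: "\<And>vs f z. f \<in> B \<Longrightarrow> z \<in> cball 0 R \<Longrightarrow> \<bar>dderivs vs (smooth_apply f) z\<bar> \<le> M vs"
      unfolding choice_iff by blast
    define N where "N = (\<Sum>p\<in>Basis \<times> V. \<bar>M (fst p # snd p)\<bar>)"
    have N: "N \<ge> 0" by (simp add: N_def sum_nonneg)
    have BN: "\<bar>dderivs (b # vs) (smooth_apply g) z\<bar> \<le> N"
      if "g \<in> B" "b \<in> Basis" "vs \<in> V" "z \<in> cball 0 R" for g b vs z
      using member_le_sum[of "(b, vs)" "Basis \<times> V" "\<lambda>p. \<bar>M (fst p # snd p)\<bar>"] that K(2)
        M[OF that(1,4), of "b # vs"]
      by (simp add: N_def del: dderivs.simps(2))
    have "\<bar>\<phi> \<mu> - \<langle>f, \<mu>\<rangle>\<bar> \<le> 0 + e" if e: "e > 0" for e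
    proof -
      \<comment> \<open>The approximation at \<mu> costs \<eta>. The bound of \<mu> costs C times
        the sum of the error \<eta> on the net and the Lipschitz error from a net point to x.
        Together this is \<eta> * A, and the Lipschitz constant was fixed before \<eta>.\<close>
      define A where "A = 1 + C * (1 + real DIM('a) * (2 * N))"
      have A: "A > 0" using N K(3) by (simp add: A_def add_pos_nonneg)
      define \<eta> where "\<eta> = e / A"
      have \<eta>: "\<eta> > 0" "\<eta> * A = e" using e A by (auto simp: \<eta>_def)
      obtain T where T: "finite T" "T \<subseteq> K" "K \<subseteq> (\<Union>x\<in>T. ball x \<eta>)"
        using K(1) \<eta>(1) compactE_image[of K K "\<lambda>x. ball x \<eta>"] by force
      obtain g where g: "g \<in> bipolar B" "\<And>\<nu>. \<nu> \<in> insert \<mu> ((\<lambda>(vs, x). derivative_at vs x) ` (V \<times> T)) \<Longrightarrow>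
          \<bar>\<langle>g, \<nu>\<rangle> - \<phi> \<nu>\<bar> < \<eta>"
        using bipolar_approximation[OF lin B bound _ \<eta>(1),
            of "insert \<mu> ((\<lambda>(vs, x). derivative_at vs x) ` (V \<times> T))"] T(1) K(2) by auto
      have "\<bar>dderivs vs (smooth_apply (g - f)) x\<bar> \<le> \<eta> + \<eta> * (real DIM('a) * (2 * N))" if vs: "vs \<in> V" and x: "x \<in> K" for vs x
      proof -
        obtain y where y: "y \<in> T" "dist y x < \<eta>" using T(3) x by auto
        have "\<bar>\<langle>g, derivative_at vs y\<rangle> - \<phi> (derivative_at vs y)\<bar> < \<eta>"
          using vs y(1) by (intro g(2)) auto
        then have near: "\<bar>dderivs vs (smooth_apply (g - f)) y\<bar> < \<eta>"
          by (simp add: df pairing_derivative_at)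
        have "\<bar>dderivs vs (smooth_apply (g - f)) x - dderivs vs (smooth_apply (g - f)) y\<bar>
            \<le> norm (x - y) * (real DIM('a) * (2 * N))"
        proof (rule dderivs_lipschitz)
          show "y \<in> cball 0 R" "x \<in> cball 0 R" using R T(2) y(1) x by auto
          fix b z :: 'a assume bz: "b \<in> Basis" "z \<in> cball 0 R"
          \<comment> \<open>Both g and \<phi> inherit from \<open>B\<close> the bound N on
            derivatives one order above those in V: g as an element of the bipolar, \<phi> by
            \<open>bound\<close>.\<close>
          have "\<bar>\<langle>g, derivative_at (b # vs) z\<rangle>\<bar> \<le> N"
            using BN vs bz by (intro bipolarD[OF g(1) N]) (simp add: pairing_derivative_at del: dderivs.simps(2))
          moreover have "\<bar>\<phi> (derivative_at (b # vs) z)\<bar> \<le> N"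
            using BN vs bz by (intro bound[OF N]) (simp add: pairing_derivative_at del: dderivs.simps(2))
          ultimately show "\<bar>dderivs (b # vs) (smooth_apply (g - f)) z\<bar> \<le> 2 * N"
            by (simp add: df pairing_derivative_at del: dderivs.simps(2))
        qed
        also have "\<dots> \<le> \<eta> * (real DIM('a) * (2 * N))"
          using y(2) N by (intro mult_right_mono) (auto simp: dist_norm norm_minus_commute)
        finally show ?thesis using near by linarith
      qed
      then have "\<bar>\<langle>g - f, \<mu>\<rangle>\<bar> \<le> C * (\<eta> + \<eta> * (real DIM('a) * (2 * N)))"
        using \<eta>(1) N by (intro K(4)) auto
      moreover have "\<bar>\<langle>g, \<mu>\<rangle> - \<phi> \<mu>\<bar> < \<eta>" by (rule g(2)) simp
      moreover have "\<eta> + C * (\<eta> + \<eta> * (real DIM('a) * (2 * N))) = \<eta> * A"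
        by (simp add: A_def algebra_simps)
      ultimately show ?thesis unfolding \<eta>(2) pairing_left_simps by linarith
    qed
    then have "\<bar>\<phi> \<mu> - \<langle>f, \<mu>\<rangle>\<bar> \<le> 0" by (rule field_le_epsilon)
    then show ?thesis by simp
  qed
  then show thesis by (rule that)
qed

section \<open>Continuity of the tensor product\<close>

lemma bounded_pairing:
  fixes \<mu> :: "'a::topological_real_vector dual"
  assumes "tvs_bounded B"
  obtains S where "S > 0" "\<And>f. f \<in> B \<Longrightarrow> \<bar>\<langle>f, \<mu>\<rangle>\<bar> \<le> S"
  using tvs_bounded_functional[OF assms linear_dual_apply[of \<mu>] continuous_dual_apply] that by blast

text \<open>Continuity at the origin of a bilinear map between strong duals, spelled out with polars.\<close>

definition polar_bounded_bilinear ::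
  "('a::topological_real_vector dual \<Rightarrow> 'b::topological_real_vector dual \<Rightarrow> 'c::topological_real_vector dual) \<Rightarrow> bool" where
  "polar_bounded_bilinear Q \<longleftrightarrow>
     (\<forall>c \<gamma> \<gamma>' \<mu>. Q (c *\<^sub>R \<gamma> + \<gamma>') \<mu> = c *\<^sub>R Q \<gamma> \<mu> + Q \<gamma>' \<mu>) \<and>
     (\<forall>c \<gamma> \<mu> \<mu>'. Q \<gamma> (c *\<^sub>R \<mu> + \<mu>') = c *\<^sub>R Q \<gamma> \<mu> + Q \<gamma> \<mu>') \<and>
     (\<forall>B. tvs_bounded B \<longrightarrow> (\<exists>B1 B2. tvs_bounded B1 \<and> tvs_bounded B2 \<and>
        (\<forall>\<gamma> \<mu>. (\<forall>f\<in>B1. \<bar>\<langle>f, \<gamma>\<rangle>\<bar> \<le> 1) \<longrightarrow> (\<forall>g\<in>B2. \<bar>\<langle>g, \<mu>\<rangle>\<bar> \<le> 1) \<longrightarrow> (\<forall>h\<in>B. \<bar>\<langle>h, Q \<gamma> \<mu>\<rangle>\<bar> \<le> 1))))"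

context
  fixes Q :: "'a::topological_real_vector dual \<Rightarrow> 'b::topological_real_vector dual \<Rightarrow> 'c::topological_real_vector dual"
  assumes Q: "polar_bounded_bilinear Q"
begin

lemma linear_bilinear_left: "linear (\<lambda>\<gamma>. Q \<gamma> \<mu>)"
  and linear_bilinear_right: "linear (Q \<gamma>)"
  using Q unfolding polar_bounded_bilinear_def by (auto intro!: linearI_lincomb)

lemmas bilinear_simps =
  linear_add[OF linear_bilinear_left] linear_diff[OF linear_bilinear_left] linear_cmul[OF linear_bilinear_left]
  linear_add[OF linear_bilinear_right] linear_diff[OF linear_bilinear_right] linear_cmul[OF linear_bilinear_right]

lemma polar_bounded_bilinear_bound:
  assumes "tvs_bounded B"
  obtains B1 B2 where "tvs_bounded B1" "tvs_bounded B2"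
    "\<And>\<gamma> \<mu> s t h. s > 0 \<Longrightarrow> t > 0 \<Longrightarrow> \<forall>f\<in>B1. \<bar>\<langle>f, \<gamma>\<rangle>\<bar> \<le> s \<Longrightarrow> \<forall>g\<in>B2. \<bar>\<langle>g, \<mu>\<rangle>\<bar> \<le> t \<Longrightarrow> h \<in> B \<Longrightarrow>
       \<bar>\<langle>h, Q \<gamma> \<mu>\<rangle>\<bar> \<le> s * t"
proof -
  obtain B1 B2 where B: "tvs_bounded B1" "tvs_bounded B2"
    "\<And>\<gamma> \<mu> h. \<forall>f\<in>B1. \<bar>\<langle>f, \<gamma>\<rangle>\<bar> \<le> 1 \<Longrightarrow> \<forall>g\<in>B2. \<bar>\<langle>g, \<mu>\<rangle>\<bar> \<le> 1 \<Longrightarrow> h \<in> B \<Longrightarrow> \<bar>\<langle>h, Q \<gamma> \<mu>\<rangle>\<bar> \<le> 1"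
    using Q assms unfolding polar_bounded_bilinear_def by meson
  show thesis
  proof (rule that[OF B(1,2)])
    fix \<gamma> \<mu> h and s t :: real
    assume s: "s > 0" "t > 0" "\<forall>f\<in>B1. \<bar>\<langle>f, \<gamma>\<rangle>\<bar> \<le> s" "\<forall>g\<in>B2. \<bar>\<langle>g, \<mu>\<rangle>\<bar> \<le> t" "h \<in> B"
    have "\<bar>\<langle>h, Q (inverse s *\<^sub>R \<gamma>) (inverse t *\<^sub>R \<mu>)\<rangle>\<bar> \<le> 1"
      using s by (intro B(3)) (auto simp: abs_mult field_simps)
    then show "\<bar>\<langle>h, Q \<gamma> \<mu>\<rangle>\<bar> \<le> s * t"
      using s(1,2) by (simp add: bilinear_simps abs_mult field_simps)
  qed
qed

lemma tendsto_bilinear: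
  assumes "(f \<longlongrightarrow> \<gamma>) F" "(g \<longlongrightarrow> \<mu>) F"
  shows "((\<lambda>x. Q (f x) (g x)) \<longlongrightarrow> Q \<gamma> \<mu>) F"
  unfolding tendsto_dual_iff
proof (intro allI impI)
  fix B :: "'c set" and e :: real assume B: "tvs_bounded B \<and> e > 0"
  obtain B1 B2 where B12: "tvs_bounded B1" "tvs_bounded B2"
    "\<And>\<gamma> \<mu> s t h. s > 0 \<Longrightarrow> t > 0 \<Longrightarrow> \<forall>f\<in>B1. \<bar>\<langle>f, \<gamma>\<rangle>\<bar> \<le> s \<Longrightarrow> \<forall>g\<in>B2. \<bar>\<langle>g, \<mu>\<rangle>\<bar> \<le> t \<Longrightarrow> h \<in> B \<Longrightarrow>
       \<bar>\<langle>h, Q \<gamma> \<mu>\<rangle>\<bar> \<le> s * t"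
    using polar_bounded_bilinear_bound[of B] B by blast
  obtain S where S: "S > 0" "\<And>f. f \<in> B1 \<Longrightarrow> \<bar>\<langle>f, \<gamma>\<rangle>\<bar> \<le> S" using bounded_pairing[OF B12(1)] by blast
  obtain T where T: "T > 0" "\<And>f. f \<in> B2 \<Longrightarrow> \<bar>\<langle>f, \<mu>\<rangle>\<bar> \<le> T" using bounded_pairing[OF B12(2)] by blast
  \<comment> \<open>As d \<le> 1, the three error terms add up to at most d * (1 + S + T); the
    further unit in A makes the estimate strict.\<close>
  define A where "A = 2 + S + T"
  have A: "A > 0" using S(1) T(1) by (simp add: A_def)
  define d where "d = min 1 (e / A)"
  have d: "d > 0" "d \<le> 1" "d * A \<le> e" using B A by (auto simp: d_def min_def field_simps)
  have "\<forall>\<^sub>F x in F. \<forall>h\<in>B1. \<bar>\<langle>h, f x\<rangle> - \<langle>h, \<gamma>\<rangle>\<bar> < d" "\<forall>\<^sub>F x in F. \<forall>h\<in>B2. \<bar>\<langle>h, g x\<rangle> - \<langle>h, \<mu>\<rangle>\<bar> < d"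
    using assms B12(1,2) d(1) unfolding tendsto_dual_iff by blast+
  then show "\<forall>\<^sub>F x in F. \<forall>h\<in>B. \<bar>\<langle>h, Q (f x) (g x)\<rangle> - \<langle>h, Q \<gamma> \<mu>\<rangle>\<bar> < e"
  proof eventually_elim
    case (elim x)
    show ?case
    proof
      fix h assume h: "h \<in> B"
      define \<alpha> \<beta> where "\<alpha> = f x - \<gamma>" and "\<beta> = g x - \<mu>"
      have \<alpha>: "\<forall>h\<in>B1. \<bar>\<langle>h, \<alpha>\<rangle>\<bar> \<le> d" and \<beta>: "\<forall>h\<in>B2. \<bar>\<langle>h, \<beta>\<rangle>\<bar> \<le> d"
        using elim by (auto simp: \<alpha>_def \<beta>_def intro: less_imp_le)
      have "Q (f x) (g x) - Q \<gamma> \<mu> = Q \<alpha> \<beta> + Q \<alpha> \<mu> + Q \<gamma> \<beta>"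
        by (simp add: \<alpha>_def \<beta>_def bilinear_simps)
      then have "\<bar>\<langle>h, Q (f x) (g x)\<rangle> - \<langle>h, Q \<gamma> \<mu>\<rangle>\<bar> = \<bar>\<langle>h, Q \<alpha> \<beta>\<rangle> + \<langle>h, Q \<alpha> \<mu>\<rangle> + \<langle>h, Q \<gamma> \<beta>\<rangle>\<bar>"
        by (metis pairing_simps(1,2))
      also have "\<dots> \<le> \<bar>\<langle>h, Q \<alpha> \<beta>\<rangle>\<bar> + \<bar>\<langle>h, Q \<alpha> \<mu>\<rangle>\<bar> + \<bar>\<langle>h, Q \<gamma> \<beta>\<rangle>\<bar>" by linarith
      also have "\<dots> \<le> d * d + d * T + S * d"
        using S(1) T(1) d(1) h by (intro add_mono B12(3) ballI bspec[OF \<alpha>] bspec[OF \<beta>] S(2) T(2))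
      also have "\<dots> \<le> d * 1 + d * T + S * d" using d S(1) by (intro add_mono mult_left_mono) auto
      also have "\<dots> < d * A" using d(1) by (simp add: A_def algebra_simps)
      also note d(3)
      finally show "\<bar>\<langle>h, Q (f x) (g x)\<rangle> - \<langle>h, Q \<gamma> \<mu>\<rangle>\<bar> < e" .
    qed
  qed
qed

end

lemma partial_pairing_lincomb_right:
  "partial_pairing \<Phi> (c *\<^sub>R \<mu> + \<nu>) = c *\<^sub>R partial_pairing \<Phi> \<mu> + partial_pairing \<Phi> \<nu>"
  by (rule smooth_eqI)
    (simp add: smooth_apply_partial_pairing plus_smooth.rep_eq scaleR_smooth.rep_eq)

text \<open>The polar of the bounded set \<open>B2\<close> of rescaled slices is mapped by \<open>partial_pairing k\<close> into a
  bounded set, uniformly in \<open>k \<in> B\<close>.\<close>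

lemma polar_bounded_bilinear_tensor:
  "polar_bounded_bilinear
     (tensor :: 'a::euclidean_space distr \<Rightarrow> 'b::euclidean_space distr \<Rightarrow> ('a \<times> 'b) distr)"
  unfolding polar_bounded_bilinear_def
proof (intro conjI allI impI)
  fix c \<gamma> \<gamma>' and \<mu> \<mu>' :: "'b distr"
  show "tensor (c *\<^sub>R \<gamma> + \<gamma>' :: 'a distr) \<mu> = c *\<^sub>R tensor \<gamma> \<mu> + tensor \<gamma>' \<mu>"
    "tensor \<gamma> (c *\<^sub>R \<mu> + \<mu>') = c *\<^sub>R tensor \<gamma> \<mu> + tensor \<gamma> \<mu>'" for \<gamma> :: "'a distr"
    by (rule dual_eqI, simp add: pairing_tensor partial_pairing_lincomb_right)+
next
  fix B :: "('a \<times> 'b) smooth set" assume B: "tvs_bounded B"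
  let ?s = "\<lambda>vs k x. slice (foldr smooth_deriv (map (\<lambda>v. (v, 0)) vs) k) x"
  \<comment> \<open>Pairing such a slice with \<mu> gives the derivative along \<open>vs\<close> at
    x of \<open>partial_pairing k \<mu>\<close>. Over all orders and all x the slices may be
    unbounded, but each stage n involves only orders up to n and a compact ball.\<close>
  define S where "S n = {?s vs k x | vs k x. set vs \<subseteq> Basis \<and> length vs \<le> n \<and> k \<in> B \<and> x \<in> cball 0 (real n)}"
    for n
  have S_bounded: "tvs_bounded (S n)" for n
    unfolding tvs_bounded_smooth_iff
  proof (intro allI impI)
    fix us :: "'b list" and K :: "'b set" assume K: "compact K"
    define L where "L = {vs :: 'a list. set vs \<subseteq> Basis \<and> length vs \<le> n}"
    have L: "finite L" unfolding L_def by (intro finite_lists_length_le) auto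
    have "compact (cball (0::'a) (real n) \<times> K)" using K by (intro compact_Times) auto
    then have "\<forall>vs. \<exists>M. \<forall>k\<in>B. \<forall>z\<in>cball (0::'a) (real n) \<times> K. \<bar>dderivs vs (smooth_apply k) z\<bar> \<le> M"
      using B unfolding tvs_bounded_smooth_iff by blast
    from choice[OF this] obtain M where
      M: "\<forall>vs. \<forall>k\<in>B. \<forall>z\<in>cball (0::'a) (real n) \<times> K. \<bar>dderivs vs (smooth_apply k) z\<bar> \<le> M vs" ..
    let ?m = "\<lambda>vs. map (Pair 0) us @ map (\<lambda>v. (v, 0)) vs"
    have "\<bar>dderivs us (smooth_apply (?s vs k x)) y\<bar> \<le> (\<Sum>vs\<in>L. \<bar>M (?m vs)\<bar>)"
      if "vs \<in> L" "k \<in> B" "x \<in> cball 0 (real n)" "y \<in> K" for vs k x y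
    proof -
      have "\<bar>dderivs us (smooth_apply (?s vs k x)) y\<bar> \<le> M (?m vs)"
        using M that(2-4)
        by (simp add: dderivs_slice smooth_apply_foldr_smooth_deriv dderivs_append[symmetric])
      also have "\<dots> \<le> \<bar>M (?m vs)\<bar>" by simp
      also have "\<dots> \<le> (\<Sum>vs\<in>L. \<bar>M (?m vs)\<bar>)"
        by (rule member_le_sum[OF that(1) _ L, of "\<lambda>vs. \<bar>M (?m vs)\<bar>"]) simp
      finally show ?thesis .
    qed
    then show "\<exists>M. \<forall>f\<in>S n. \<forall>y\<in>K. \<bar>dderivs us (smooth_apply f) y\<bar> \<le> M"
      by (intro exI[of _ "\<Sum>vs\<in>L. \<bar>M (?m vs)\<bar>"]) (auto simp: S_def L_def)
  qed
  obtain c where c: "\<And>n. c n > 0" "tvs_bounded (\<Union>n. (\<lambda>f. c n *\<^sub>R f) ` S n)"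
    using tvs_bounded_smooth_countable_Union[of S, OF S_bounded] by blast
  define B2 where "B2 = (\<Union>n. (\<lambda>f. c n *\<^sub>R f) ` S n)"
  define B1 where "B1 = {partial_pairing k \<mu> | k \<mu>. k \<in> B \<and> (\<forall>g\<in>B2. \<bar>\<langle>g, \<mu>\<rangle>\<bar> \<le> 1)}"
  have "tvs_bounded B1"
  proof (rule tvs_bounded_smooth_BasisI)
    fix vs :: "'a list" and n assume vs: "set vs \<subseteq> Basis"
    define m where "m = max n (length vs)"
    have "\<bar>dderivs vs (smooth_apply (partial_pairing k \<mu>)) x\<bar> \<le> 1 / c m"
      if k: "k \<in> B" and \<mu>: "\<forall>g\<in>B2. \<bar>\<langle>g, \<mu>\<rangle>\<bar> \<le> 1" and x: "x \<in> cball 0 (real n)" for k \<mu> x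
    proof -
      have "length vs \<le> m" "x \<in> cball 0 (real m)" using x by (auto simp: m_def)
      then have "?s vs k x \<in> S m" using vs k unfolding S_def by blast
      then have "c m *\<^sub>R ?s vs k x \<in> B2" unfolding B2_def by blast
      then have "\<bar>\<langle>c m *\<^sub>R ?s vs k x, \<mu>\<rangle>\<bar> \<le> 1" using \<mu> by blast
      then show ?thesis using c(1)[of m] by (simp add: dderivs_partial_pairing abs_mult field_simps)
    qed
    then show "\<exists>M. \<forall>f\<in>B1. \<forall>x\<in>cball 0 (real n). \<bar>dderivs vs (smooth_apply f) x\<bar> \<le> M"
      unfolding B1_def by blast
  qed
  moreover have "\<bar>\<langle>k, tensor \<gamma> \<mu>\<rangle>\<bar> \<le> 1"
    if "\<forall>f\<in>B1. \<bar>\<langle>f, \<gamma>\<rangle>\<bar> \<le> 1" "\<forall>g\<in>B2. \<bar>\<langle>g, \<mu>\<rangle>\<bar> \<le> 1" "k \<in> B" for \<gamma> \<mu> k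
    using that unfolding pairing_tensor B1_def by blast
  ultimately show "\<exists>B1 B2. tvs_bounded B1 \<and> tvs_bounded B2 \<and>
        (\<forall>\<gamma> \<mu>. (\<forall>f\<in>B1. \<bar>\<langle>f, \<gamma>\<rangle>\<bar> \<le> 1) \<longrightarrow> (\<forall>g\<in>B2. \<bar>\<langle>g, \<mu>\<rangle>\<bar> \<le> 1) \<longrightarrow> (\<forall>h\<in>B. \<bar>\<langle>h, tensor \<gamma> \<mu>\<rangle>\<bar> \<le> 1))"
    using c(2)[folded B2_def] by blast
qed

lemma tendsto_pairing:
  assumes "(g \<longlongrightarrow> \<mu>) F"
  shows "((\<lambda>x. \<langle>f, g x\<rangle>) \<longlongrightarrow> \<langle>f, \<mu>\<rangle>) F"
proof (rule tendstoI)
  fix e :: real assume "e > 0"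
  then have "\<forall>\<^sub>F x in F. \<forall>h\<in>{f}. \<bar>\<langle>h, g x\<rangle> - \<langle>h, \<mu>\<rangle>\<bar> < e"
    using assms tvs_bounded_singleton[of f] unfolding tendsto_dual_iff by blast
  then show "\<forall>\<^sub>F x in F. dist \<langle>f, g x\<rangle> \<langle>f, \<mu>\<rangle> < e" by (simp add: dist_real_def)
qed

lift_definition swap :: "('a::euclidean_space \<times> 'b::euclidean_space) smooth \<Rightarrow> ('b \<times> 'a) smooth"
  is "\<lambda>\<Phi> z. \<Phi> (snd z, fst z)"
  by (rule smooth_function_compose_linear)
    (auto intro: bounded_linear_Pair bounded_linear_fst bounded_linear_snd)

text \<open>Fubini: by reflexivity, \<open>\<mu> \<mapsto> \<langle>\<Phi>, \<gamma> \<otimes> \<mu>\<rangle>\<close> is the pairing with a smooth function, which is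
  identified by testing with Dirac measures.\<close>

lemma tensor_commute:
  fixes \<Phi> :: "('a::euclidean_space \<times> 'b::euclidean_space) smooth"
  shows "\<langle>\<Phi>, tensor \<gamma> \<mu>\<rangle> = \<langle>swap \<Phi>, tensor \<mu> \<gamma>\<rangle>"
proof -
  have "linear (\<lambda>\<mu>. \<langle>\<Phi>, tensor \<gamma> \<mu>\<rangle>)"
    by (rule linearI_lincomb)
      (simp add: linear_add[OF linear_bilinear_right[OF polar_bounded_bilinear_tensor]]
        linear_cmul[OF linear_bilinear_right[OF polar_bounded_bilinear_tensor]])
  moreover have "continuous_on UNIV (\<lambda>\<mu>. \<langle>\<Phi>, tensor \<gamma> \<mu>\<rangle>)"
    unfolding continuous_on_def
    by (intro ballI tendsto_pairing tendsto_bilinear[OF polar_bounded_bilinear_tensor] tendsto_const tendsto_ident_at)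
  ultimately obtain f where f: "\<And>\<mu>. \<langle>\<Phi>, tensor \<gamma> \<mu>\<rangle> = \<langle>f, \<mu>\<rangle>"
    by (rule smooth_reflexive) blast
  have "f = partial_pairing (swap \<Phi>) \<gamma>"
  proof (rule smooth_eqI)
    fix y
    have "smooth_apply f y = \<langle>\<Phi>, tensor \<gamma> (derivative_at [] y)\<rangle>"
      by (simp add: f pairing_derivative_at)
    also have "\<dots> = \<langle>slice (swap \<Phi>) y, \<gamma>\<rangle>"
      unfolding pairing_tensor
      by (rule arg_cong[of _ _ "\<lambda>f. \<langle>f, \<gamma>\<rangle>"], rule smooth_eqI)
        (simp add: smooth_apply_partial_pairing pairing_derivative_at slice.rep_eq swap.rep_eq)
    finally show "smooth_apply f y = smooth_apply (partial_pairing (swap \<Phi>) \<gamma>) y"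
      by (simp add: smooth_apply_partial_pairing)
  qed
  then show ?thesis by (simp add: f pairing_tensor[where \<Phi> = "swap \<Phi>"])
qed

section \<open>Gateaux derivatives\<close>

lemma gateaux_derivI:
  "((\<lambda>t. (f (x + t *\<^sub>R h) - f x) /\<^sub>R t) \<longlongrightarrow> l) (at 0) \<Longrightarrow> gateaux_deriv f x h = l"
  unfolding gateaux_deriv_def by (rule tendsto_Lim) auto

lemma gateaux_differentiable_iff:
  "gateaux_differentiable f x h \<longleftrightarrow>
    ((\<lambda>t. (f (x + t *\<^sub>R h) - f x) /\<^sub>R t) \<longlongrightarrow> gateaux_deriv f x h) (at 0)"
  unfolding gateaux_differentiable_def
proof
  assume "\<exists>l. ((\<lambda>t. (f (x + t *\<^sub>R h) - f x) /\<^sub>R t) \<longlongrightarrow> l) (at 0)"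
  then obtain l where l: "((\<lambda>t. (f (x + t *\<^sub>R h) - f x) /\<^sub>R t) \<longlongrightarrow> l) (at 0)" ..
  then show "((\<lambda>t. (f (x + t *\<^sub>R h) - f x) /\<^sub>R t) \<longlongrightarrow> gateaux_deriv f x h) (at 0)"
    unfolding gateaux_derivI[OF l] .
qed blast

lemma
  assumes "gateaux_smooth f"
  shows gateaux_smooth_differentiable: "gateaux_differentiable f x h"
    and continuous_on_gateaux_deriv: "continuous_on UNIV (\<lambda>(x, h). gateaux_deriv f x h)"
proof -
  from assms have "\<And>x h. gateaux_differentiable (\<lambda>y. iter_gateaux_deriv 0 f y h) x (h 0)"
    and cont: "continuous_on UNIV (\<lambda>(x, h). iter_gateaux_deriv 1 f x h)"
    unfolding gateaux_smooth_def by blast+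
  from this(1)[of "\<lambda>_. h" x] show "gateaux_differentiable f x h" by simp
  have fst: "continuous_on UNIV (\<lambda>p :: 'a \<times> 'a. fst p)" and snd: "continuous_on UNIV (\<lambda>p :: 'a \<times> 'a. snd p)"
    by (simp_all add: continuous_on_fst continuous_on_snd)
  \<comment> \<open>Directions enter \<open>gateaux_smooth\<close> as a sequence; the constant
    sequence turns continuity in it into continuity in one direction.\<close>
  have const: "continuous_on UNIV (\<lambda>p :: 'a \<times> 'a. \<lambda>_ :: nat. snd p)"
    by (rule continuous_on_coordinatewise_then_product) (rule snd)
  have "continuous_on UNIV (\<lambda>p :: 'a \<times> 'a. (\<lambda>(x, h). iter_gateaux_deriv 1 f x h) (fst p, \<lambda>_. snd p))"
    by (rule continuous_on_compose2[OF cont continuous_on_Pair[OF fst const]]) simp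
  then show "continuous_on UNIV (\<lambda>(x, h). gateaux_deriv f x h)"
    by (simp add: case_prod_beta)
qed

lemma gateaux_line:
  fixes F :: "'a::topological_real_vector \<Rightarrow> real"
  assumes "gateaux_smooth F"
  shows "((\<lambda>s. F (x + s *\<^sub>R h)) has_real_derivative gateaux_deriv F (x + s *\<^sub>R h) h) (at s)"
proof -
  have "((\<lambda>t. (F (x + s *\<^sub>R h + t *\<^sub>R h) - F (x + s *\<^sub>R h)) /\<^sub>R t) \<longlongrightarrow> gateaux_deriv F (x + s *\<^sub>R h) h) (at 0)"
    using gateaux_smooth_differentiable[OF assms] unfolding gateaux_differentiable_iff .
  moreover have "x + s *\<^sub>R h + t *\<^sub>R h = x + (s + t) *\<^sub>R h" for t by (simp add: algebra_simps)
  ultimately show ?thesis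
    unfolding DERIV_def by (simp add: divide_inverse mult.commute)
qed

lemma gateaux_deriv_scaleR:
  fixes F :: "'a::topological_real_vector \<Rightarrow> real"
  assumes "gateaux_smooth F"
  shows "gateaux_deriv F x (c *\<^sub>R h) = c * gateaux_deriv F x h"
proof -
  have "((\<lambda>s. c * s) has_real_derivative c) (at 0)"
    by (auto intro!: derivative_eq_intros)
  from DERIV_chain2[where f = "\<lambda>s. F (x + s *\<^sub>R h)" and g = "\<lambda>s. c * s" and x = 0, OF gateaux_line[OF assms] this]
  have "((\<lambda>s. F (x + (c * s) *\<^sub>R h)) has_real_derivative gateaux_deriv F x h * c) (at 0)" by simp
  moreover have "((\<lambda>s. F (x + (c * s) *\<^sub>R h)) has_real_derivative gateaux_deriv F x (c *\<^sub>R h)) (at 0)"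
    using gateaux_line[OF assms, of x "c *\<^sub>R h" 0] by (simp add: mult.commute)
  ultimately have "gateaux_deriv F x h * c = gateaux_deriv F x (c *\<^sub>R h)" by (rule DERIV_unique)
  then show ?thesis by (simp add: mult.commute)
qed

text \<open>Linearity in the direction is not part of the definition of smoothness. The increment
  along h + k is split at x + t h; the second part is a derivative along k at an intermediate point,
  which tends to x, and joint continuity gives its limit.\<close>

lemma gateaux_deriv_add:
  fixes F :: "'a::topological_real_vector \<Rightarrow> real"
  assumes F: "gateaux_smooth F"
  shows "gateaux_deriv F x (h + k) = gateaux_deriv F x h + gateaux_deriv F x k"
proof -
  have "\<exists>\<theta>. 0 \<le> \<theta> \<and> \<theta> \<le> 1 \<and>
      F (x + t *\<^sub>R (h + k)) - F (x + t *\<^sub>R h) = t * gateaux_deriv F (x + t *\<^sub>R h + (\<theta> * t) *\<^sub>R k) k" for t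
  proof -
    \<comment> \<open>The mean value theorem is applied on the unit interval with t absorbed into
      the direction, which covers every sign of t; homogeneity then extracts t.\<close>
    obtain \<theta> where \<theta>: "0 < \<theta>" "\<theta> < 1"
      "F (x + t *\<^sub>R h + 1 *\<^sub>R t *\<^sub>R k) - F (x + t *\<^sub>R h + 0 *\<^sub>R t *\<^sub>R k) =
        (1 - 0) * gateaux_deriv F (x + t *\<^sub>R h + \<theta> *\<^sub>R t *\<^sub>R k) (t *\<^sub>R k)"
      using MVT2[OF zero_less_one gateaux_line[OF F]] by blast
    then show ?thesis
      by (intro exI[of _ \<theta>]) (simp add: gateaux_deriv_scaleR[OF F] algebra_simps)
  qed
  then obtain \<theta> where \<theta>: "\<And>t. 0 \<le> \<theta> t" "\<And>t. \<theta> t \<le> 1"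
    "\<And>t. F (x + t *\<^sub>R (h + k)) - F (x + t *\<^sub>R h) = t * gateaux_deriv F (x + t *\<^sub>R h + (\<theta> t * t) *\<^sub>R k) k"
    by metis
  have "((\<lambda>t. \<theta> t * t) \<longlongrightarrow> 0) (at 0)"
  proof (rule tendsto_rabs_zero_cancel, rule tendsto_sandwich)
    show "\<forall>\<^sub>F t in at 0. 0 \<le> \<bar>\<theta> t * t\<bar>" by simp
    have "\<bar>\<theta> t * t\<bar> \<le> \<bar>t\<bar>" for t
      using \<theta>(1,2)[of t] by (simp add: abs_mult mult_left_le_one_le)
    then show "\<forall>\<^sub>F t in at 0. \<bar>\<theta> t * t\<bar> \<le> \<bar>t\<bar>" by simp
  qed (auto intro!: tendsto_eq_intros)
  then have "((\<lambda>t. x + t *\<^sub>R h + (\<theta> t * t) *\<^sub>R k) \<longlongrightarrow> x + 0 *\<^sub>R h + 0 *\<^sub>R k) (at 0)"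
    by (intro tendsto_add tendsto_scaleR_tvs tendsto_const tendsto_ident_at)
  then have "((\<lambda>t. (x + t *\<^sub>R h + (\<theta> t * t) *\<^sub>R k, k)) \<longlongrightarrow> (x, k)) (at 0)"
    by (intro tendsto_Pair tendsto_const) simp
  then have "((\<lambda>t. (\<lambda>(x, h). gateaux_deriv F x h) (x + t *\<^sub>R h + (\<theta> t * t) *\<^sub>R k, k)) \<longlongrightarrow>
      (\<lambda>(x, h). gateaux_deriv F x h) (x, k)) (at 0)"
    by (rule continuous_on_tendsto_compose[OF continuous_on_gateaux_deriv[OF F]]) auto
  then have lim1: "((\<lambda>t. gateaux_deriv F (x + t *\<^sub>R h + (\<theta> t * t) *\<^sub>R k) k) \<longlongrightarrow> gateaux_deriv F x k) (at 0)"
    by simp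
  have lim2: "((\<lambda>t. (F (x + t *\<^sub>R h) - F x) /\<^sub>R t) \<longlongrightarrow> gateaux_deriv F x h) (at 0)"
    using gateaux_smooth_differentiable[OF F] unfolding gateaux_differentiable_iff .
  have "((\<lambda>t. (F (x + t *\<^sub>R (h + k)) - F x) /\<^sub>R t) \<longlongrightarrow> gateaux_deriv F x h + gateaux_deriv F x k) (at 0)"
  proof (rule Lim_transform_eventually[OF tendsto_add[OF lim2 lim1]])
    have "(b - c) /\<^sub>R t + g = (a - c) /\<^sub>R t" if "t \<noteq> 0" "a - b = t * g" for a b c g t :: real
      using that by (simp add: field_simps)
    from this[OF _ \<theta>(3)]
    show "\<forall>\<^sub>F t in at 0. (F (x + t *\<^sub>R h) - F x) /\<^sub>R t + gateaux_deriv F (x + t *\<^sub>R h + (\<theta> t * t) *\<^sub>R k) k =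
        (F (x + t *\<^sub>R (h + k)) - F x) /\<^sub>R t"
      unfolding eventually_at_filter by (intro always_eventually allI impI)
  qed
  then show ?thesis by (rule gateaux_derivI)
qed

section \<open>Gradients as elements of the predual\<close>

lemma dual_gradient_eqI:
  fixes F :: "'a::euclidean_space distr \<Rightarrow> real"
  assumes "\<And>\<mu>. gateaux_deriv F \<gamma> \<mu> = \<langle>f, \<mu>\<rangle>"
  shows "dual_gradient F \<gamma> = f"
  unfolding dual_gradient_def
proof (rule the_equality)
  show "g = f" if "\<forall>\<mu>. gateaux_deriv F \<gamma> \<mu> = \<langle>g, \<mu>\<rangle>" for g
    using that assms by (intro pairing_separates) simp
qed (use assms in blast)

text \<open>At fixed \<gamma> joint continuity restricts to continuity in the direction, so the
  derivative lies in the bidual and reflexivity shows that the definite description in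
  \<open>dual_gradient\<close> is proper.\<close>

lemma gateaux_deriv_eq_dual_gradient:
  fixes F :: "'a::euclidean_space distr \<Rightarrow> real"
  assumes F: "gateaux_smooth F"
  shows "gateaux_deriv F \<gamma> \<mu> = \<langle>dual_gradient F \<gamma>, \<mu>\<rangle>"
proof -
  have "linear (gateaux_deriv F \<gamma>)"
    by (rule linearI_lincomb) (simp add: gateaux_deriv_add[OF F] gateaux_deriv_scaleR[OF F])
  moreover have "continuous_on UNIV (\<lambda>\<mu>. (\<lambda>(x, h). gateaux_deriv F x h) (\<gamma>, \<mu>))"
    by (rule continuous_on_compose2[OF continuous_on_gateaux_deriv[OF F]])
      (auto intro!: continuous_on_Pair continuous_on_const continuous_on_id)
  ultimately obtain f where f: "\<And>\<mu>. gateaux_deriv F \<gamma> \<mu> = \<langle>f, \<mu>\<rangle>"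
    using smooth_reflexive[of "gateaux_deriv F \<gamma>"] by auto
  then show ?thesis using dual_gradient_eqI[OF f] by simp
qed


section \<open>Smoothness of quadratic maps\<close>

text \<open>All derivatives are explicit and vanish from order three on. Continuity of A and Q is
  assumed along filters on \<open>'a \<times> (nat \<Rightarrow> 'a)\<close>, the space of base
  points and directions on which smoothness is tested. Q need not be symmetric, so both orders of
  its arguments appear.\<close>

lemma gateaux_smooth_quadratic:
  fixes A :: "'a::topological_real_vector \<Rightarrow> 'b::{topological_real_vector, t2_space}"
    and Q :: "'a \<Rightarrow> 'a \<Rightarrow> 'b"
  assumes A: "linear A" "\<And>f \<gamma> (F :: ('a \<times> (nat \<Rightarrow> 'a)) filter). (f \<longlongrightarrow> \<gamma>) F \<Longrightarrow> ((\<lambda>x. A (f x)) \<longlongrightarrow> A \<gamma>) F"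
    and Q: "\<And>\<mu>. linear (\<lambda>\<gamma>. Q \<gamma> \<mu>)" "\<And>\<gamma>. linear (Q \<gamma>)"
    and Q_cont: "\<And>f \<gamma> g \<mu> (F :: ('a \<times> (nat \<Rightarrow> 'a)) filter). (f \<longlongrightarrow> \<gamma>) F \<Longrightarrow> (g \<longlongrightarrow> \<mu>) F \<Longrightarrow>
        ((\<lambda>x. Q (f x) (g x)) \<longlongrightarrow> Q \<gamma> \<mu>) F"
  shows "gateaux_smooth (\<lambda>\<gamma>. A \<gamma> + Q \<gamma> \<gamma>)"
proof -
  let ?X = "\<lambda>\<gamma>. A \<gamma> + Q \<gamma> \<gamma>"
  note lin = linear_add[OF A(1)] linear_cmul[OF A(1)] linear_add[OF Q(1)] linear_cmul[OF Q(1)]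
    linear_add[OF Q(2)] linear_cmul[OF Q(2)]
  define D where "D n x h = (if n = 0 then A x + Q x x
      else if n = 1 then A (h 0) + Q x (h 0) + Q (h 0) x
      else if n = 2 then Q (h 1) (h 0) + Q (h 0) (h 1) else 0)" for n :: nat and x and h :: "nat \<Rightarrow> 'a"
  have lim: "((\<lambda>t. (D n (x + t *\<^sub>R h n) h - D n x h) /\<^sub>R t) \<longlongrightarrow> D (Suc n) x h) (at 0)" for n x h
  proof -
    \<comment> \<open>Only the quotient of order 0 has a remainder, the quadratic term times t; from
      order 1 on the derivatives are affine in x and their quotients are exact.\<close>
    define R where "R = (if n = 0 then Q (h 0) (h 0) else 0)"
    have "(D n (x + t *\<^sub>R h n) h - D n x h) /\<^sub>R t = D (Suc n) x h + t *\<^sub>R R" if t: "t \<noteq> 0" for t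
    proof -
      have "D n (x + t *\<^sub>R h n) h - D n x h = t *\<^sub>R (D (Suc n) x h + t *\<^sub>R R)"
      proof -
        consider "n = 0" | "n = 1" | "n \<ge> 2" by linarith
        then show ?thesis
          by cases (simp_all add: D_def R_def lin algebra_simps)
      qed
      then show ?thesis using t by simp
    qed
    then have ev: "\<forall>\<^sub>F t in at 0. D (Suc n) x h + t *\<^sub>R R = (D n (x + t *\<^sub>R h n) h - D n x h) /\<^sub>R t"
      by (auto simp: eventually_at_filter)
    have "((\<lambda>t. D (Suc n) x h + t *\<^sub>R R) \<longlongrightarrow> D (Suc n) x h + 0 *\<^sub>R R) (at 0)"
      by (intro tendsto_add tendsto_scaleR_tvs tendsto_const tendsto_ident_at)
    from Lim_transform_eventually[OF this ev] show ?thesis by simp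
  qed
  have iter: "iter_gateaux_deriv n ?X x h = D n x h" for n x h
  proof (induction n arbitrary: x)
    case 0
    then show ?case by (simp add: D_def)
  next
    case (Suc n)
    show ?case by (simp add: Suc.IH gateaux_derivI[OF lim])
  qed
  show ?thesis
    unfolding gateaux_smooth_def iter
  proof (intro allI conjI)
    fix n x h
    show "gateaux_differentiable (\<lambda>y. D n y h) x (h n)"
      unfolding gateaux_differentiable_def using lim by blast
    have fst: "((\<lambda>p. fst p) \<longlongrightarrow> fst p) (at p)"
      and snd: "((\<lambda>p. snd p i) \<longlongrightarrow> snd p i) (at p)" for p :: "'a \<times> (nat \<Rightarrow> 'a)" and i
    proof -
      show "((\<lambda>p. fst p) \<longlongrightarrow> fst p) (at p)"
        by (intro tendsto_fst tendsto_ident_at)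
      have "continuous_on UNIV (\<lambda>p :: 'a \<times> (nat \<Rightarrow> 'a). snd p i)"
        by (rule continuous_on_product_then_coordinatewise) (intro continuous_on_snd continuous_on_id)
      then show "((\<lambda>p. snd p i) \<longlongrightarrow> snd p i) (at p)"
        by (cases p) (simp add: continuous_on_def)
    qed
    consider "n = 0" | "n = 1" | "n = 2" | "n \<ge> 3" by linarith
    then show "continuous_on UNIV (\<lambda>(x, h). D n x h)"
      unfolding continuous_on_def case_prod_beta D_def
      by cases (auto intro!: tendsto_add A(2) Q_cont tendsto_const
          fst[where p = "(_, _)", simplified] snd[where p = "(_, _)", simplified])
  qed
qed

section \<open>Bounded operators and their transposes\<close>

definition bounded_operator :: "('a::topological_real_vector \<Rightarrow> 'b::topological_real_vector) \<Rightarrow> bool" where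
  "bounded_operator T \<longleftrightarrow> (\<forall>B. tvs_bounded B \<longrightarrow> tvs_bounded (T ` B))"

lemma bounded_operator_compose:
  "bounded_operator S \<Longrightarrow> bounded_operator T \<Longrightarrow> bounded_operator (\<lambda>f. S (T f))"
  unfolding bounded_operator_def by (metis image_image)

lemma bounded_operator_scaleR: "bounded_operator T \<Longrightarrow> bounded_operator (\<lambda>f. c *\<^sub>R T f)"
  unfolding bounded_operator_def by (metis image_image tvs_bounded_scaleR)

lemma bounded_operator_smooth_iff:
  "bounded_operator T \<longleftrightarrow> (\<forall>B vs K. tvs_bounded B \<longrightarrow> compact K \<longrightarrow>
     (\<exists>M. \<forall>f\<in>B. \<forall>x\<in>K. \<bar>dderivs vs (smooth_apply (T f)) x\<bar> \<le> M))"
  unfolding bounded_operator_def tvs_bounded_smooth_iff[of "T ` _"] by auto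

lemma bounded_operator_sum:
  fixes T :: "'i \<Rightarrow> 'a::topological_real_vector \<Rightarrow> 'b::euclidean_space smooth"
  assumes "finite A" "\<And>i. i \<in> A \<Longrightarrow> bounded_operator (T i)"
  shows "bounded_operator (\<lambda>f. \<Sum>i\<in>A. T i f)"
  unfolding bounded_operator_smooth_iff
proof (intro allI impI)
  fix B :: "'a set" and vs and K :: "'b set" assume B: "tvs_bounded B" and K: "compact K"
  have "\<forall>i. \<exists>M. i \<in> A \<longrightarrow> (\<forall>f\<in>B. \<forall>x\<in>K. \<bar>dderivs vs (smooth_apply (T i f)) x\<bar> \<le> M)"
    using assms(2) B K unfolding bounded_operator_smooth_iff by blast
  from choice[OF this] obtain M where
    M: "\<forall>i. i \<in> A \<longrightarrow> (\<forall>f\<in>B. \<forall>x\<in>K. \<bar>dderivs vs (smooth_apply (T i f)) x\<bar> \<le> M i)" ..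
  have "\<bar>dderivs vs (smooth_apply (\<Sum>i\<in>A. T i f)) x\<bar> \<le> (\<Sum>i\<in>A. M i)" if "f \<in> B" "x \<in> K" for f x
    unfolding dderivs_sum_smooth by (rule order_trans[OF sum_abs], rule sum_mono) (use M that in blast)
  then show "\<exists>M. \<forall>f\<in>B. \<forall>x\<in>K. \<bar>dderivs vs (smooth_apply (\<Sum>i\<in>A. T i f)) x\<bar> \<le> M" by blast
qed

lemma bounded_operator_smooth_deriv: "bounded_operator (smooth_deriv v)"
  unfolding bounded_operator_smooth_iff dderivs_smooth_deriv by (auto simp: tvs_bounded_smooth_iff)

lemma bounded_operator_tensor_one:
  "bounded_operator (tensor_one :: 'a::euclidean_space smooth \<Rightarrow> ('a \<times> 'b::euclidean_space) smooth)"
  unfolding bounded_operator_smooth_iff dderivs_tensor_one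
proof (intro allI impI)
  fix B :: "'a smooth set" and vs and K :: "('a \<times> 'b) set"
  assume B: "tvs_bounded B" and K: "compact K"
  have "compact (fst ` K)" using K by (intro compact_continuous_image continuous_intros)
  then obtain M where "\<forall>f\<in>B. \<forall>x\<in>fst ` K. \<bar>dderivs (map fst vs) (smooth_apply f) x\<bar> \<le> M"
    using B unfolding tvs_bounded_smooth_iff by blast
  then show "\<exists>M. \<forall>f\<in>B. \<forall>x\<in>K. \<bar>dderivs (map fst vs) (smooth_apply f) (fst x)\<bar> \<le> M" by blast
qed

lemma bounded_operator_mult: "bounded_operator ((*) (g :: 'a::euclidean_space smooth))"
  unfolding bounded_operator_smooth_iff
proof (intro allI impI)
  fix B :: "'a smooth set" and vs and K :: "'a set"
  assume B: "tvs_bounded B" and K: "compact K"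
  \<comment> \<open>Stated for any list of pairs, so that induction applies; the Leibniz list
    \<open>splits vs\<close> is an instance.\<close>
  have "\<exists>M. \<forall>f\<in>B. \<forall>x\<in>K. \<bar>\<Sum>p\<leftarrow>ps. dderivs (fst p) (smooth_apply g) x * dderivs (snd p) (smooth_apply f) x\<bar> \<le> M" for ps
  proof (induction ps)
    case Nil
    then show ?case by auto
  next
    case (Cons p ps)
    then obtain M where M: "\<And>f x. f \<in> B \<Longrightarrow> x \<in> K \<Longrightarrow>
        \<bar>\<Sum>p\<leftarrow>ps. dderivs (fst p) (smooth_apply g) x * dderivs (snd p) (smooth_apply f) x\<bar> \<le> M" by blast
    obtain M1 where M1: "M1 > 0" "\<And>x. x \<in> K \<Longrightarrow> \<bar>dderivs (fst p) (smooth_apply g) x\<bar> \<le> M1"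
      using dderivs_bounded_on_compact[OF K, of "{fst p}" g] by auto
    have "\<exists>M. \<forall>f\<in>B. \<forall>x\<in>K. \<bar>dderivs (snd p) (smooth_apply f) x\<bar> \<le> M"
      using B K unfolding tvs_bounded_smooth_iff by blast
    then obtain M2 where M2: "\<And>f x. f \<in> B \<Longrightarrow> x \<in> K \<Longrightarrow> \<bar>dderivs (snd p) (smooth_apply f) x\<bar> \<le> M2"
      by blast
    have "\<bar>\<Sum>p\<leftarrow>p # ps. dderivs (fst p) (smooth_apply g) x * dderivs (snd p) (smooth_apply f) x\<bar> \<le> M1 * M2 + M"
      if "f \<in> B" "x \<in> K" for f x
    proof -
      have "\<bar>dderivs (fst p) (smooth_apply g) x * dderivs (snd p) (smooth_apply f) x\<bar> \<le> M1 * M2"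
        unfolding abs_mult using M1(1) by (intro mult_mono M1(2) M2 that) auto
      then show ?thesis using M[OF that] by simp
    qed
    then show ?case by blast
  qed
  then show "\<exists>M. \<forall>f\<in>B. \<forall>x\<in>K. \<bar>dderivs vs (smooth_apply (g * f)) x\<bar> \<le> M"
    by (simp add: times_smooth.rep_eq dderivs_mult)
qed

lemma tendsto_transpose:
  fixes T :: "'a::topological_real_vector \<Rightarrow> 'b::topological_real_vector"
  assumes T: "bounded_operator T" and lim: "(g \<longlongrightarrow> \<mu>) F"
    and "\<And>f x. \<langle>f, h x\<rangle> = \<langle>T f, g x\<rangle>" "\<And>f. \<langle>f, \<nu>\<rangle> = \<langle>T f, \<mu>\<rangle>"
  shows "(h \<longlongrightarrow> \<nu>) F"
  unfolding tendsto_dual_iff assms(3,4)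
proof (intro allI impI)
  fix B :: "'a set" and e :: real assume B: "tvs_bounded B \<and> e > 0"
  then have "tvs_bounded (T ` B)" using T unfolding bounded_operator_def by blast
  then have "\<forall>\<^sub>F x in F. \<forall>f\<in>T ` B. \<bar>\<langle>f, g x\<rangle> - \<langle>f, \<mu>\<rangle>\<bar> < e"
    using lim B unfolding tendsto_dual_iff by blast
  then show "\<forall>\<^sub>F x in F. \<forall>f\<in>B. \<bar>\<langle>T f, g x\<rangle> - \<langle>T f, \<mu>\<rangle>\<bar> < e" by simp
qed

section \<open>Derivatives of the functions in the Vlasov Hamiltonian\<close>

lemma smooth_apply_smooth_deriv: "smooth_apply (smooth_deriv v f) = dderivs [v] (smooth_apply f)"
  by (simp add: smooth_deriv.rep_eq)

lemma smooth_derivI: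
  assumes "\<And>x. (smooth_apply f has_derivative D x) (at x)" "\<And>x. smooth_apply g x = D x v"
  shows "smooth_deriv v f = g"
proof (rule smooth_eqI)
  fix x
  have "dderivs [v] (smooth_apply f) x = D x v"
    by (rule dderivs_Cons_eq) (simp add: assms(1))
  then show "smooth_apply (smooth_deriv v f) x = smooth_apply g x"
    by (simp add: smooth_apply_smooth_deriv assms(2) del: dderivs.simps(2))
qed

lemma smooth_deriv_simps:
  "smooth_deriv v (f + g) = smooth_deriv v f + smooth_deriv v g"
  "smooth_deriv v (c *\<^sub>R f) = c *\<^sub>R smooth_deriv v f"
proof -
  have lin: "linear (smooth_deriv v)" by (rule linearI_lincomb) (rule smooth_deriv_lincomb_right)
  show "smooth_deriv v (f + g) = smooth_deriv v f + smooth_deriv v g"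
    "smooth_deriv v (c *\<^sub>R f) = c *\<^sub>R smooth_deriv v f"
    by (simp_all add: linear_add[OF lin] linear_cmul[OF lin])
qed

lemma smooth_deriv_zero_direction: "smooth_deriv 0 f = 0"
  using smooth_deriv_lincomb[where a = "-1" and u = 0 and v = 0 and f = f] by simp

lemma smooth_deriv_mult: "smooth_deriv v (g * f) = smooth_deriv v g * f + g * smooth_deriv v f"
  by (rule smooth_eqI)
    (simp add: smooth_apply_smooth_deriv times_smooth.rep_eq plus_smooth.rep_eq dderivs_mult
      del: dderivs.simps(2))

lemma smooth_deriv_tensor_one: "smooth_deriv v (tensor_one f) = tensor_one (smooth_deriv (fst v) f)"
  by (rule smooth_eqI, unfold smooth_apply_smooth_deriv dderivs_tensor_one)
    (simp add: tensor_one.rep_eq smooth_apply_smooth_deriv del: dderivs.simps(2))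

lemma tensor_one_simps: "tensor_one 0 = 0" "tensor_one 1 = 1" "tensor_one (c *\<^sub>R f) = c *\<^sub>R tensor_one f"
  by (transfer; simp)+

lemma smooth_deriv_velocity: "smooth_deriv v (velocity j) = (snd v $ j) *\<^sub>R 1"
proof (rule smooth_derivI)
  show "(smooth_apply (velocity j) has_derivative (\<lambda>h. snd h $ j)) (at x)" for x :: "'a phase"
    unfolding velocity.rep_eq
    by (intro bounded_linear_imp_has_derivative bounded_linear_compose[OF bounded_linear_vec_nth] bounded_linear_snd)
qed (simp add: scaleR_smooth.rep_eq one_smooth.rep_eq)

lemma smooth_deriv_kinetic_energy:
  "smooth_deriv (x_dir i) kinetic_energy = 0" "smooth_deriv (v_dir i) kinetic_energy = velocity i"
proof -
  have *: "(smooth_apply kinetic_energy has_derivative (\<lambda>h. snd z \<bullet> snd h)) (at z)" for z :: "'a phase"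
    unfolding kinetic_energy.rep_eq power2_norm_eq_inner
    by (auto intro!: derivative_eq_intros simp: inner_commute)
  show "smooth_deriv (x_dir i) kinetic_energy = 0" "smooth_deriv (v_dir i) kinetic_energy = velocity i"
    by (rule smooth_derivI[OF *], simp add: zero_smooth.rep_eq velocity.rep_eq inner_axis)+
qed

lemma smooth_deriv_difference_kernel:
  "smooth_deriv (v, 0) (difference_kernel g) = difference_kernel (smooth_deriv v g)"
proof (rule smooth_eqI)
  fix z
  have "smooth_apply (difference_kernel g) = (\<lambda>z. smooth_apply g (fst z - snd z))"
    by (simp add: difference_kernel.rep_eq fun_eq_iff)
  then have "dderivs [(v, 0)] (smooth_apply (difference_kernel g)) z =
      dderivs (map (\<lambda>z. fst z - snd z) [(v, 0)]) (smooth_apply g) (fst z - snd z)"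
    using dderivs_linear[OF smooth_function_smooth_apply[of g], of "\<lambda>z. fst z - snd z" "[(v, 0)]"]
    by (simp add: bounded_linear_sub bounded_linear_fst bounded_linear_snd del: dderivs.simps(2))
  then show "smooth_apply (smooth_deriv (v, 0) (difference_kernel g)) z =
      smooth_apply (difference_kernel (smooth_deriv v g)) z"
    by (simp add: smooth_apply_smooth_deriv difference_kernel.rep_eq)
qed

lemma smooth_deriv_convolution: "smooth_deriv v (convolution g \<mu>) = convolution (smooth_deriv v g) \<mu>"
proof (rule smooth_eqI)
  fix x
  have "smooth_apply (smooth_deriv v (convolution g \<mu>)) x =
      dderivs [v] (smooth_apply (partial_pairing (difference_kernel g) \<mu>)) x"
    by (simp add: smooth_apply_smooth_deriv convolution_def)
  also have "\<dots> = \<langle>slice (difference_kernel (smooth_deriv v g)) x, \<mu>\<rangle>"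
    unfolding dderivs_partial_pairing by (simp add: smooth_deriv_difference_kernel)
  finally show "smooth_apply (smooth_deriv v (convolution g \<mu>)) x =
      smooth_apply (convolution (smooth_deriv v g) \<mu>) x"
    by (simp add: smooth_apply_convolution)
qed

text \<open>For a fixed first point the kernel depends on the second one only through its position,
  so the pairing with \<mu> sees only the spatial density. This is how the convolution arises from
  the pair interaction.\<close>

lemma partial_pairing_pair_interaction:
  "partial_pairing (pair_interaction g * tensor_one h) \<mu> =
     tensor_one (convolution g (spatial_density \<mu>)) * h"
proof (rule smooth_eqI)
  fix z :: "'a phase"
  have "slice (pair_interaction g * tensor_one h) z =
      smooth_apply h z *\<^sub>R tensor_one (slice (difference_kernel g) (fst z))"
    by (rule smooth_eqI)
      (simp add: slice.rep_eq times_smooth.rep_eq pair_interaction.rep_eq tensor_one.rep_eq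
        scaleR_smooth.rep_eq difference_kernel.rep_eq)
  then show "smooth_apply (partial_pairing (pair_interaction g * tensor_one h) \<mu>) z =
      smooth_apply (tensor_one (convolution g (spatial_density \<mu>)) * h) z"
    by (simp add: smooth_apply_partial_pairing times_smooth.rep_eq tensor_one.rep_eq
        smooth_apply_convolution pairing_spatial_density)
qed

lemma pairing_pair_interaction:
  "\<langle>pair_interaction g * tensor_one h, tensor \<gamma> \<mu>\<rangle> = \<langle>tensor_one (convolution g (spatial_density \<mu>)) * h, \<gamma>\<rangle>"
  by (simp add: pairing_tensor partial_pairing_pair_interaction)

lemma pairing_pair_interaction_one:
  "\<langle>pair_interaction g, tensor \<gamma> \<mu>\<rangle> = \<langle>tensor_one (convolution g (spatial_density \<mu>)), \<gamma>\<rangle>"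
  using pairing_pair_interaction[where g = g and h = 1] by (simp add: tensor_one_simps)

lemma swap_pair_interaction:
  assumes "\<And>x. smooth_apply W (- x) = smooth_apply W x"
  shows "swap (pair_interaction W) = pair_interaction W"
proof (rule smooth_eqI)
  fix z
  show "smooth_apply (swap (pair_interaction W)) z = smooth_apply (pair_interaction W) z"
    using assms[of "fst (fst z) - fst (snd z)"]
    by (simp add: swap.rep_eq pair_interaction.rep_eq case_prod_beta)
qed

section \<open>The Hamiltonian vector field\<close>

lemmas tensor_simps = bilinear_simps[OF polar_bounded_bilinear_tensor]

text \<open>The linear part of the interaction energy is P(\<gamma>, \<mu>) + P(\<mu>, \<gamma>).
  Symmetry turns it into 2 P(\<mu>, \<gamma>), where the variation \<mu> stands in the outer slot
  and the inner pairing with \<gamma> is the convolution with its density.\<close>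

lemma dual_gradient_vlasov_hamiltonian:
  assumes even: "\<And>x. smooth_apply W (- x) = smooth_apply W x"
  shows "dual_gradient (vlasov_hamiltonian W) \<gamma> =
    kinetic_energy + 2 *\<^sub>R tensor_one (convolution W (spatial_density \<gamma>))"
proof (rule dual_gradient_eqI)
  fix \<mu>
  let ?g = "kinetic_energy + 2 *\<^sub>R tensor_one (convolution W (spatial_density \<gamma>))"
  let ?P = "\<lambda>\<gamma> \<mu>. \<langle>pair_interaction W, tensor \<gamma> \<mu>\<rangle>"
  have sym: "?P \<gamma> \<mu> = ?P \<mu> \<gamma>"
    using tensor_commute[where \<Phi> = "pair_interaction W"] swap_pair_interaction[OF even] by simp
  have g: "\<langle>?g, \<mu>\<rangle> = \<langle>kinetic_energy, \<mu>\<rangle> + 2 * ?P \<mu> \<gamma>"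
    by (simp add: pairing_pair_interaction_one)
  have "(vlasov_hamiltonian W (\<gamma> + t *\<^sub>R \<mu>) - vlasov_hamiltonian W \<gamma>) /\<^sub>R t = \<langle>?g, \<mu>\<rangle> + t * ?P \<mu> \<mu>"
    if "t \<noteq> 0" for t
    unfolding g using that sym by (simp add: vlasov_hamiltonian_def tensor_simps field_simps)
  then have ev: "\<forall>\<^sub>F t in at 0. \<langle>?g, \<mu>\<rangle> + t * ?P \<mu> \<mu> =
      (vlasov_hamiltonian W (\<gamma> + t *\<^sub>R \<mu>) - vlasov_hamiltonian W \<gamma>) /\<^sub>R t"
    unfolding eventually_at_filter by (intro always_eventually allI impI) simp
  have "((\<lambda>t. \<langle>?g, \<mu>\<rangle> + t * ?P \<mu> \<mu>) \<longlongrightarrow> \<langle>?g, \<mu>\<rangle> + 0 * ?P \<mu> \<mu>) (at 0)"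
    by (intro tendsto_intros)
  from Lim_transform_eventually[OF this ev]
  show "gateaux_deriv (vlasov_hamiltonian W) \<gamma> \<mu> = \<langle>?g, \<mu>\<rangle>"
    by (intro gateaux_derivI) simp
qed

section \<open>The Vlasov vector field and its identification\<close>

definition transport_field :: "'d::finite phase distr \<Rightarrow> 'd phase distr" where
  "transport_field \<gamma> = - (\<Sum>i\<in>UNIV. distr_mult (velocity i) (distr_deriv (x_dir i) \<gamma>))"

text \<open>The force term in bilinear form: \<mu> supplies the density, \<gamma> is the
  distribution being moved. The Vlasov equation uses the diagonal.\<close>

definition interaction_field :: "(real ^ 'd::finite) smooth \<Rightarrow> 'd phase distr \<Rightarrow> 'd phase distr \<Rightarrow> 'd phase distr" where
  "interaction_field W \<gamma> \<mu> = 2 *\<^sub>R (\<Sum>i\<in>UNIV.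
     distr_mult (tensor_one (convolution (smooth_deriv (axis i 1) W) (spatial_density \<mu>))) (distr_deriv (v_dir i) \<gamma>))"

text \<open>Integration by parts leaves no divergence term, because the i-th velocity component is
  constant in x; likewise the force below is constant in v.\<close>

lemma pairing_transport_field:
  "\<langle>f, transport_field \<gamma>\<rangle> = \<langle>\<Sum>i\<in>UNIV. velocity i * smooth_deriv (x_dir i) f, \<gamma>\<rangle>"
  by (simp add: transport_field_def pairing_sum pairing_sum_left pairing_distr_mult pairing_distr_deriv
      smooth_deriv_mult smooth_deriv_velocity sum_negf)

text \<open>The first form is matched with the Lie bracket. The second exhibits the field as the
  transpose of a fixed operator applied to \<open>tensor \<gamma> \<mu>\<close>, so that joint
  continuity of the tensor product passes to it.\<close>

lemma pairing_interaction_field: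
  fixes \<gamma> \<mu> :: "'d::finite phase distr"
  shows "\<langle>f, interaction_field W \<gamma> \<mu>\<rangle> =
      \<langle>(-2) *\<^sub>R (\<Sum>i\<in>UNIV. tensor_one (convolution (smooth_deriv (axis i 1) W) (spatial_density \<mu>)) * smooth_deriv (v_dir i) f), \<gamma>\<rangle>"
    and pairing_interaction_field_tensor: "\<langle>f, interaction_field W \<gamma> \<mu>\<rangle> =
      \<langle>(-2) *\<^sub>R (\<Sum>i\<in>UNIV. pair_interaction (smooth_deriv (axis i 1) W) * tensor_one (smooth_deriv (v_dir i) f)), tensor \<gamma> \<mu>\<rangle>"
  by (simp_all add: interaction_field_def pairing_sum pairing_sum_left pairing_distr_mult pairing_distr_deriv
      smooth_deriv_mult smooth_deriv_tensor_one smooth_deriv_zero_direction tensor_one_simps sum_negf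
      pairing_pair_interaction)

lemma gateaux_smooth_vlasov_field:
  "gateaux_smooth (\<lambda>\<gamma> :: 'd::finite phase distr. transport_field \<gamma> + interaction_field W \<gamma> \<gamma>)"
proof (rule gateaux_smooth_quadratic[of transport_field "interaction_field W"])
  show "linear (transport_field :: 'd phase distr \<Rightarrow> _)"
    by (rule linearI_lincomb, rule dual_eqI) (simp add: pairing_transport_field)
  show "linear (\<lambda>\<gamma>. interaction_field W \<gamma> \<mu>)" "linear (interaction_field W \<gamma>)" for \<gamma> \<mu> :: "'d phase distr"
    by (rule linearI_lincomb, rule dual_eqI, simp add: pairing_interaction_field_tensor tensor_simps algebra_simps)+
next
  fix f and \<gamma> :: "'d phase distr" and F :: "('d phase distr \<times> (nat \<Rightarrow> 'd phase distr)) filter"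
  assume lim: "(f \<longlongrightarrow> \<gamma>) F"
  have bounded: "bounded_operator (\<lambda>f :: 'd phase smooth. \<Sum>i\<in>UNIV. velocity i * smooth_deriv (x_dir i) f)"
    by (intro bounded_operator_sum bounded_operator_compose[OF bounded_operator_mult bounded_operator_smooth_deriv]) auto
  show "((\<lambda>x. transport_field (f x)) \<longlongrightarrow> transport_field \<gamma>) F"
    by (rule tendsto_transpose[OF bounded lim]) (rule pairing_transport_field)+
next
  fix f g and \<gamma> \<mu> :: "'d phase distr" and F :: "('d phase distr \<times> (nat \<Rightarrow> 'd phase distr)) filter"
  assume "(f \<longlongrightarrow> \<gamma>) F" "(g \<longlongrightarrow> \<mu>) F"
  from tendsto_bilinear[OF polar_bounded_bilinear_tensor this]
  have lim: "((\<lambda>x. tensor (f x) (g x)) \<longlongrightarrow> tensor \<gamma> \<mu>) F" .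
  have bounded: "bounded_operator (\<lambda>f :: 'd phase smooth. (-2) *\<^sub>R (\<Sum>i\<in>UNIV.
      pair_interaction (smooth_deriv (axis i 1) W) * (tensor_one (smooth_deriv (v_dir i) f) :: ('d phase \<times> 'd phase) smooth)))"
    by (intro bounded_operator_scaleR bounded_operator_sum bounded_operator_compose[OF bounded_operator_mult]
        bounded_operator_compose[OF bounded_operator_tensor_one bounded_operator_smooth_deriv]) auto
  show "((\<lambda>x. interaction_field W (f x) (g x)) \<longlongrightarrow> interaction_field W \<gamma> \<mu>) F"
    by (rule tendsto_transpose[OF bounded lim]) (rule pairing_interaction_field_tensor)+
qed

lemma
  fixes f :: "'a::euclidean_space smooth"
  shows gateaux_smooth_pairing: "gateaux_smooth (\<lambda>\<gamma>. \<langle>f, \<gamma>\<rangle>)"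
    and gateaux_deriv_pairing: "gateaux_deriv (\<lambda>\<gamma>. \<langle>f, \<gamma>\<rangle>) \<gamma> \<mu> = \<langle>f, \<mu>\<rangle>"
proof -
  have lin: "linear (\<lambda>\<gamma>. \<langle>f, \<gamma>\<rangle>)" by (rule linearI_lincomb) simp
  have "gateaux_smooth (\<lambda>\<gamma>. \<langle>f, \<gamma>\<rangle> + (0 :: real))"
    by (rule gateaux_smooth_quadratic[where Q = "\<lambda>_ _. 0", OF lin])
      (simp_all add: linear_zero tendsto_pairing)
  then show "gateaux_smooth (\<lambda>\<gamma>. \<langle>f, \<gamma>\<rangle>)" by simp
  have "\<forall>\<^sub>F t in at 0. \<langle>f, \<mu>\<rangle> = (\<langle>f, \<gamma> + t *\<^sub>R \<mu>\<rangle> - \<langle>f, \<gamma>\<rangle>) /\<^sub>R t"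
    by (simp add: eventually_at_filter)
  from Lim_transform_eventually[OF tendsto_const this]
  show "gateaux_deriv (\<lambda>\<gamma>. \<langle>f, \<gamma>\<rangle>) \<gamma> \<mu> = \<langle>f, \<mu>\<rangle>" by (rule gateaux_derivI)
qed

lemma hamiltonian_vector_field_vlasov:
  fixes W :: "(real ^ 'd::finite) smooth"
  assumes even: "\<And>x. smooth_apply W (- x) = smooth_apply W x"
  shows "hamiltonian_vector_field (vlasov_hamiltonian W) = (\<lambda>\<gamma>. transport_field \<gamma> + interaction_field W \<gamma> \<gamma>)"
    (is "_ = ?X")
proof -
  \<comment> \<open>The defining identity involves F only through its gradient. This identity for
    every f therefore gives existence, with f the gradient of F, and uniqueness, with F the pairing
    with f.\<close>
  have bracket: "\<langle>f, ?X \<gamma>\<rangle> = \<langle>lie_bracket f (dual_gradient (vlasov_hamiltonian W) \<gamma>), \<gamma>\<rangle>" for f \<gamma>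
  proof -
    let ?c = "\<lambda>i. tensor_one (convolution (smooth_deriv (axis i 1) W) (spatial_density \<gamma>)) :: 'd phase smooth"
    let ?g = "dual_gradient (vlasov_hamiltonian W) \<gamma>"
    have "smooth_deriv (v_dir i) ?g = velocity i" "smooth_deriv (x_dir i) ?g = 2 *\<^sub>R ?c i" for i
      unfolding dual_gradient_vlasov_hamiltonian[OF even] smooth_deriv_simps smooth_deriv_kinetic_energy
        smooth_deriv_tensor_one
      by (simp_all add: smooth_deriv_zero_direction tensor_one_simps flip: smooth_deriv_convolution)
    then have "lie_bracket f ?g = (\<Sum>i\<in>UNIV. smooth_deriv (x_dir i) f * velocity i) -
        (\<Sum>i\<in>UNIV. smooth_deriv (v_dir i) f * 2 *\<^sub>R ?c i)"
      by (simp add: lie_bracket_def)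
    then show ?thesis
      by (simp add: pairing_transport_field pairing_interaction_field pairing_sum_left mult.commute sum_distrib_left)
  qed
  show ?thesis
    unfolding hamiltonian_vector_field_def lie_poisson_bracket_def
  proof (rule the_equality)
    show "gateaux_smooth ?X \<and> (\<forall>F. gateaux_smooth F \<longrightarrow> (\<forall>\<gamma>. gateaux_deriv F \<gamma> (?X \<gamma>) =
        \<langle>lie_bracket (dual_gradient F \<gamma>) (dual_gradient (vlasov_hamiltonian W) \<gamma>), \<gamma>\<rangle>))"
    proof (intro conjI allI impI)
      fix F :: "'d phase distr \<Rightarrow> real" and \<gamma>
      assume F: "gateaux_smooth F"
      show "gateaux_deriv F \<gamma> (?X \<gamma>) =
          \<langle>lie_bracket (dual_gradient F \<gamma>) (dual_gradient (vlasov_hamiltonian W) \<gamma>), \<gamma>\<rangle>"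
        unfolding gateaux_deriv_eq_dual_gradient[OF F] by (rule bracket)
    qed (rule gateaux_smooth_vlasov_field)
  next
    fix X
    assume X: "gateaux_smooth X \<and> (\<forall>F. gateaux_smooth F \<longrightarrow> (\<forall>\<gamma>. gateaux_deriv F \<gamma> (X \<gamma>) =
        \<langle>lie_bracket (dual_gradient F \<gamma>) (dual_gradient (vlasov_hamiltonian W) \<gamma>), \<gamma>\<rangle>))"
    have "\<langle>f, X \<gamma>\<rangle> = \<langle>f, ?X \<gamma>\<rangle>" for f \<gamma>
    proof -
      have "dual_gradient (\<lambda>\<gamma>. \<langle>f, \<gamma>\<rangle>) \<gamma> = f"
        by (rule dual_gradient_eqI) (rule gateaux_deriv_pairing)
      then show ?thesis
        using X[THEN conjunct2, rule_format, OF gateaux_smooth_pairing[of f], of \<gamma>]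
        by (simp only: bracket gateaux_deriv_pairing)
    qed
    then show "X = ?X" by (intro ext dual_eqI)
  qed
qed

theorem proposition2p13:
  fixes W :: "(real ^ 'd::finite) smooth"
    and a b :: real
    and \<gamma> :: "real \<Rightarrow> 'd phase distr"
  assumes even: "\<And>x. smooth_apply W (- x) = smooth_apply W x"
    and interval: "a < b"
    and smooth_curve: "smooth_curve_on {a..b} \<gamma>"
  shows "vlasov_solution W {a..b} \<gamma> \<longleftrightarrow>
    (\<forall>t\<in>{a..b}. curve_deriv {a..b} \<gamma> t =
        hamiltonian_vector_field (vlasov_hamiltonian W) (\<gamma> t))"
proof -
  \<comment> \<open>With the vector field computed, the two equations at time t differ only by
    moving terms across the equality.\<close>
  have "x + s - r = 0 \<longleftrightarrow> x = - s + r" for x s r :: "'d phase distr"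
    by (auto simp: algebra_simps eq_neg_iff_add_eq_0)
  then show ?thesis
    unfolding vlasov_solution_def hamiltonian_vector_field_vlasov[OF even] transport_field_def
      interaction_field_def by simp
qed

end
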